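(* Let $L\ge2$ and suppose that $\gamma\to\infty$ and $d_i\to\infty$ with $d_i\sim c_i\frac{\log\gamma}{I_i}$ for constants $c_i\in[0,\infty]$, $1\le i\le L-1$, and set $c_L=\infty$. Let $h=\min\{1\le j\le L:\sum_{i=1}^{j}c_i\ge1\}$ and $$D_\gamma=\log\gamma\left(\sum_{i=1}^{h-1}\frac{c_i}{I_i}+\frac{1-\sum_{i=1}^{h-1}c_i}{I_h}\right).$$ (i) If there exists $b=b(\gamma)\sim\log\gamma$ such that the D-CuSum stopping time satisfies $\mathbb{E}_\infty[\widehat\tau(b)]\ge\gamma$, then (for such $b$), as $\gamma\to\infty$, $$J^{\boldsymbol d}_{\mathrm L}(\widehat\tau(b))\sim\inf_{\tau\in\mathcal C_\gamma}J^{\boldsymbol d}_{\mathrm L}(\tau)\sim J^{\boldsymbol d}_{\mathrm P}(\widehat\tau(b))\sim\inf_{\tau\in\mathcal C_\gamma}J^{\boldsymbol d}_{\mathrm P}(\tau)\sim D_\gamma.$$ (ii) If the weights $\rho_i\in(0,1)$, $1\le i\le L-1$, of the WD-CuSum algorithm are chosen so that $\rho_i\to0$ and $\frac{-\log\rho_i}{b}\to0$ as $b\to\infty$, and $b=b(\gamma)\sim\log\gamma$ is chosen such that $\mathbb{E}_\infty[\widetilde\tau(b)]\ge\gamma$, then, as $\gamma\to\infty$, $$J^{\boldsymbol d}_{\mathrm L}(\widetilde\tau(b))\sim\inf_{\tau\in\mathcal C_\gamma}J^{\boldsymbol d}_{\mathrm L}(\tau)\sim J^{\boldsymbol d}_{\mathrm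 P}(\widetilde\tau(b))\sim\inf_{\tau\in\mathcal C_\gamma}J^{\boldsymbol d}_{\mathrm P}(\tau)\sim D_\gamma.$$
   Context: Model. Let $L$ be a known integer and $f_0,f_1,\dots,f_L$ known probability densities with respect to a common measure. For each $1\le i\le L$ the Kullback-Leibler divergence $I_i=\int f_i\log\frac{f_i}{f_0}$ is assumed positive and finite. Independent random variables $X_1,X_2,\dots$ are observed sequentially, $\mathcal F_k=\sigma(X_1,\dots,X_k)$. For a change-point $v_1\ge1$ and a vector of transient durations $\boldsymbol d=(d_1,\dots,d_{L-1})$ of nonnegative integers, set $v_0=1$, $v_{i+1}=v_i+d_i$ for $1\le i\le L-1$, and $v_{L+1}=\infty$. Under $\mathbb{P}^{\boldsymbol d}_{v_1}$ (expectation $\mathbb{E}^{\boldsymbol d}_{v_1}$) the $X_k$ are independent with $X_k\sim f_i$ if $v_i\le k<v_{i+1}$, $0\le i\le L$. Under $\mathbb{P}_\infty$ (expectation $\mathbb{E}_\infty$) all $X_k$ are i.i.d. with density $f_0$. For $\gamma>1$, $\mathcal C_\gamma$ is the set of $\{\mathcal F_k\}$-stopping times $\tau$ with $\mathbb{E}_\infty[\tau]\ge\gamma$. Worst-case average detection delays: $J^{\boldsymbol d}_{\mathrm P}(\tau)=\sup_{v_1\ge1}\mathbb{E}^{\boldsymbol d}_{v_1}[\tau-v_1\mid\tau\ge v_1]$ (Pollak) and $J^{\boldsymbol d}_{\mathrm L}(\tau)=\sup_{v_1\ge1}\operatorname{ess\,sup}\mathbb{E}^{\boldsymbol d}_{v_1}[(\tau-v_1)^+\mid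 X_1,\dots,X_{v_1-1}]$ (Lorden). D-CuSum: for $1\le v_1\le k$ and $\boldsymbol d\in\mathbb N^{L-1}$ (with $0\in\mathbb N$), let $\Gamma(k,v_1,\boldsymbol d)=\prod_{i=1}^{L}\prod_{j=v_i}^{\min\{v_{i+1}-1,k\}}\frac{f_i(X_j)}{f_0(X_j)}$ (empty products equal $1$) be the likelihood ratio of $X_1,\dots,X_k$ under $\mathbb{P}^{\boldsymbol d}_{v_1}$ versus $\mathbb{P}_\infty$. Put $\widehat W[k]=\max_{1\le v_1\le k}\max_{\boldsymbol d\in\mathbb N^{L-1}}\log\Gamma(k,v_1,\boldsymbol d)$ and, for $b>0$, $\widehat\tau(b)=\inf\{k\ge1:\widehat W[k]>b\}$. WD-CuSum: given $\rho_1,\dots,\rho_{L-1}\in(0,1)$, put $\rho_L=0$, $v_{L+1}=\infty$, and $$(\widetilde W[k])^+=\max_{1\le v_1\le v_2\le\cdots\le v_L\le k+1}\log\left(\frac{\prod_{i=1}^{L}B_i}{\prod_{j=v_1}^{k}f_0(X_j)}\right),\qquad B_i=\left(\prod_{j=v_i}^{\min\{v_{i+1}-1,k\}}f_i(X_j)(1-\rho_i)\right)\rho_i^{\mathbf 1\{k\ge v_{i+1}\}},$$ with $0^0=1$. For $b>0$, $\widetilde\tau(b)=\inf\{k\ge1:\widetilde W[k]\ge b\}$; since $b>0$, $\widetilde W[k]$ may be replaced by its positive part $(\widetilde W[k])^+$. Conventions: $g\sim h$ means $g/h\to1$; $d_i\sim c_i\log\gamma/I_i$ means $d_iI_i/\log\gamma\to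 c_i$ (with $c_i=0$ meaning $d_i=o(\log\gamma)$ and $c_i=\infty$ meaning $\log\gamma=o(d_i)$). *)

theory Defs
  imports "HOL-Probability.Probability"
begin

text \<open>A tuple of change-points is a function \<open>v\<close> on indices; only \<open>v 1, \<dots>, v L\<close>
  (and \<open>v 0 = 1\<close> in \<open>change_point\<close>) are relevant. The value \<open>v (L + 1) = \<infinity>\<close> is never
  represented; it is encoded by the guard \<open>i < L\<close>. Likewise a duration vector \<open>d\<close> is a
  function of which only \<open>d 1, \<dots>, d (L - 1)\<close> are used.\<close>

definition change_point :: "nat \<Rightarrow> (nat \<Rightarrow> nat) \<Rightarrow> nat \<Rightarrow> nat" where
  "change_point v1 d i = (if i = 0 then 1 else v1 + (\<Sum>j = 1..<i. d j))"

definition segment :: "nat \<Rightarrow> (nat \<Rightarrow> nat) \<Rightarrow> nat \<Rightarrow> nat set" where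
  "segment L v i = {j. v i \<le> j \<and> (i < L \<longrightarrow> j < v (Suc i))}"

text \<open>\<open>KL_divergence\<close> is a Bochner integral with a default value, so a finite divergence is
  expressed by absolute continuity together with integrability of the log-density.\<close>

definition KL_info :: "'a measure \<Rightarrow> (nat \<Rightarrow> 'a \<Rightarrow> real) \<Rightarrow> nat \<Rightarrow> real" where
  "KL_info M f i = KL_divergence (exp 1) (density M (f 0)) (density M (f i))"

definition finite_KL :: "'a measure \<Rightarrow> (nat \<Rightarrow> 'a \<Rightarrow> real) \<Rightarrow> nat \<Rightarrow> bool" where
  "finite_KL M f i \<longleftrightarrow>
     absolutely_continuous (density M (f 0)) (density M (f i)) \<and>
     integrable (density M (f i)) (entropy_density (exp 1) (density M (f 0)) (density M (f i)))"

text \<open>\<open>M\<close> is the common reference measure of the densities, \<open>Pinf\<close> is the law without a change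
  and \<open>P d v\<close> the law with first change-point \<open>v\<close> and transient durations \<open>d\<close>. All of them live
  on one measurable space, on which the observations \<open>X 1, X 2, \<dots>\<close> are defined (\<open>X 0\<close> is unused).\<close>

locale transient_change_model =
  fixes L :: nat
    and M :: "'a measure"
    and f :: "nat \<Rightarrow> 'a \<Rightarrow> real"
    and X :: "nat \<Rightarrow> 'w \<Rightarrow> 'a"
    and Pinf :: "'w measure"
    and P :: "(nat \<Rightarrow> nat) \<Rightarrow> nat \<Rightarrow> 'w measure"
  assumes density_measurable: "\<And>i. i \<le> L \<Longrightarrow> f i \<in> borel_measurable M"
    and density_nonneg: "\<And>i x. i \<le> L \<Longrightarrow> x \<in> space M \<Longrightarrow> 0 \<le> f i x"
    and density_total: "\<And>i. i \<le> L \<Longrightarrow> (\<integral>\<^sup>+ x. ennreal (f i x) \<partial>M) = 1"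
    and KL_finite: "\<And>i. i \<in> {1..L} \<Longrightarrow> finite_KL M f i"
    and KL_pos: "\<And>i. i \<in> {1..L} \<Longrightarrow> 0 < KL_info M f i"
    and prob_space_Pinf: "prob_space Pinf"
    and indep_Pinf: "prob_space.indep_vars Pinf (\<lambda>_. M) X {1..}"
    and law_Pinf: "\<And>k. 1 \<le> k \<Longrightarrow> distributed Pinf M (X k) (\<lambda>x. ennreal (f 0 x))"
    and sets_P: "\<And>d v. 1 \<le> v \<Longrightarrow> sets (P d v) = sets Pinf"
    and prob_space_P: "\<And>d v. 1 \<le> v \<Longrightarrow> prob_space (P d v)"
    and indep_P: "\<And>d v. 1 \<le> v \<Longrightarrow> prob_space.indep_vars (P d v) (\<lambda>_. M) X {1..}"
    and law_P: "\<And>d v i k. 1 \<le> v \<Longrightarrow> i \<le> L \<Longrightarrow> 1 \<le> k \<Longrightarrow> k \<in> segment L (change_point v d) i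
      \<Longrightarrow> distributed (P d v) M (X k) (\<lambda>x. ennreal (f i x))"

text \<open>The \<open>\<sigma>\<close>-algebra generated by \<open>X 1, \<dots>, X t\<close>; the time index is extended by \<open>\<infinity>\<close> so that
  stopping times may be infinite. Only the space of \<open>Q\<close> matters.\<close>

definition obs_filtration :: "'w measure \<Rightarrow> 'a measure \<Rightarrow> (nat \<Rightarrow> 'w \<Rightarrow> 'a) \<Rightarrow> enat \<Rightarrow> 'w measure" where
  "obs_filtration Q M X t =
     sigma (space Q) {X j -` A \<inter> space Q | j A. 1 \<le> j \<and> enat j \<le> t \<and> A \<in> sets M}"

definition false_alarm_time :: "'w measure \<Rightarrow> ('w \<Rightarrow> enat) \<Rightarrow> ennreal" where
  "false_alarm_time Pinf \<tau> = (\<integral>\<^sup>+ \<omega>. ennreal_of_enat (\<tau> \<omega>) \<partial>Pinf)"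

definition admissible :: "'w measure \<Rightarrow> 'a measure \<Rightarrow> (nat \<Rightarrow> 'w \<Rightarrow> 'a) \<Rightarrow> real \<Rightarrow> ('w \<Rightarrow> enat) set" where
  "admissible Pinf M X \<gamma> =
     {\<tau>. stopping_time (obs_filtration Pinf M X) \<tau> \<and> ennreal \<gamma> \<le> false_alarm_time Pinf \<tau>}"

text \<open>In the two delays, \<open>Q v\<close> is the law with first change-point \<open>v\<close>. Subtraction on \<open>enat\<close> is
  truncated, so it is the positive part. Since \<open>0 / 0 = 0\<close> in \<open>ennreal\<close>, change-points with
  \<open>\<tau> \<ge> v\<close> of probability zero do not contribute to the first supremum.\<close>

definition pollak_delay :: "(nat \<Rightarrow> 'w measure) \<Rightarrow> ('w \<Rightarrow> enat) \<Rightarrow> ennreal" where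
  "pollak_delay Q \<tau> =
     (SUP v\<in>{1..}. (\<integral>\<^sup>+ \<omega>. ennreal_of_enat (\<tau> \<omega> - enat v) * indicator {\<omega>. enat v \<le> \<tau> \<omega>} \<omega> \<partial>Q v)
                   / emeasure (Q v) {\<omega> \<in> space (Q v). enat v \<le> \<tau> \<omega>})"

definition lorden_delay :: "'a measure \<Rightarrow> (nat \<Rightarrow> 'w \<Rightarrow> 'a) \<Rightarrow> (nat \<Rightarrow> 'w measure) \<Rightarrow> ('w \<Rightarrow> enat) \<Rightarrow> ennreal" where
  "lorden_delay M X Q \<tau> =
     (SUP v\<in>{1..}. esssup (Q v)
        (nn_cond_exp (Q v) (obs_filtration (Q v) M X (enat (v - 1)))
           (\<lambda>\<omega>. ennreal_of_enat (\<tau> \<omega> - enat v))))"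

text \<open>Logarithm of a nonnegative real with \<open>log 0 = -\<infinity>\<close>, unlike the library's \<open>ln 0 = 0\<close>:
  a likelihood ratio may vanish with positive probability.\<close>

definition elog :: "real \<Rightarrow> ereal" where
  "elog x = (if x \<le> 0 then -\<infinity> else ereal (ln x))"

text \<open>Observations with \<open>f 0 (X j \<omega>) = 0\<close>, where division by zero takes place below, have
  probability zero under all laws of the model.\<close>

definition likelihood_ratio ::
  "nat \<Rightarrow> (nat \<Rightarrow> 'a \<Rightarrow> real) \<Rightarrow> (nat \<Rightarrow> 'w \<Rightarrow> 'a) \<Rightarrow> nat \<Rightarrow> nat \<Rightarrow> (nat \<Rightarrow> nat) \<Rightarrow> 'w \<Rightarrow> real" where
  "likelihood_ratio L f X k v1 d \<omega> =
     (\<Prod>i = 1..L. \<Prod>j \<in> segment L (change_point v1 d) i \<inter> {..k}. f i (X j \<omega>) / f 0 (X j \<omega>))"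

text \<open>The suprema in the two statistics range over only finitely many distinct values, hence are
  maxima.\<close>

definition dcusum_stat :: "nat \<Rightarrow> (nat \<Rightarrow> 'a \<Rightarrow> real) \<Rightarrow> (nat \<Rightarrow> 'w \<Rightarrow> 'a) \<Rightarrow> nat \<Rightarrow> 'w \<Rightarrow> ereal" where
  "dcusum_stat L f X k \<omega> = (SUP v1\<in>{1..k}. SUP d. elog (likelihood_ratio L f X k v1 d \<omega>))"

definition dcusum :: "nat \<Rightarrow> (nat \<Rightarrow> 'a \<Rightarrow> real) \<Rightarrow> (nat \<Rightarrow> 'w \<Rightarrow> 'a) \<Rightarrow> real \<Rightarrow> 'w \<Rightarrow> enat" where
  "dcusum L f X b \<omega> = (INF k\<in>{k. 1 \<le> k \<and> ereal b < dcusum_stat L f X k \<omega>}. enat k)"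

definition weighted_block ::
  "nat \<Rightarrow> (nat \<Rightarrow> 'a \<Rightarrow> real) \<Rightarrow> (nat \<Rightarrow> 'w \<Rightarrow> 'a) \<Rightarrow> (nat \<Rightarrow> real) \<Rightarrow> nat \<Rightarrow> (nat \<Rightarrow> nat) \<Rightarrow> 'w \<Rightarrow> nat \<Rightarrow> real" where
  "weighted_block L f X \<rho> k v \<omega> i =
     (let r = (if i = L then 0 else \<rho> i) in
       (\<Prod>j \<in> segment L v i \<inter> {..k}. f i (X j \<omega>) * (1 - r)) * r ^ of_bool (i < L \<and> v (Suc i) \<le> k))"

text \<open>This is the positive part of the weighted statistic: the choice of all change-points equal
  to \<open>k + 1\<close> contributes \<open>log 1 = 0\<close>.\<close>

definition wdcusum_stat ::
  "nat \<Rightarrow> (nat \<Rightarrow> 'a \<Rightarrow> real) \<Rightarrow> (nat \<Rightarrow> 'w \<Rightarrow> 'a) \<Rightarrow> (nat \<Rightarrow> real) \<Rightarrow> nat \<Rightarrow> 'w \<Rightarrow> ereal" where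
  "wdcusum_stat L f X \<rho> k \<omega> =
     (SUP v\<in>{v. 1 \<le> v 1 \<and> (\<forall>i\<in>{1..<L}. v i \<le> v (Suc i)) \<and> v L \<le> k + 1}.
        elog ((\<Prod>i = 1..L. weighted_block L f X \<rho> k v \<omega> i) / (\<Prod>j = v 1..k. f 0 (X j \<omega>))))"

definition wdcusum ::
  "nat \<Rightarrow> (nat \<Rightarrow> 'a \<Rightarrow> real) \<Rightarrow> (nat \<Rightarrow> 'w \<Rightarrow> 'a) \<Rightarrow> (nat \<Rightarrow> real) \<Rightarrow> real \<Rightarrow> 'w \<Rightarrow> enat" where
  "wdcusum L f X \<rho> b \<omega> = (INF k\<in>{k. 1 \<le> k \<and> ereal b \<le> wdcusum_stat L f X \<rho> k \<omega>}. enat k)"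

definition critical_phase :: "nat \<Rightarrow> (nat \<Rightarrow> ennreal) \<Rightarrow> nat" where
  "critical_phase L c = (LEAST j. 1 \<le> j \<and> j \<le> L \<and> 1 \<le> (\<Sum>i = 1..j. c i))"

text \<open>By minimality of \<open>h\<close> the truncated subtraction on \<open>ennreal\<close> is a genuine one here.\<close>

definition optimal_delay :: "nat \<Rightarrow> (nat \<Rightarrow> ennreal) \<Rightarrow> (nat \<Rightarrow> real) \<Rightarrow> real \<Rightarrow> ennreal" where
  "optimal_delay L c I \<gamma> =
     (let h = critical_phase L c in
       ennreal (ln \<gamma>) *
         ((\<Sum>i = 1..<h. c i / ennreal (I i)) + (1 - (\<Sum>i = 1..<h. c i)) / ennreal (I h)))"

text \<open>The library's \<open>asymp_equiv\<close> requires a normed field, but delays may be infinite. In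
  \<open>ennreal\<close>, \<open>\<infinity> / \<infinity> = 0 / 0 = 0\<close>, so degenerate quotients do not count as equivalent.\<close>

definition delay_equiv :: "(real \<Rightarrow> ennreal) \<Rightarrow> (real \<Rightarrow> ennreal) \<Rightarrow> bool" where
  "delay_equiv g h \<longleftrightarrow> ((\<lambda>\<gamma>. g \<gamma> / h \<gamma>) \<longlongrightarrow> 1) at_top"

end

theory Submission
  imports Defs "HOL-Real_Asymp.Real_Asymp"
begin

text \<open>Write \<open>Z j\<close> for the log-likelihood ratio at time \<open>j\<close> of the true phase against the
  pre-change density. Sums of the \<open>Z j\<close> over windows of length \<open>O(ln \<gamma>)\<close> are within \<open>o(ln \<gamma>)\<close>
  of their means in probability, uniformly in the position of the window (truncation and Hoeffding's
  inequality; only a first moment is available), and the mean accumulated from the change-point on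
  reaches \<open>ln \<gamma>\<close> at the time \<open>optimal_delay\<close>.

  For the lower bound, \<open>E\<^sub>\<infinity> \<tau> \<ge> \<gamma>\<close> forces a window \<open>[v, v + m)\<close> in which \<open>\<tau>\<close> stops
  only with conditional probability \<open>O(m / \<gamma>)\<close> when there is no change. If \<open>m\<close> is
  \<open>(1 - \<epsilon>)\<close> times the optimal delay, the likelihood ratio of that window is at most
  \<open>\<gamma>\<close> to the power \<open>1 - \<theta>\<close> with high probability, so stopping there stays unlikely under the change at \<open>v\<close>.

  For the upper bound, both statistics scan the hypothesis that restricts the true phases to any
  given window after the change. Cut the time after the change into a first block of \<open>(1 + \<epsilon>)\<close>
  times the optimal delay and further blocks of length \<open>O(ln \<gamma>)\<close>: the blocks are independent of each other and
  of the past, and each fails to stop the rule with probability tending to \<open>0\<close>, so the delay after the first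
  block is a geometric series of negligible size.\<close>

subsection \<open>Log-likelihood ratios\<close>

text \<open>Two estimates settle all four delays: a lower bound on the Pollak delay of every
  admissible rule, and an upper bound on the Lorden delay of the given rule. Pollak's delay is at
  most Lorden's and the rule is eventually admissible, so the other quantities lie in between.

  The obstacle is uniformity. The durations change with \<open>\<gamma>\<close>, and both delays are
  suprema over change-points, so no limit theorem along one fixed law applies. The weak law is
  therefore an explicit inequality that sees a window only through its length; one truncation level
  serves all windows because only \<open>L\<close> laws occur after the change.

  Convergence in probability suffices, without a maximal inequality, because likelihood ratios are
  examined only at the ends of windows. In the lower bound, stopping inside a window is an event
  decided at its end, where the change of measure is applied; in the upper bound, a statistic above
  its threshold at the end of a block already forces stopping.

  Later blocks may start in any phase, so their length is governed by the smallest
  divergence.\<close>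

definition trunc :: "real \<Rightarrow> real \<Rightarrow> real" where
  "trunc K y = max (- K) (min K y)"

lemma trunc_bounds: "0 \<le> K \<Longrightarrow> - K \<le> trunc K y \<and> trunc K y \<le> K"
  by (auto simp: trunc_def)

lemma trunc_measurable [measurable]: "trunc K \<in> borel_measurable borel"
  unfolding trunc_def by measurable

lemma abs_trunc_le: "0 \<le> K \<Longrightarrow> \<bar>trunc K y\<bar> \<le> \<bar>y\<bar>"
  by (auto simp: trunc_def)

text \<open>A weak law for variables with a first moment only, as an explicit bound: Hoeffding's
  inequality for the truncated variables, Markov's inequality for the remainders. The laws may
  differ, since a window may meet several phases.\<close>

lemma (in prob_space) truncated_deviation:
  fixes Z :: "'i \<Rightarrow> 'a \<Rightarrow> real" and K \<delta> t :: real
  assumes fin: "finite T" and ne: "T \<noteq> {}"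
    and indep: "indep_vars (\<lambda>_. borel) Z T"
    and int: "\<And>j. j \<in> T \<Longrightarrow> integrable M (Z j)"
    and K: "0 < K"
    and \<delta>: "\<And>j. j \<in> T \<Longrightarrow> expectation (\<lambda>\<omega>. \<bar>Z j \<omega> - trunc K (Z j \<omega>)\<bar>) \<le> \<delta>"
    and t: "0 < t"
  shows "prob {\<omega>\<in>space M. t \<le> \<bar>\<Sum>j\<in>T. Z j \<omega> - expectation (Z j)\<bar>}
           \<le> 2 * exp (- t\<^sup>2 / (8 * real (card T) * K\<^sup>2)) + 4 * \<delta> * real (card T) / t"
proof -
  define g where "g j \<omega> = trunc K (Z j \<omega>)" for j \<omega>
  define r where "r j \<omega> = Z j \<omega> - g j \<omega>" for j \<omega>
  have Zm [measurable]: "Z j \<in> borel_measurable M" if "j \<in> T" for j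
    using int[OF that] by simp
  have gm [measurable]: "g j \<in> borel_measurable M" if "j \<in> T" for j
    unfolding g_def using Zm[OF that] by measurable
  have gint: "integrable M (g j)" if "j \<in> T" for j
    using int[OF that] gm[OF that]
    by (rule Bochner_Integration.integrable_bound) (use K in \<open>auto simp: g_def abs_trunc_le\<close>)
  have rint: "integrable M (r j)" if "j \<in> T" for j
    unfolding r_def using int[OF that] gint[OF that] by (rule Bochner_Integration.integrable_diff)
  interpret H: Hoeffding_ineq M T g "\<lambda>_. - K" "\<lambda>_. K" "\<Sum>j\<in>T. expectation (g j)"
  proof unfold_locales
    show "indep_vars (\<lambda>_. borel) g T"
      unfolding g_def by (intro indep_vars_compose2[OF indep]) measurable
    show "AE x in M. g i x \<in> {- K..K}" for i
      using trunc_bounds[of K] K by (auto simp: g_def)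
  qed (use fin in auto)
  have n: "0 < card T" using fin ne by (simp add: card_gt_0_iff)
  \<comment> \<open>Each part receives half of \<open>t\<close>; intervals of width
    \<open>2 * K\<close> in Hoeffding's exponent then produce the constant 8.\<close>
  have "prob {\<omega>\<in>space M. t / 2 \<le> \<bar>(\<Sum>j\<in>T. g j \<omega>) - (\<Sum>j\<in>T. expectation (g j))\<bar>}
      \<le> 2 * exp (- 2 * (t / 2)\<^sup>2 / (\<Sum>i\<in>T. (K - (- K))\<^sup>2))"
    using t n K by (intro H.Hoeffding_ineq_abs_ge) auto
  also have "- 2 * (t / 2)\<^sup>2 / (\<Sum>i\<in>T. (K - (- K))\<^sup>2) = - t\<^sup>2 / (8 * real (card T) * K\<^sup>2)"
    using n K by (simp add: power2_eq_square field_simps)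
  finally have 1: "prob {\<omega>\<in>space M. t / 2 \<le> \<bar>\<Sum>j\<in>T. g j \<omega> - expectation (g j)\<bar>}
      \<le> 2 * exp (- t\<^sup>2 / (8 * real (card T) * K\<^sup>2))"
    by (simp add: sum_subtractf)
  \<comment> \<open>Centring at most doubles the absolute moment of a remainder; together with the
    threshold \<open>t / 2\<close> this gives the factor 4.\<close>
  let ?R = "\<lambda>\<omega>. \<Sum>j\<in>T. r j \<omega> - expectation (r j)"
  have Rint: "integrable M ?R"
    using rint by (intro Bochner_Integration.integrable_sum Bochner_Integration.integrable_diff) auto
  have "expectation (\<lambda>\<omega>. \<bar>?R \<omega>\<bar>) \<le> expectation (\<lambda>\<omega>. \<Sum>j\<in>T. \<bar>r j \<omega>\<bar> + \<bar>expectation (r j)\<bar>)"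
    using rint Rint
    by (intro integral_mono integrable_abs Bochner_Integration.integrable_sum Bochner_Integration.integrable_add
          order_trans[OF sum_abs] sum_mono abs_triangle_ineq4) auto
  also have "\<dots> = (\<Sum>j\<in>T. expectation (\<lambda>\<omega>. \<bar>r j \<omega>\<bar>) + \<bar>expectation (r j)\<bar>)"
    using rint by (subst Bochner_Integration.integral_sum) (auto simp: prob_space)
  also have "\<dots> \<le> (\<Sum>j\<in>T. \<delta> + \<delta>)"
  proof (intro sum_mono add_mono)
    fix j assume j: "j \<in> T"
    show "expectation (\<lambda>\<omega>. \<bar>r j \<omega>\<bar>) \<le> \<delta>" using \<delta>[OF j] by (simp add: r_def g_def)
    then show "\<bar>expectation (r j)\<bar> \<le> \<delta>" using integral_abs_bound[of M "r j"] by linarith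
  qed
  finally have E: "expectation (\<lambda>\<omega>. \<bar>?R \<omega>\<bar>) \<le> 2 * \<delta> * card T"
    by (simp add: mult_ac)
  have "prob {\<omega>\<in>space M. t / 2 \<le> \<bar>?R \<omega>\<bar>} \<le> expectation (\<lambda>\<omega>. \<bar>?R \<omega>\<bar>) / (t / 2)"
    using Rint t by (intro integral_Markov_inequality_measure[where A="{}"]) auto
  also have "\<dots> \<le> (2 * \<delta> * card T) / (t / 2)"
    using E t by (intro divide_right_mono) auto
  finally have 2: "prob {\<omega>\<in>space M. t / 2 \<le> \<bar>?R \<omega>\<bar>} \<le> 4 * \<delta> * real (card T) / t" by simp
  have split: "(\<Sum>j\<in>T. Z j \<omega> - expectation (Z j)) = (\<Sum>j\<in>T. g j \<omega> - expectation (g j)) + ?R \<omega>" for \<omega>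
  proof -
    have "expectation (r j) = expectation (Z j) - expectation (g j)" if "j \<in> T" for j
      unfolding r_def using int[OF that] gint[OF that] by simp
    then show ?thesis unfolding sum.distrib[symmetric] by (intro sum.cong) (auto simp: r_def)
  qed
  let ?A = "{\<omega>\<in>space M. t / 2 \<le> \<bar>\<Sum>j\<in>T. g j \<omega> - expectation (g j)\<bar>}"
  let ?B = "{\<omega>\<in>space M. t / 2 \<le> \<bar>?R \<omega>\<bar>}"
  have Rm: "?R \<in> borel_measurable M" using Rint by simp
  have AB: "?A \<in> events" "?B \<in> events" using Rm by measurable
  have "prob {\<omega>\<in>space M. t \<le> \<bar>\<Sum>j\<in>T. Z j \<omega> - expectation (Z j)\<bar>} \<le> prob (?A \<union> ?B)"
  proof (intro finite_measure_mono)
    show "?A \<union> ?B \<in> events" using AB by (rule sets.Un)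
  qed (unfold split, auto)
  also have "\<dots> \<le> prob ?A + prob ?B" using AB by (rule measure_Un_le)
  finally show ?thesis using 1 2 by linarith
qed

text \<open>Counting the change-points already passed selects the last of several coinciding ones,
  so empty segments need no special treatment. It also makes plain that moving change-points to the
  border of a window does not alter the phases inside it.\<close>

definition phase :: "nat \<Rightarrow> (nat \<Rightarrow> nat) \<Rightarrow> nat \<Rightarrow> nat" where
  "phase L v j = card {i \<in> {1..L}. v i \<le> j}"

definition phases_ordered :: "nat \<Rightarrow> (nat \<Rightarrow> nat) \<Rightarrow> bool" where
  "phases_ordered L v \<longleftrightarrow> (\<forall>i\<in>{1..<L}. v i \<le> v (Suc i))"

lemma phases_ordered_le:
  assumes "phases_ordered L v" "1 \<le> a" "a \<le> b" "b \<le> L"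
  shows "v a \<le> v b"
  using assms(3,4)
proof (induction b rule: dec_induct)
  case (step n)
  then have "v n \<le> v (Suc n)" using assms(1,2) by (auto simp: phases_ordered_def)
  with step show ?case by simp
qed simp

lemma phase_eqI:
  assumes v: "phases_ordered L v" and i: "1 \<le> i" "i \<le> L" and j: "j \<in> segment L v i"
  shows "phase L v j = i"
proof -
  have "{l \<in> {1..L}. v l \<le> j} = {1..i}"
  proof (intro equalityI subsetI)
    fix l assume l: "l \<in> {l \<in> {1..L}. v l \<le> j}"
    have "\<not> i < l"
    proof
      assume "i < l"
      then have "v (Suc i) \<le> v l" "i < L" using l by (auto intro: phases_ordered_le[OF v])
      then show False using l j by (auto simp: segment_def)
    qed
    then show "l \<in> {1..i}" using l by auto
  next
    fix l assume "l \<in> {1..i}"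
    then have "v l \<le> v i" "l \<in> {1..L}" using i by (auto intro: phases_ordered_le[OF v])
    then show "l \<in> {l \<in> {1..L}. v l \<le> j}" using j by (auto simp: segment_def)
  qed
  then show ?thesis by (simp add: phase_def)
qed

lemma phase_segment:
  assumes v: "phases_ordered L v" and L: "1 \<le> L" and j: "v 1 \<le> j"
  shows "phase L v j \<in> {1..L} \<and> j \<in> segment L v (phase L v j)"
proof -
  let ?S = "{l \<in> {1..L}. v l \<le> j}"
  define i where "i = Max ?S"
  have "1 \<in> ?S" using L j by simp
  then have i: "i \<in> ?S" unfolding i_def by (intro Max_in) auto
  have "j \<in> segment L v i"
  proof -
    have "j < v (Suc i)" if "i < L"
    proof (rule ccontr)
      assume "\<not> j < v (Suc i)"
      then have "Suc i \<in> ?S" using that by auto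
      then have "Suc i \<le> i" unfolding i_def by (intro Max_ge) auto
      then show False by simp
    qed
    then show ?thesis using i by (auto simp: segment_def)
  qed
  moreover from this have "phase L v j = i" using i by (intro phase_eqI[OF v]) auto
  ultimately show ?thesis using i by auto
qed

lemma phases_ordered_change_point: "phases_ordered L (change_point v d)"
  by (auto simp: phases_ordered_def change_point_def)

lemma change_point_1 [simp]: "change_point v d (Suc 0) = v"
  by (simp add: change_point_def)

lemma segment_phase_iff:
  assumes "phases_ordered L v" "1 \<le> L" "v 1 \<le> j" "i \<in> {1..L}"
  shows "j \<in> segment L v i \<longleftrightarrow> phase L v j = i"
  using phase_eqI[of L v i j] phase_segment[of L v j] assms by auto

text \<open>The segments of ordered change-points partition the times from \<open>v 1\<close> on.
  With both arguments kept in \<open>F\<close>, this serves the likelihood ratio and the weighted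
  blocks alike.\<close>

lemma prod_segments:
  fixes F :: "nat \<Rightarrow> nat \<Rightarrow> 'b::comm_monoid_mult"
  assumes v: "phases_ordered L v" and L: "1 \<le> L"
  shows "(\<Prod>i = 1..L. \<Prod>j\<in>segment L v i \<inter> {..k}. F i j) = (\<Prod>j = v 1..k. F (phase L v j) j)"
proof -
  have "(\<Prod>j = v 1..k. F (phase L v j) j)
      = (\<Prod>i = 1..L. \<Prod>j\<in>{j\<in>{v 1..k}. phase L v j = i}. F (phase L v j) j)"
    using phase_segment[OF v L] by (intro prod.group[symmetric]) auto
  also have "\<dots> = (\<Prod>i = 1..L. \<Prod>j\<in>segment L v i \<inter> {..k}. F i j)"
  proof (intro prod.cong refl)
    fix i assume i: "i \<in> {1..L}"
    have "v 1 \<le> v i" using i by (intro phases_ordered_le[OF v]) auto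
    then have "segment L v i \<subseteq> {v 1..}" by (auto simp: segment_def)
    then show "{j \<in> {v 1..k}. phase L v j = i} = segment L v i \<inter> {..k}"
      using segment_phase_iff[OF v L _ i] by auto
    fix j assume "j \<in> segment L v i \<inter> {..k}"
    then show "F (phase L v j) j = F i j"
      using phase_eqI[OF v, of i j] i by auto
  qed
  finally show ?thesis ..
qed

section \<open>Means and deviations of the log-likelihood ratios\<close>

locale transient_change = transient_change_model L M f X Pinf P
  for L and M :: "'a measure" and f and X and Pinf :: "'w measure" and P +
  assumes L_ge: "2 \<le> L"
begin

text \<open>Real-valued, so that means and sums make sense. The default values at zeros of the
  densities concern only null sets of the post-change laws, by \<open>f_pos_AE\<close>.\<close>

definition llr :: "nat \<Rightarrow> 'a \<Rightarrow> real" where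
  "llr i x = ln (f i x / f 0 x)"

abbreviation info :: "nat \<Rightarrow> real" where
  "info \<equiv> KL_info M f"

abbreviation ph :: "(nat \<Rightarrow> nat) \<Rightarrow> nat \<Rightarrow> nat \<Rightarrow> nat" where
  "ph d v \<equiv> phase L (change_point v d)"

lemma f_measurable [measurable]: "i \<le> L \<Longrightarrow> f i \<in> borel_measurable M"
  by (rule density_measurable)

lemma f0_measurable [measurable]: "f 0 \<in> borel_measurable M"
  by (rule density_measurable) simp

lemma llr_measurable [measurable]: "i \<le> L \<Longrightarrow> llr i \<in> borel_measurable M"
  unfolding llr_def by measurable

lemma prob_space_density: "i \<le> L \<Longrightarrow> prob_space (density M (\<lambda>x. ennreal (f i x)))"
  using density_total[of i] density_measurable[of i]
  by (intro prob_spaceI) (simp add: emeasure_density cong: nn_integral_cong)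

text \<open>The absolute continuity contained in \<open>finite_KL\<close> makes the zero set of
  \<open>f 0\<close> null for the law with density \<open>f i\<close>.\<close>

lemma f_zero_if_f0_zero:
  assumes i: "i \<in> {1..L}"
  shows "AE x in M. f 0 x = 0 \<longrightarrow> f i x = 0"
proof -
  have [measurable]: "f i \<in> borel_measurable M" using i by (intro density_measurable) auto
  have ac: "absolutely_continuous (density M (f 0)) (density M (f i))"
    using KL_finite[OF i] by (simp add: finite_KL_def)
  have "AE x in density M (f 0). f 0 x \<noteq> 0"
    by (subst AE_density) auto
  then have "AE x in density M (f i). f 0 x \<noteq> 0"
    by (rule absolutely_continuous_AE[OF _ ac, rotated]) simp
  then have "AE x in M. 0 < ennreal (f i x) \<longrightarrow> f 0 x \<noteq> 0"
    by (subst (asm) AE_density) auto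
  with AE_space show ?thesis
    by eventually_elim (use i density_nonneg[of i] in \<open>auto simp: less_le\<close>)
qed

lemma f_pos_AE:
  assumes i: "i \<in> {1..L}"
  shows "AE x in density M (f i). 0 < f 0 x \<and> 0 < f i x"
proof -
  have [measurable]: "f i \<in> borel_measurable M" using i by (intro density_measurable) auto
  have "AE x in M. 0 < ennreal (f i x) \<longrightarrow> 0 < f 0 x \<and> 0 < f i x"
    using AE_space f_zero_if_f0_zero[OF i]
  proof eventually_elim
    case (elim x)
    then show ?case using density_nonneg[of 0 x] by (cases "f 0 x = 0") auto
  qed
  then show ?thesis by (subst AE_density) auto
qed

text \<open>Where \<open>f 0\<close> vanishes, division by zero returns 0, which is the right value
  because \<open>f i\<close> vanishes there almost everywhere.\<close>

lemma density_ratio: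
  assumes i: "i \<in> {1..L}"
  shows "density (density M (f 0)) (\<lambda>x. ennreal (f i x / f 0 x)) = density M (f i)"
proof -
  have [measurable]: "f i \<in> borel_measurable M" using i by (intro density_measurable) auto
  have "AE x in M. ennreal (f 0 x) * ennreal (f i x / f 0 x) = ennreal (f i x)"
    using AE_space f_zero_if_f0_zero[OF i]
    by eventually_elim (use i density_nonneg[of 0] density_nonneg[of i] in \<open>auto simp: ennreal_mult[symmetric]\<close>)
  then show ?thesis
    by (subst density_density_eq) (auto intro!: density_cong)
qed

text \<open>Links the divergence, defined through the Radon-Nikodym derivative, to the mean of
  \<open>llr\<close>. Uniqueness of the derivative holds almost everywhere for \<open>f 0\<close>
  and passes to \<open>f i\<close> by absolute continuity.\<close>

lemma entropy_density_eq_llr: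
  assumes i: "i \<in> {1..L}"
  shows "AE x in density M (f i). entropy_density (exp 1) (density M (f 0)) (density M (f i)) x = llr i x"
proof -
  have [measurable]: "f i \<in> borel_measurable M" using i by (intro density_measurable) auto
  have ac: "absolutely_continuous (density M (f 0)) (density M (f i))"
    using KL_finite[OF i] by (simp add: finite_KL_def)
  interpret N: prob_space "density M (f 0)" by (rule prob_space_density) simp
  have "AE x in density M (f 0). ennreal (f i x / f 0 x) = RN_deriv (density M (f 0)) (density M (f i)) x"
    by (intro N.RN_deriv_unique density_ratio i) measurable
  then have "AE x in density M (f i). ennreal (f i x / f 0 x) = RN_deriv (density M (f 0)) (density M (f i)) x"
    by (rule absolutely_continuous_AE[OF _ ac, rotated]) simp
  with f_pos_AE[OF i] show ?thesis
  proof eventually_elim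
    case (elim x)
    then have "enn2real (RN_deriv (density M (f 0)) (density M (f i)) x) = f i x / f 0 x"
      by (metis enn2real_ennreal divide_nonneg_nonneg less_imp_le)
    then show ?case by (simp add: entropy_density_def llr_def log_def)
  qed
qed

lemma llr_integrable:
  assumes i: "i \<in> {1..L}"
  shows "integrable (density M (f i)) (llr i)" and "integral\<^sup>L (density M (f i)) (llr i) = info i"
proof -
  have [measurable]: "f i \<in> borel_measurable M" "llr i \<in> borel_measurable M"
    using i by auto
  have m: "entropy_density (exp 1) (density M (f 0)) (density M (f i)) \<in> borel_measurable (density M (f i))"
    using measurable_entropy_density[of "exp 1" "density M (f 0)" "density M (f i)"]
    by (simp add: measurable_def)
  show "integrable (density M (f i)) (llr i)"
    using KL_finite[OF i] m
    by (subst integrable_cong_AE[OF _ _ entropy_density_eq_llr[OF i], symmetric]) (auto simp: finite_KL_def)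
  show "integral\<^sup>L (density M (f i)) (llr i) = info i"
    using m
    by (subst integral_cong_AE[OF _ _ entropy_density_eq_llr[OF i], symmetric])
       (auto simp: KL_info_def KL_divergence_def)
qed

lemma ph_range: "v \<le> j \<Longrightarrow> ph d v j \<in> {1..L}"
  using phase_segment[OF phases_ordered_change_point[of L v d], of j] L_ge by simp

lemma law_ph:
  assumes "1 \<le> v" "v \<le> j"
  shows "distributed (P d v) M (X j) (\<lambda>x. ennreal (f (ph d v j) x))"
  using phase_segment[OF phases_ordered_change_point[of L v d], of j] L_ge assms
  by (intro law_P) auto

lemma law_pre:
  assumes "1 \<le> j" "j < v"
  shows "distributed (P d v) M (X j) (\<lambda>x. ennreal (f 0 x))"
  using L_ge assms by (intro law_P) (auto simp: segment_def change_point_def)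

lemma space_P: "1 \<le> v \<Longrightarrow> space (P d v) = space Pinf"
  using sets_P by (rule sets_eq_imp_space_eq)

lemma X_measurable [measurable]: "1 \<le> j \<Longrightarrow> X j \<in> measurable Pinf M"
  using law_Pinf[of j] by (simp add: distributed_def)

lemma X_measurable_P [measurable]: "1 \<le> v \<Longrightarrow> 1 \<le> j \<Longrightarrow> X j \<in> measurable (P d v) M"
  using X_measurable[of j] sets_P[of v d] measurable_cong_sets[of "P d v" Pinf M M] by simp

lemma
  assumes v: "1 \<le> v" and j: "v \<le> j"
  shows integrable_llr_X: "integrable (P d v) (\<lambda>\<omega>. llr (ph d v j) (X j \<omega>))"
    and expectation_llr_X: "integral\<^sup>L (P d v) (\<lambda>\<omega>. llr (ph d v j) (X j \<omega>)) = info (ph d v j)"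
    and AE_pos_X: "AE \<omega> in P d v. 0 < f 0 (X j \<omega>) \<and> 0 < f (ph d v j) (X j \<omega>)"
proof -
  define i where "i = ph d v j"
  have i: "i \<in> {1..L}" unfolding i_def using ph_range[OF j] .
  have D: "density M (f i) = distr (P d v) M (X j)"
    using law_ph[OF v j, of d] by (simp add: distributed_def i_def)
  have [measurable]: "X j \<in> measurable (P d v) M" "llr i \<in> borel_measurable M" "f i \<in> borel_measurable M"
    using i v j by auto
  show "integrable (P d v) (\<lambda>\<omega>. llr (ph d v j) (X j \<omega>))"
    using llr_integrable(1)[OF i] unfolding D i_def[symmetric] by (subst (asm) integrable_distr_eq) auto
  show "integral\<^sup>L (P d v) (\<lambda>\<omega>. llr (ph d v j) (X j \<omega>)) = info (ph d v j)"
    using llr_integrable(2)[OF i] unfolding D i_def[symmetric] by (subst (asm) integral_distr) auto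
  show "AE \<omega> in P d v. 0 < f 0 (X j \<omega>) \<and> 0 < f (ph d v j) (X j \<omega>)"
    using f_pos_AE[OF i] unfolding D i_def[symmetric] by (subst (asm) AE_distr_iff) auto
qed

text \<open>Dominated convergence for each phase; since there are finitely many phases, one level
  \<open>K\<close> serves all of them.\<close>

lemma truncation_uniform:
  assumes "0 < \<delta>"
  obtains K where "0 < K"
    "\<And>i. i \<in> {1..L} \<Longrightarrow> integral\<^sup>L (density M (f i)) (\<lambda>x. \<bar>llr i x - trunc K (llr i x)\<bar>) \<le> \<delta>"
proof -
  have "(\<lambda>n. integral\<^sup>L (density M (f i)) (\<lambda>x. \<bar>llr i x - trunc (real n) (llr i x)\<bar>))
      \<longlonglongrightarrow> integral\<^sup>L (density M (f i)) (\<lambda>x. 0)" if i: "i \<in> {1..L}" for i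
  proof (rule integral_dominated_convergence)
    have [measurable]: "llr i \<in> borel_measurable M" using i by auto
    show "(\<lambda>x. \<bar>llr i x - trunc (real n) (llr i x)\<bar>) \<in> borel_measurable (density M (f i))" for n
      by measurable
    show "integrable (density M (f i)) (\<lambda>x. 2 * \<bar>llr i x\<bar>)"
      using llr_integrable(1)[OF i] by simp
    show "AE x in density M (f i). norm \<bar>llr i x - trunc (real n) (llr i x)\<bar> \<le> 2 * \<bar>llr i x\<bar>" for n
      using abs_trunc_le[of "real n"] by (intro AE_I2) (smt (verit) of_nat_0_le_iff real_norm_def)
    show "AE x in density M (f i). (\<lambda>n. \<bar>llr i x - trunc (real n) (llr i x)\<bar>) \<longlonglongrightarrow> 0"
    proof (intro AE_I2 tendsto_eventually)
      fix x
      show "\<forall>\<^sub>F n in sequentially. \<bar>llr i x - trunc (real n) (llr i x)\<bar> = 0"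
        using eventually_ge_at_top[of "nat \<lceil>\<bar>llr i x\<bar>\<rceil>"]
        by eventually_elim (auto simp: trunc_def nat_le_iff ceiling_le_iff)
    qed
  qed simp
  then have "\<forall>\<^sub>F n in sequentially. integral\<^sup>L (density M (f i)) (\<lambda>x. \<bar>llr i x - trunc (real n) (llr i x)\<bar>) < \<delta>"
    if "i \<in> {1..L}" for i
    using that assms by (auto dest!: order_tendstoD(2)[where a=\<delta>])
  then have "\<forall>\<^sub>F n in sequentially. \<forall>i\<in>{1..L}. integral\<^sup>L (density M (f i)) (\<lambda>x. \<bar>llr i x - trunc (real n) (llr i x)\<bar>) < \<delta>"
    by (intro eventually_ball_finite) auto
  then have "\<forall>\<^sub>F n in sequentially. 0 < n \<and> (\<forall>i\<in>{1..L}. integral\<^sup>L (density M (f i)) (\<lambda>x. \<bar>llr i x - trunc (real n) (llr i x)\<bar>) < \<delta>)"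
    using eventually_gt_at_top[of "0::nat"] by eventually_elim auto
  then obtain n :: nat where "0 < n" "\<forall>i\<in>{1..L}. integral\<^sup>L (density M (f i)) (\<lambda>x. \<bar>llr i x - trunc (real n) (llr i x)\<bar>) < \<delta>"
    by (auto simp: eventually_sequentially)
  then show ?thesis by (intro that[of "real n"]) (auto intro: less_imp_le)
qed

text \<open>Here \<open>x\<close> stands for \<open>ln \<gamma>\<close>. How large \<open>x\<close>
  must be is fixed before \<open>d\<close>, \<open>v\<close> and \<open>T\<close>, which is possible
  because the bound of \<open>truncated_deviation\<close> involves \<open>T\<close> only through its
  cardinality.\<close>

lemma llr_deviation:
  assumes \<epsilon>: "0 < \<epsilon>" and \<theta>: "0 < \<theta>" and R: "0 < R"
  shows "\<forall>\<^sub>F x :: real in at_top. \<forall>d v T. 1 \<le> v \<longrightarrow> finite T \<longrightarrow> T \<subseteq> {v..} \<longrightarrow> card T \<le> R * x \<longrightarrow>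
    measure (P d v) {\<omega>\<in>space (P d v). \<theta> * x \<le> \<bar>\<Sum>j\<in>T. llr (ph d v j) (X j \<omega>) - info (ph d v j)\<bar>} \<le> \<epsilon>"
proof -
  \<comment> \<open>Makes the Markov term \<open>4 * \<delta> * (R * x) / (\<theta> * x)\<close>
    equal to \<open>\<epsilon> / 2\<close>; the exponential term gets the other half once
    \<open>x\<close> is large.\<close>
  define \<delta> where "\<delta> = \<epsilon> * \<theta> / (8 * R)"
  have \<delta>: "0 < \<delta>" using assms by (simp add: \<delta>_def)
  obtain K where K: "0 < K"
    "\<And>i. i \<in> {1..L} \<Longrightarrow> integral\<^sup>L (density M (f i)) (\<lambda>x. \<bar>llr i x - trunc K (llr i x)\<bar>) \<le> \<delta>"
    using truncation_uniform[OF \<delta>] by blast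
  have "((\<lambda>x. 2 * exp (- (\<theta>\<^sup>2 / (8 * R * K\<^sup>2)) * x)) \<longlongrightarrow> 0) at_top"
    using \<theta> R K(1) by real_asymp
  then have "\<forall>\<^sub>F x in at_top. 2 * exp (- (\<theta>\<^sup>2 / (8 * R * K\<^sup>2)) * x) < \<epsilon> / 2"
    using \<epsilon> by (intro order_tendstoD(2)) auto
  with eventually_gt_at_top[of 0] show ?thesis
  proof eventually_elim
    case (elim x)
    show ?case
    proof (intro allI impI)
      fix d v T
      assume v: "1 \<le> (v::nat)" and T: "finite T" "T \<subseteq> {v..}" "card T \<le> R * x"
      interpret Q: prob_space "P d v" using prob_space_P v .
      show "measure (P d v) {\<omega>\<in>space (P d v). \<theta> * x \<le> \<bar>\<Sum>j\<in>T. llr (ph d v j) (X j \<omega>) - info (ph d v j)\<bar>} \<le> \<epsilon>"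
      proof (cases "T = {}")
        case True
        have "\<not> \<theta> * x \<le> 0" using elim \<theta> by (simp add: not_le)
        then show ?thesis using True \<epsilon> by simp
      next
        case False
        then have n: "0 < card T" using T by (simp add: card_gt_0_iff)
        have "Q.prob {\<omega>\<in>space (P d v). \<theta> * x \<le> \<bar>\<Sum>j\<in>T. llr (ph d v j) (X j \<omega>) - Q.expectation (\<lambda>\<omega>. llr (ph d v j) (X j \<omega>))\<bar>}
          \<le> 2 * exp (- (\<theta> * x)\<^sup>2 / (8 * real (card T) * K\<^sup>2)) + 4 * \<delta> * real (card T) / (\<theta> * x)"
        proof (rule Q.truncated_deviation)
          show "Q.indep_vars (\<lambda>_. borel) (\<lambda>j \<omega>. llr (ph d v j) (X j \<omega>)) T"
          proof (rule Q.indep_vars_compose2[where Y = "\<lambda>j. llr (ph d v j)"])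
            show "Q.indep_vars (\<lambda>_. M) X T"
              using indep_P[OF v, of d] by (rule Q.indep_vars_subset) (use T v in auto)
            show "llr (ph d v j) \<in> borel_measurable M" if "j \<in> T" for j
              using ph_range[of v j d] that T by (intro llr_measurable) auto
          qed
          fix j assume j: "j \<in> T"
          then have vj: "v \<le> j" using T by auto
          define i where "i = ph d v j"
          have i: "i \<in> {1..L}" unfolding i_def using ph_range[OF vj] .
          show "integrable (P d v) (\<lambda>\<omega>. llr (ph d v j) (X j \<omega>))"
            by (rule integrable_llr_X[OF v vj])
          have [measurable]: "X j \<in> measurable (P d v) M" "llr i \<in> borel_measurable M"
            using i v vj by auto
          have D: "density M (f i) = distr (P d v) M (X j)"
            using law_ph[OF v vj, of d] by (simp add: distributed_def i_def)
          have "Q.expectation (\<lambda>\<omega>. \<bar>llr i (X j \<omega>) - trunc K (llr i (X j \<omega>))\<bar>) \<le> \<delta>"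
            using K(2)[OF i] unfolding D by (subst (asm) integral_distr) measurable
          then show "Q.expectation (\<lambda>\<omega>. \<bar>llr (ph d v j) (X j \<omega>) - trunc K (llr (ph d v j) (X j \<omega>))\<bar>) \<le> \<delta>"
            by (simp add: i_def)
        qed (use T False K elim \<theta> in auto)
        also have "(\<lambda>\<omega>. \<Sum>j\<in>T. llr (ph d v j) (X j \<omega>) - Q.expectation (\<lambda>\<omega>. llr (ph d v j) (X j \<omega>)))
            = (\<lambda>\<omega>. \<Sum>j\<in>T. llr (ph d v j) (X j \<omega>) - info (ph d v j))"
          using T v by (intro ext sum.cong refl) (auto simp: expectation_llr_X)
        also have "4 * \<delta> * real (card T) / (\<theta> * x) \<le> 4 * \<delta> * (R * x) / (\<theta> * x)"
          using T \<delta> elim \<theta> by (intro divide_right_mono mult_left_mono) auto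
        also have "\<dots> = \<epsilon> / 2" using elim \<theta> R by (simp add: \<delta>_def field_simps)
        also have "- (\<theta> * x)\<^sup>2 / (8 * real (card T) * K\<^sup>2) \<le> - (\<theta>\<^sup>2 / (8 * R * K\<^sup>2)) * x"
        proof -
          have "(\<theta> * x)\<^sup>2 / (8 * (R * x) * K\<^sup>2) \<le> (\<theta> * x)\<^sup>2 / (8 * real (card T) * K\<^sup>2)"
            using T n K R elim by (intro divide_left_mono mult_right_mono mult_left_mono mult_pos_pos) auto
          moreover have "(\<theta> * x)\<^sup>2 / (8 * (R * x) * K\<^sup>2) = (\<theta>\<^sup>2 / (8 * R * K\<^sup>2)) * x"
            using elim R K by (simp add: power2_eq_square field_simps)
          ultimately show ?thesis by simp
        qed
        finally have "Q.prob {\<omega>\<in>space (P d v). \<theta> * x \<le> \<bar>\<Sum>j\<in>T. llr (ph d v j) (X j \<omega>) - info (ph d v j)\<bar>}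
          \<le> 2 * exp (- (\<theta>\<^sup>2 / (8 * R * K\<^sup>2)) * x) + \<epsilon> / 2"
          by simp
        then show ?thesis using elim by linarith
      qed
    qed
  qed
qed

end

subsection \<open>Change of measure\<close>

text \<open>Passes from integrals over past events to the essential supremum in Lorden's delay. The
  set where the conditional expectation exceeds \<open>c\<close> is itself a past event, and the
  hypothesis on it forces the excess to vanish.\<close>

lemma (in prob_space) nn_cond_exp_le_const:
  fixes g :: "'a \<Rightarrow> ennreal" and c :: ennreal
  assumes sub: "subalgebra M F" and g [measurable]: "g \<in> borel_measurable M"
    and le: "\<And>A. A \<in> sets F \<Longrightarrow> (\<integral>\<^sup>+x. indicator A x * g x \<partial>M) \<le> c * emeasure M A"
    and c: "c \<noteq> \<infinity>"
  shows "AE x in M. nn_cond_exp M F g x \<le> c"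
proof -
  interpret S: finite_measure_subalgebra M F
    by unfold_locales (rule sub)
  define h where "h = nn_cond_exp M F g"
  have hF [measurable]: "h \<in> borel_measurable F" unfolding h_def by simp
  have hM [measurable]: "h \<in> borel_measurable M" using measurable_from_subalg[OF sub hF] .
  define A where "A = {x \<in> space F. c < h x}"
  have AF [measurable]: "A \<in> sets F" unfolding A_def by measurable
  have AM [measurable]: "A \<in> sets M" using AF sub by (auto simp: subalgebra_def)
  have "(\<integral>\<^sup>+x. indicator A x * h x \<partial>M) = (\<integral>\<^sup>+x. indicator A x * g x \<partial>M)"
    unfolding h_def by (rule S.nn_cond_exp_intg) auto
  also have "\<dots> \<le> c * emeasure M A" by (rule le[OF AF])
  finally have 1: "(\<integral>\<^sup>+x. indicator A x * h x \<partial>M) \<le> c * emeasure M A" .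
  have cA: "c * emeasure M A \<noteq> \<infinity>"
    using c by (simp add: ennreal_mult_eq_top_iff)
  \<comment> \<open>Finiteness of \<open>c\<close> allows the integral of the difference to be
    split; the truncated subtraction is a true one because \<open>c\<close> is below
    \<open>h\<close> on \<open>A\<close>.\<close>
  have "(\<integral>\<^sup>+x. indicator A x * h x - c * indicator A x \<partial>M)
      = (\<integral>\<^sup>+x. indicator A x * h x \<partial>M) - (\<integral>\<^sup>+x. c * indicator A x \<partial>M)"
  proof (rule nn_integral_diff)
    show "AE x in M. c * indicator A x \<le> indicator A x * h x"
      by (intro AE_I2) (auto simp: A_def indicator_def)
    show "(\<integral>\<^sup>+ x. c * indicator A x \<partial>M) \<noteq> \<infinity>"
      using cA by (simp add: nn_integral_cmult)
  qed measurable
  also have "\<dots> = 0"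
    using 1 neq_top_trans[OF _ 1] cA by (simp add: nn_integral_cmult diff_eq_0_iff_ennreal less_top)
  finally have "AE x in M. indicator A x * h x - c * indicator A x = 0"
    by (subst (asm) nn_integral_0_iff_AE) auto
  with AE_space show ?thesis unfolding h_def[symmetric]
  proof eventually_elim
    case (elim x)
    show ?case
    proof (rule ccontr)
      assume "\<not> h x \<le> c"
      then have "x \<in> A" using elim sub by (auto simp: A_def subalgebra_def)
      then have "h x - c = 0" using elim by simp
      then show False using \<open>\<not> h x \<le> c\<close> by (simp add: diff_eq_0_iff_ennreal)
    qed
  qed
qed

section \<open>Observation blocks and the likelihood ratio of the laws\<close>

context transient_change
begin

text \<open>Arbitrary sets of times, not only initial segments, so that each block after the change
  has its own \<open>\<sigma>\<close>-algebra. The space of \<open>Pinf\<close> serves for all laws,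
  as they share it.\<close>

definition obs_sigma :: "nat set \<Rightarrow> 'w measure" where
  "obs_sigma T = sigma (space Pinf) {X j -` A \<inter> space Pinf | j A. j \<in> T \<and> A \<in> sets M}"

lemma space_obs_sigma [simp]: "space (obs_sigma T) = space Pinf"
  by (simp add: obs_sigma_def space_measure_of_conv)

lemma sets_obs_sigma:
  "sets (obs_sigma T) = sigma_sets (space Pinf) (\<Union>j\<in>T. {X j -` A \<inter> space Pinf | A. A \<in> sets M})"
proof -
  have "{X j -` A \<inter> space Pinf | j A. j \<in> T \<and> A \<in> sets M} = (\<Union>j\<in>T. {X j -` A \<inter> space Pinf | A. A \<in> sets M})"
    by auto
  then show ?thesis unfolding obs_sigma_def by (subst sets_measure_of) auto
qed

lemma obs_filtration_eq: "obs_filtration Pinf M X (enat k) = obs_sigma {1..k}"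
  unfolding obs_filtration_def obs_sigma_def
  by (intro arg_cong2[where f = sigma] refl) auto

lemma obs_filtration_P: "1 \<le> v \<Longrightarrow> obs_filtration (P d v) M X t = obs_filtration Pinf M X t"
  unfolding obs_filtration_def by (simp add: space_P)

lemma obs_sigma_mono: "S \<subseteq> T \<Longrightarrow> sets (obs_sigma S) \<subseteq> sets (obs_sigma T)"
  unfolding sets_obs_sigma by (intro sigma_sets_mono') auto

lemma X_measurable_obs_sigma:
  assumes "j \<in> T" "1 \<le> j"
  shows "X j \<in> measurable (obs_sigma T) M"
proof (rule measurableI)
  fix A assume "A \<in> sets M"
  then show "X j -` A \<inter> space (obs_sigma T) \<in> sets (obs_sigma T)"
    unfolding sets_obs_sigma using assms by (auto intro!: sigma_sets.Basic)
next
  fix x assume "x \<in> space (obs_sigma T)"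
  then show "X j x \<in> space M"
    using measurable_space[OF X_measurable, of j] assms by simp
qed

lemma sets_obs_sigma_subset:
  assumes "T \<subseteq> {1..}"
  shows "sets (obs_sigma T) \<subseteq> sets Pinf"
  unfolding sets_obs_sigma
proof (rule sets.sigma_sets_subset)
  show "(\<Union>j\<in>T. {X j -` A \<inter> space Pinf |A. A \<in> sets M}) \<subseteq> sets Pinf"
    using assms by (auto intro!: measurable_sets[OF X_measurable])
qed

lemma subalgebra_obs_sigma:
  assumes "T \<subseteq> {1..}" "1 \<le> v"
  shows "subalgebra (P d v) (obs_sigma T)"
  using sets_obs_sigma_subset[OF assms(1)] assms(2) by (simp add: subalgebra_def space_P sets_P)

text \<open>Independence survives grouping by disjoint sets of times, as the preimages under one
  observation are closed under intersection.\<close>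

lemma indep_blocks:
  fixes n :: nat
  assumes v: "1 \<le> v" and T: "\<And>i. i \<le> n \<Longrightarrow> T i \<subseteq> {1..}" "disjoint_family_on T {..n}"
    and E: "\<And>i. i \<le> n \<Longrightarrow> E i \<in> sets (obs_sigma (T i))"
  shows "measure (P d v) (\<Inter>i\<le>n. E i) = (\<Prod>i\<le>n. measure (P d v) (E i))"
proof -
  interpret Q: prob_space "P d v" using prob_space_P v .
  have ind: "Q.indep_sets (\<lambda>j. {X j -` A \<inter> space Pinf | A. A \<in> sets M}) {1..}"
    using indep_P[OF v, of d] by (simp add: Q.indep_vars_def2 space_P[OF v])
  have "Q.indep_sets (\<lambda>i. sigma_sets (space (P d v)) (\<Union>j\<in>T i. {X j -` A \<inter> space Pinf | A. A \<in> sets M})) {..n}"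
  proof (rule Q.indep_sets_collect_sigma)
    show "Q.indep_sets (\<lambda>j. {X j -` A \<inter> space Pinf | A. A \<in> sets M}) (\<Union>j\<le>n. T j)"
      using ind by (rule Q.indep_sets_mono_index[rotated]) (use T(1) in auto)
    fix j
    show "Int_stable {X j -` A \<inter> space Pinf | A. A \<in> sets M}"
    proof (rule Int_stableI)
      fix a b assume "a \<in> {X j -` A \<inter> space Pinf | A. A \<in> sets M}" "b \<in> {X j -` A \<inter> space Pinf | A. A \<in> sets M}"
      then obtain A B where "a = X j -` A \<inter> space Pinf" "b = X j -` B \<inter> space Pinf" "A \<in> sets M" "B \<in> sets M"
        by auto
      then show "a \<inter> b \<in> {X j -` A \<inter> space Pinf | A. A \<in> sets M}"
        by (intro CollectI exI[of _ "A \<inter> B"]) auto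
    qed
  qed (rule T(2))
  then show ?thesis
    by (rule Q.indep_setsD) (use E in \<open>auto simp: sets_obs_sigma space_P[OF v]\<close>)
qed

lemma nn_integral_prod_X:
  assumes Q: "prob_space Q" and ind: "prob_space.indep_vars Q (\<lambda>_. M) X {1..}"
    and u: "\<And>j. j \<in> {1..k} \<Longrightarrow> u j \<in> borel_measurable M"
  shows "(\<integral>\<^sup>+\<omega>. (\<Prod>j = 1..k. u j (X j \<omega>)) \<partial>Q) = (\<Prod>j = 1..k. \<integral>\<^sup>+\<omega>. u j (X j \<omega>) \<partial>Q)"
proof -
  interpret Q: prob_space Q by fact
  show ?thesis
  proof (rule Q.indep_vars_nn_integral)
    have "Q.indep_vars (\<lambda>_. M) X {1..k}"
      using ind by (rule Q.indep_vars_subset) auto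
    then show "Q.indep_vars (\<lambda>_. borel) (\<lambda>j \<omega>. u j (X j \<omega>)) {1..k}"
      by (rule Q.indep_vars_compose2[where Y = u]) (rule u)
  qed auto
qed

abbreviation ratio :: "(nat \<Rightarrow> nat) \<Rightarrow> nat \<Rightarrow> nat \<Rightarrow> 'w \<Rightarrow> ennreal" where
  "ratio d v k \<omega> \<equiv> (\<Prod>j = v..k. ennreal (f (ph d v j) (X j \<omega>) / f 0 (X j \<omega>)))"

lemma nn_integral_X_change:
  assumes v: "1 \<le> v" and j: "1 \<le> j" and u [measurable]: "u \<in> borel_measurable M"
  shows "(\<integral>\<^sup>+\<omega>. u (X j \<omega>) \<partial>P d v)
    = (\<integral>\<^sup>+\<omega>. u (X j \<omega>) * (if v \<le> j then ennreal (f (ph d v j) (X j \<omega>) / f 0 (X j \<omega>)) else 1) \<partial>Pinf)"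
proof -
  have [measurable]: "X j \<in> measurable (P d v) M" "X j \<in> measurable Pinf M" using v j by auto
  have D0: "distr Pinf M (X j) = density M (\<lambda>x. ennreal (f 0 x))"
    using law_Pinf[OF j] by (simp add: distributed_def)
  show ?thesis
  proof (cases "v \<le> j")
    case True
    define i where "i = ph d v j"
    have i: "i \<in> {1..L}" unfolding i_def using ph_range[OF True] .
    then have [measurable]: "f i \<in> borel_measurable M" by auto
    have D: "distr (P d v) M (X j) = density M (\<lambda>x. ennreal (f i x))"
      using law_ph[OF v True, of d] by (simp add: distributed_def i_def)
    have "(\<integral>\<^sup>+\<omega>. u (X j \<omega>) \<partial>P d v) = (\<integral>\<^sup>+x. u x \<partial>distr (P d v) M (X j))"
      by (subst nn_integral_distr) auto
    also have "\<dots> = (\<integral>\<^sup>+x. u x \<partial>density (distr Pinf M (X j)) (\<lambda>x. ennreal (f i x / f 0 x)))"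
      unfolding D D0 density_ratio[OF i] ..
    also have "\<dots> = (\<integral>\<^sup>+x. ennreal (f i x / f 0 x) * u x \<partial>distr Pinf M (X j))"
      by (subst nn_integral_density) auto
    also have "\<dots> = (\<integral>\<^sup>+\<omega>. ennreal (f i (X j \<omega>) / f 0 (X j \<omega>)) * u (X j \<omega>) \<partial>Pinf)"
      by (subst nn_integral_distr) auto
    finally show ?thesis using True by (simp add: i_def mult.commute)
  next
    case False
    have D: "distr (P d v) M (X j) = density M (\<lambda>x. ennreal (f 0 x))"
      using law_pre[of j v d] False j by (simp add: distributed_def)
    have "(\<integral>\<^sup>+\<omega>. u (X j \<omega>) \<partial>P d v) = (\<integral>\<^sup>+x. u x \<partial>distr (P d v) M (X j))"
      by (subst nn_integral_distr) auto
    also have "\<dots> = (\<integral>\<^sup>+x. u x \<partial>distr Pinf M (X j))" by (simp add: D D0)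
    also have "\<dots> = (\<integral>\<^sup>+\<omega>. u (X j \<omega>) \<partial>Pinf)" by (subst nn_integral_distr) auto
    finally show ?thesis using False by simp
  qed
qed

lemma ratio_measurable [measurable]: "1 \<le> v \<Longrightarrow> ratio d v k \<in> borel_measurable Pinf"
proof (intro borel_measurable_prod_ennreal)
  fix j assume "1 \<le> v" "j \<in> {v..k}"
  then have [measurable]: "X j \<in> measurable Pinf M" "f (ph d v j) \<in> borel_measurable M"
    using ph_range[of v j d] by auto
  show "(\<lambda>\<omega>. ennreal (f (ph d v j) (X j \<omega>) / f 0 (X j \<omega>))) \<in> borel_measurable Pinf"
    by measurable
qed

text \<open>Both sides are measures in \<open>G\<close>. On cylinders independence splits them into
  single coordinates, where \<open>nn_integral_X_change\<close> applies; cylinders are closed under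
  intersection and generate the \<open>\<sigma>\<close>-algebra of the first \<open>k\<close>
  observations.\<close>

lemma change_of_measure:
  assumes v: "1 \<le> v" and G: "G \<in> sets (obs_sigma {1..k})"
  shows "emeasure (P d v) G = (\<integral>\<^sup>+\<omega>. ratio d v k \<omega> * indicator G \<omega> \<partial>Pinf)"
proof -
  interpret Q: prob_space "P d v" using prob_space_P v .
  let ?\<Omega> = "space Pinf"
  define E where "E = {{\<omega>\<in>?\<Omega>. \<forall>j\<in>{1..k}. X j \<omega> \<in> A j} | A. \<forall>j. A j \<in> sets M}"
  let ?F = "obs_sigma {1..k}"
  let ?N = "restr_to_subalg (P d v) ?F"
  let ?D = "density Pinf (ratio d v k)"
  let ?N' = "restr_to_subalg ?D ?F"
  have sub: "subalgebra (P d v) ?F" by (rule subalgebra_obs_sigma[OF _ v]) auto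
  have sub': "subalgebra ?D ?F"
    using sets_obs_sigma_subset[of "{1..k}"] by (simp add: subalgebra_def)
  have Xs: "X j \<omega> \<in> space M" if "\<omega> \<in> ?\<Omega>" "1 \<le> j" for j \<omega>
    using measurable_space[OF X_measurable] that by blast
  have EF: "E \<subseteq> sets ?F"
  proof
    fix e assume "e \<in> E"
    then obtain A where A: "\<And>j. A j \<in> sets M" and e: "e = {\<omega>\<in>?\<Omega>. \<forall>j\<in>{1..k}. X j \<omega> \<in> A j}"
      unfolding E_def by auto
    have "{\<omega> \<in> space ?F. \<forall>j\<in>{1..k}. X j \<omega> \<in> A j} \<in> sets ?F"
    proof (rule sets.sets_Collect_finite_All)
      fix j assume j: "j \<in> {1..k}"
      have [measurable]: "X j \<in> measurable ?F M" using j by (intro X_measurable_obs_sigma) auto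
      note A[measurable]
      show "{\<omega> \<in> space ?F. X j \<omega> \<in> A j} \<in> sets ?F" by measurable
    qed auto
    then show "e \<in> sets ?F" unfolding e by simp
  qed
  have sets: "sets ?F = sigma_sets ?\<Omega> E"
  proof (rule antisym)
    show "sigma_sets ?\<Omega> E \<subseteq> sets ?F"
      using sets.sigma_sets_subset[OF EF] by simp
    show "sets ?F \<subseteq> sigma_sets ?\<Omega> E"
      unfolding sets_obs_sigma
    proof (rule sigma_sets_mono, safe)
      fix j A assume j: "j \<in> {1..k}" and A: "A \<in> sets M"
      have "X j -` A \<inter> ?\<Omega> = {\<omega>\<in>?\<Omega>. \<forall>i\<in>{1..k}. X i \<omega> \<in> (if i = j then A else space M)}"
        using j Xs by auto
      also have "\<dots> \<in> E" unfolding E_def using A by (intro CollectI exI[of _ "\<lambda>i. if i = j then A else space M"]) auto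
      finally show "X j -` A \<inter> ?\<Omega> \<in> sigma_sets ?\<Omega> E" by (rule sigma_sets.Basic)
    qed
  qed
  \<comment> \<open>Restricted to \<open>?F\<close>, both measures live on the sets generated by
    \<open>E\<close>, as uniqueness from a generator requires.\<close>
  have "?N = ?N'"
  proof (rule measure_eqI_generator_eq[where E = E and \<Omega> = ?\<Omega> and A = "\<lambda>_. ?\<Omega>"])
    show "Int_stable E"
    proof (rule Int_stableI)
      fix a b assume "a \<in> E" "b \<in> E"
      then obtain A B where "a = {\<omega>\<in>?\<Omega>. \<forall>j\<in>{1..k}. X j \<omega> \<in> A j}" "b = {\<omega>\<in>?\<Omega>. \<forall>j\<in>{1..k}. X j \<omega> \<in> B j}"
        "\<forall>j. A j \<in> sets M" "\<forall>j. B j \<in> sets M"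
        unfolding E_def by auto
      then show "a \<inter> b \<in> E" unfolding E_def by (intro CollectI exI[of _ "\<lambda>j. A j \<inter> B j"]) auto
    qed
    have \<Omega>E: "?\<Omega> \<in> E"
      unfolding E_def using Xs by (intro CollectI exI[of _ "\<lambda>_. space M"]) auto
    then show "range (\<lambda>_. ?\<Omega>) \<subseteq> E" by auto
    fix e assume "e \<in> E"
    then obtain A where A [measurable]: "\<And>j. A j \<in> sets M" and e: "e = {\<omega>\<in>?\<Omega>. \<forall>j\<in>{1..k}. X j \<omega> \<in> A j}"
      unfolding E_def by auto
    have eF: "e \<in> sets ?F" using EF \<open>e \<in> E\<close> by auto
    \<comment> \<open>The factor 1 before \<open>v\<close> extends the ratio to a product over all
      of \<open>{1..k}\<close>, so that it can be merged with the indicator of the cylinder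
      coordinate by coordinate.\<close>
    define r :: "nat \<Rightarrow> 'a \<Rightarrow> ennreal" where
      "r j x = (if v \<le> j then ennreal (f (ph d v j) x / f 0 x) else 1)" for j x
    have r [measurable]: "(\<lambda>x. r j x) \<in> borel_measurable M" for j
    proof (cases "v \<le> j")
      case True
      then have [measurable]: "f (ph d v j) \<in> borel_measurable M" using ph_range[of v j d] by auto
      show ?thesis unfolding r_def using True by simp
    next
      case False
      then show ?thesis by (simp add: r_def)
    qed
    have ind: "indicator e \<omega> = (\<Prod>j = 1..k. indicator (A j) (X j \<omega>) :: ennreal)" if "\<omega> \<in> ?\<Omega>" for \<omega>
    proof (cases "\<forall>j\<in>{1..k}. X j \<omega> \<in> A j")
      case True
      then show ?thesis using that by (simp add: e)
    next
      case False
      then have "(\<Prod>j = 1..k. indicator (A j) (X j \<omega>) :: ennreal) = 0"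
        by (intro prod_zero) (auto simp: indicator_def)
      then show ?thesis using False by (simp add: e)
    qed
    have rr: "(\<Prod>j = 1..k. r j (X j \<omega>)) = ratio d v k \<omega>" for \<omega>
    proof -
      have "ratio d v k \<omega> = (\<Prod>j = v..k. r j (X j \<omega>))"
        by (intro prod.cong) (auto simp: r_def)
      also have "\<dots> = (\<Prod>j = 1..k. r j (X j \<omega>))"
        using v by (intro prod.mono_neutral_left) (auto simp: r_def)
      finally show ?thesis ..
    qed
    have eP: "e \<in> sets (P d v)" using eF sub by (auto simp: subalgebra_def)
    have "emeasure (P d v) e = (\<integral>\<^sup>+\<omega>. indicator e \<omega> \<partial>P d v)" using eP by simp
    also have "\<dots> = (\<integral>\<^sup>+\<omega>. (\<Prod>j = 1..k. indicator (A j) (X j \<omega>)) \<partial>P d v)"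
      using ind space_P[OF v] by (intro nn_integral_cong) auto
    also have "\<dots> = (\<Prod>j = 1..k. \<integral>\<^sup>+\<omega>. indicator (A j) (X j \<omega>) \<partial>P d v)"
      by (rule nn_integral_prod_X[OF prob_space_P[OF v] indep_P[OF v]]) measurable
    also have "\<dots> = (\<Prod>j = 1..k. \<integral>\<^sup>+\<omega>. indicator (A j) (X j \<omega>) * r j (X j \<omega>) \<partial>Pinf)"
      unfolding r_def by (intro prod.cong refl nn_integral_X_change v) auto
    also have "\<dots> = (\<integral>\<^sup>+\<omega>. (\<Prod>j = 1..k. indicator (A j) (X j \<omega>) * r j (X j \<omega>)) \<partial>Pinf)"
      by (rule nn_integral_prod_X[symmetric, OF prob_space_Pinf indep_Pinf, where u = "\<lambda>j x. indicator (A j) x * r j x"]) measurable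
    also have "\<dots> = (\<integral>\<^sup>+\<omega>. ratio d v k \<omega> * indicator e \<omega> \<partial>Pinf)"
      unfolding rr[symmetric] by (intro nn_integral_cong) (simp add: ind prod.distrib mult.commute)
    also have "\<dots> = emeasure ?D e"
      using eP v by (subst emeasure_density) (auto simp: sets_P)
    finally show "emeasure ?N e = emeasure ?N' e"
      unfolding emeasure_restr_to_subalg[OF sub eF] emeasure_restr_to_subalg[OF sub' eF] .
  next
    have "?\<Omega> \<in> sets ?F" using sets.top[of ?F] by simp
    then show "emeasure ?N ?\<Omega> \<noteq> \<infinity>" by (subst emeasure_restr_to_subalg[OF sub]) auto
    show "sets ?N = sigma_sets ?\<Omega> E" unfolding sets_restr_to_subalg[OF sub] by (rule sets)
    show "sets ?N' = sigma_sets ?\<Omega> E" unfolding sets_restr_to_subalg[OF sub'] by (rule sets)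
    show "E \<subseteq> Pow ?\<Omega>" by (auto simp: E_def)
  qed simp
  then have "emeasure ?N G = emeasure ?N' G" by simp
  then have "emeasure (P d v) G = emeasure ?D G"
    unfolding emeasure_restr_to_subalg[OF sub G] emeasure_restr_to_subalg[OF sub' G] .
  moreover have "G \<in> sets Pinf" using G sets_obs_sigma_subset[of "{1..k}"] by auto
  ultimately show ?thesis using v by (simp add: emeasure_density)
qed

end

subsection \<open>Lower bound on the delay\<close>

text \<open>The number of multiples of \<open>m\<close> below \<open>t\<close> is
  \<open>t / m\<close> rounded up. After integration, a mean time is bounded by tail probabilities
  on a grid of step \<open>m\<close>, infinite times included.\<close>

lemma ennreal_of_enat_le_count:
  assumes m: "0 < m"
  shows "ennreal_of_enat t \<le> of_nat m * (\<Sum>j. of_bool (enat (j * m) < t))"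
proof -
  let ?S = "\<Sum>j. of_bool (enat (j * m) < t) :: ennreal"
  have partial: "of_nat n \<le> ?S" if "\<And>j. j < n \<Longrightarrow> enat (j * m) < t" for n
  proof -
    have "of_nat n = (\<Sum>j<n. of_bool (enat (j * m) < t) :: ennreal)"
      using that by simp
    also have "\<dots> \<le> ?S" by (intro sum_le_suminf) auto
    finally show ?thesis .
  qed
  show ?thesis
  proof (cases t)
    case (enat s)
    show ?thesis
    proof (cases "s = 0")
      case False
      define q where "q = Suc ((s - 1) div m)"
      have "enat (j * m) < t" if "j < q" for j
      proof -
        have "j * m \<le> (s - 1) div m * m" using that by (simp add: q_def)
        also have "\<dots> \<le> s - 1" by simp
        finally show ?thesis using False enat by simp
      qed
      then have "of_nat q \<le> ?S" by (rule partial)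
      then have "of_nat m * of_nat q \<le> of_nat m * ?S" by (rule mult_left_mono) simp
      moreover have "s \<le> m * q"
      proof -
        have "s - 1 < m * q" unfolding q_def using m by (simp add: dividend_less_times_div)
        then show ?thesis by simp
      qed
      then have "(of_nat s :: ennreal) \<le> of_nat (m * q)" by (subst of_nat_le_iff)
      ultimately show ?thesis using enat by simp
    qed (use enat in \<open>simp add: zero_enat_def[symmetric]\<close>)
  next
    case infinity
    have "?S = \<infinity>"
    proof (rule ccontr)
      assume "?S \<noteq> \<infinity>"
      then obtain n :: nat where "?S < of_nat n"
        using ennreal_Ex_less_of_nat[of ?S] by (auto simp: less_top)
      then show False using partial[of n] infinity by simp
    qed
    then show ?thesis using m by (simp add: ennreal_mult_top)
  qed
qed

context transient_change
begin

lemma stopping_time_le: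
  assumes "stopping_time (obs_filtration Pinf M X) \<tau>"
  shows "{\<omega>\<in>space Pinf. \<tau> \<omega> \<le> enat k} \<in> sets (obs_sigma {1..k})"
proof -
  have "Measurable.pred (obs_sigma {1..k}) (\<lambda>\<omega>. \<tau> \<omega> \<le> enat k)"
    using assms unfolding stopping_time_def obs_filtration_eq[symmetric] by blast
  then show ?thesis by (simp add: pred_def)
qed

text \<open>Reaching \<open>v\<close> means not having stopped by \<open>v - 1\<close>, so it is
  decided before the first post-change observation.\<close>

lemma stopping_time_ge:
  assumes "stopping_time (obs_filtration Pinf M X) \<tau>" "1 \<le> v"
  shows "{\<omega>\<in>space Pinf. enat v \<le> \<tau> \<omega>} \<in> sets (obs_sigma {1..v - 1})"
proof -
  have "\<tau> \<omega> \<le> enat (v - 1) \<longleftrightarrow> \<not> enat v \<le> \<tau> \<omega>" for \<omega>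
    using assms(2) by (cases "\<tau> \<omega>") auto
  then have "{\<omega>\<in>space Pinf. enat v \<le> \<tau> \<omega>} = space (obs_sigma {1..v - 1}) - {\<omega>\<in>space Pinf. \<tau> \<omega> \<le> enat (v - 1)}"
    by auto
  then show ?thesis using stopping_time_le[OF assms(1)] by (metis sets.compl_sets)
qed

lemma stopping_time_measurable:
  assumes "stopping_time (obs_filtration Pinf M X) \<tau>"
  shows "\<tau> \<in> measurable Pinf (count_space UNIV)"
proof (subst measurable_count_space_eq2_countable)
  have eq: "\<tau> \<omega> = a \<longleftrightarrow> (\<forall>i. \<tau> \<omega> \<le> enat i \<longleftrightarrow> a \<le> enat i)" for \<omega> a
  proof
    assume h: "\<forall>i. \<tau> \<omega> \<le> enat i \<longleftrightarrow> a \<le> enat i"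
    show "\<tau> \<omega> = a"
    proof (cases "\<tau> \<omega>")
      case (enat n)
      then show ?thesis using h[rule_format, of n] h[rule_format, of "the_enat a"]
        by (cases a) auto
    next
      case infinity
      then show ?thesis using h[rule_format, of "the_enat a"] by (cases a) auto
    qed
  qed simp
  have [measurable]: "{\<omega>\<in>space Pinf. \<tau> \<omega> \<le> enat k} \<in> sets Pinf" for k
    using stopping_time_le[OF assms, of k] sets_obs_sigma_subset[of "{1..k}"] by auto
  have "\<tau> -` {a} \<inter> space Pinf = {\<omega>\<in>space Pinf. \<forall>i. \<tau> \<omega> \<le> enat i \<longleftrightarrow> a \<le> enat i}" for a
    using eq by auto
  moreover have "{\<omega>\<in>space Pinf. \<forall>i. \<tau> \<omega> \<le> enat i \<longleftrightarrow> a \<le> enat i} \<in> sets Pinf" for a by measurable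
  ultimately show "\<tau> \<in> space Pinf \<rightarrow> UNIV \<and> (\<forall>a\<in>UNIV. \<tau> -` {a} \<inter> space Pinf \<in> sets Pinf)"
    by simp
qed

lemma stopping_time_measurable_P:
  assumes "stopping_time (obs_filtration Pinf M X) \<tau>" "1 \<le> v"
  shows "\<tau> \<in> measurable (P d v) (count_space UNIV)"
  using stopping_time_measurable[OF assms(1)] measurable_cong_sets[OF sets_P[OF assms(2), of d] refl] by blast

text \<open>Iterating \<open>decay\<close> along the grid \<open>1 + j * m\<close> gives a geometric
  tail with sum \<open>1 / \<delta>\<close>. It is used contrapositively: a larger mean means that
  \<open>decay\<close> fails somewhere.\<close>

lemma false_alarm_time_le:
  assumes st: "stopping_time (obs_filtration Pinf M X) \<tau>" and m: "0 < m"
    and \<delta>: "0 < \<delta>" "\<delta> \<le> 1"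
    and decay: "\<And>v. 1 \<le> v \<Longrightarrow> measure Pinf {\<omega>\<in>space Pinf. enat (v + m) \<le> \<tau> \<omega>}
        \<le> (1 - \<delta>) * measure Pinf {\<omega>\<in>space Pinf. enat v \<le> \<tau> \<omega>}"
  shows "false_alarm_time Pinf \<tau> \<le> ennreal (m / \<delta>)"
proof -
  interpret Q: prob_space Pinf by (rule prob_space_Pinf)
  note [measurable] = stopping_time_measurable[OF st]
  have bound: "measure Pinf {\<omega>\<in>space Pinf. enat (1 + j * m) \<le> \<tau> \<omega>} \<le> (1 - \<delta>) ^ j" for j
  proof (induction j)
    case (Suc j)
    have "measure Pinf {\<omega>\<in>space Pinf. enat (1 + j * m + m) \<le> \<tau> \<omega>}
        \<le> (1 - \<delta>) * measure Pinf {\<omega>\<in>space Pinf. enat (1 + j * m) \<le> \<tau> \<omega>}"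
      by (rule decay) simp
    also have "\<dots> \<le> (1 - \<delta>) * (1 - \<delta>) ^ j" using Suc \<delta> by (intro mult_left_mono) auto
    finally show ?case by (simp add: add_ac)
  qed simp
  have gt: "enat (j * m) < t \<longleftrightarrow> enat (1 + j * m) \<le> t" for j t
    by (cases t) auto
  have "false_alarm_time Pinf \<tau> \<le> (\<integral>\<^sup>+\<omega>. of_nat m * (\<Sum>j. of_bool (enat (j * m) < \<tau> \<omega>)) \<partial>Pinf)"
    unfolding false_alarm_time_def by (intro nn_integral_mono ennreal_of_enat_le_count m)
  also have "\<dots> = of_nat m * (\<Sum>j. \<integral>\<^sup>+\<omega>. of_bool (enat (j * m) < \<tau> \<omega>) \<partial>Pinf)"
    by (simp add: nn_integral_cmult nn_integral_suminf)
  also have "(\<lambda>j. \<integral>\<^sup>+\<omega>. of_bool (enat (j * m) < \<tau> \<omega>) \<partial>Pinf)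
      = (\<lambda>j. ennreal (measure Pinf {\<omega>\<in>space Pinf. enat (1 + j * m) \<le> \<tau> \<omega>}))"
  proof
    fix j
    have "(\<integral>\<^sup>+\<omega>. of_bool (enat (j * m) < \<tau> \<omega>) \<partial>Pinf)
        = (\<integral>\<^sup>+\<omega>. indicator {\<omega>\<in>space Pinf. enat (1 + j * m) \<le> \<tau> \<omega>} \<omega> \<partial>Pinf)"
      by (intro nn_integral_cong) (simp add: gt indicator_def)
    also have "\<dots> = emeasure Pinf {\<omega>\<in>space Pinf. enat (1 + j * m) \<le> \<tau> \<omega>}"
      by (intro nn_integral_indicator) measurable
    finally show "(\<integral>\<^sup>+\<omega>. of_bool (enat (j * m) < \<tau> \<omega>) \<partial>Pinf)
        = ennreal (measure Pinf {\<omega>\<in>space Pinf. enat (1 + j * m) \<le> \<tau> \<omega>})"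
      by (simp add: Q.emeasure_eq_measure)
  qed
  also have "of_nat m * (\<Sum>j. ennreal (measure Pinf {\<omega>\<in>space Pinf. enat (1 + j * m) \<le> \<tau> \<omega>}))
      \<le> of_nat m * (\<Sum>j. ennreal ((1 - \<delta>) ^ j))"
    using bound by (intro mult_left_mono suminf_le ennreal_leI) auto
  also have "(\<Sum>j. ennreal ((1 - \<delta>) ^ j)) = ennreal (1 / \<delta>)"
    using \<delta> geometric_sums[of "1 - \<delta>"] by (intro suminf_ennreal_eq) auto
  also have "of_nat m * ennreal (1 / \<delta>) = ennreal (m / \<delta>)"
    using \<delta> by (simp add: ennreal_of_nat_eq_real_of_nat ennreal_mult[symmetric])
  finally show ?thesis .
qed

text \<open>Lai's argument: otherwise the tail of \<open>\<tau>\<close> would decay geometrically in steps of length \<open>m\<close>.\<close>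

lemma exists_quiet_window:
  assumes st: "stopping_time (obs_filtration Pinf M X) \<tau>" and m: "0 < m"
    and \<delta>: "0 < \<delta>" "\<delta> \<le> 1" and fa: "ennreal (m / \<delta>) < false_alarm_time Pinf \<tau>"
  obtains v where "1 \<le> v" "0 < measure Pinf {\<omega>\<in>space Pinf. enat v \<le> \<tau> \<omega>}"
    "measure Pinf {\<omega>\<in>space Pinf. enat v \<le> \<tau> \<omega> \<and> \<tau> \<omega> < enat (v + m)}
      \<le> \<delta> * measure Pinf {\<omega>\<in>space Pinf. enat v \<le> \<tau> \<omega>}"
proof -
  interpret Q: prob_space Pinf by (rule prob_space_Pinf)
  note [measurable] = stopping_time_measurable[OF st]
  let ?H = "\<lambda>v. {\<omega>\<in>space Pinf. enat v \<le> \<tau> \<omega>}"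
  obtain v where v: "1 \<le> v" "(1 - \<delta>) * measure Pinf (?H v) < measure Pinf (?H (v + m))"
    using false_alarm_time_le[OF st m \<delta>] fa by (meson leD not_le)
  have "?H (v + m) \<subseteq> ?H v"
    using order_trans[of "enat v" "enat (v + m)"] by auto
  then have "Q.prob (?H v - ?H (v + m)) = Q.prob (?H v) - Q.prob (?H (v + m))"
    by (intro Q.finite_measure_Diff) measurable
  moreover have "?H v - ?H (v + m) = {\<omega>\<in>space Pinf. enat v \<le> \<tau> \<omega> \<and> \<tau> \<omega> < enat (v + m)}"
    by auto
  \<comment> \<open>If \<open>?H v\<close> were null, so would be its subset
    \<open>?H (v + m)\<close>, contradicting the strict inequality that selects
    \<open>v\<close>.\<close>
  moreover have "0 < Q.prob (?H v)"
  proof (rule ccontr)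
    assume "\<not> 0 < Q.prob (?H v)"
    then have "Q.prob (?H v) = 0" by (simp add: zero_less_measure_iff)
    moreover have "Q.prob (?H (v + m)) \<le> Q.prob (?H v)"
      using \<open>?H (v + m) \<subseteq> ?H v\<close> by (intro Q.finite_measure_mono) measurable
    ultimately show False using v by simp
  qed
  ultimately show ?thesis using v by (intro that[of v]) (auto simp: algebra_simps)
qed

lemma AE_pos_all:
  assumes v: "1 \<le> v"
  shows "AE \<omega> in P d v. \<forall>j\<ge>v. 0 < f 0 (X j \<omega>) \<and> 0 < f (ph d v j) (X j \<omega>)"
proof -
  have "AE \<omega> in P d v. \<forall>j\<in>{v..}. 0 < f 0 (X j \<omega>) \<and> 0 < f (ph d v j) (X j \<omega>)"
    using AE_pos_X[OF v] by (intro AE_ball_countable') auto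
  then show ?thesis by (rule eventually_mono) auto
qed

lemma ratio_exp:
  assumes "\<forall>j\<ge>v. 0 < f 0 (X j \<omega>) \<and> 0 < f (ph d v j) (X j \<omega>)"
  shows "ratio d v k \<omega> = ennreal (exp (\<Sum>j = v..k. llr (ph d v j) (X j \<omega>)))"
proof -
  have "ratio d v k \<omega> = (\<Prod>j = v..k. ennreal (exp (llr (ph d v j) (X j \<omega>))))"
    using assms by (intro prod.cong) (auto simp: llr_def)
  then show ?thesis by (simp add: prod_ennreal exp_sum)
qed

text \<open>Stopping within the window is split by whether its likelihood ratio exceeds
  \<open>exp a\<close>. If not, changing measure costs at most that factor on an event of relative
  size \<open>\<delta>\<close>; if so, the event is independent of reaching \<open>v\<close> and has
  probability at most \<open>q\<close>. In all other cases the delay is at least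
  \<open>m\<close>.\<close>

lemma pollak_delay_ge:
  assumes st: "stopping_time (obs_filtration Pinf M X) \<tau>" and v: "1 \<le> v"
    and H: "0 < measure Pinf {\<omega>\<in>space Pinf. enat v \<le> \<tau> \<omega>}"
    and \<delta>: "measure Pinf {\<omega>\<in>space Pinf. enat v \<le> \<tau> \<omega> \<and> \<tau> \<omega> < enat (v + m)}
      \<le> \<delta> * measure Pinf {\<omega>\<in>space Pinf. enat v \<le> \<tau> \<omega>}"
    and q: "measure (P d v) {\<omega>\<in>space (P d v). a < (\<Sum>j\<in>{v..<v + m}. llr (ph d v j) (X j \<omega>))} \<le> q"
  shows "ennreal (m * (1 - exp a * \<delta> - q)) \<le> pollak_delay (P d) \<tau>"
proof -
  interpret Q: prob_space Pinf by (rule prob_space_Pinf)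
  interpret V: prob_space "P d v" by (rule prob_space_P[OF v])
  note [measurable] = stopping_time_measurable[OF st] stopping_time_measurable_P[OF st v, of d]
  define H where "H = {\<omega>\<in>space Pinf. enat v \<le> \<tau> \<omega>}"
  define H' where "H' = {\<omega>\<in>space Pinf. enat (v + m) \<le> \<tau> \<omega>}"
  define G where "G = {\<omega>\<in>space Pinf. enat v \<le> \<tau> \<omega> \<and> \<tau> \<omega> < enat (v + m)}"
  define k where "k = v + m - 1"
  \<comment> \<open>Phrased through the ratio rather than the sum of logarithms, so that the ratio
    is at most \<open>exp a\<close> at every point outside \<open>B\<close>, also where densities
    vanish.\<close>
  define B where "B = {\<omega>\<in>space Pinf. ennreal (exp a) < ratio d v k \<omega>}"
  have vk: "{v..k} = {v..<v + m}" using v by (auto simp: k_def)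
  have H_sets: "H \<in> sets (obs_sigma {1..v - 1})"
    unfolding H_def by (rule stopping_time_ge[OF st v])
  have H'_sets: "H' \<in> sets (obs_sigma {1..k})"
    unfolding H'_def k_def using stopping_time_ge[OF st, of "v + m"] v by simp
  have HG: "G = H - H'" by (auto simp: G_def H_def H'_def)
  have HH': "H' \<subseteq> H"
    unfolding H_def H'_def using order_trans[of "enat v" "enat (v + m)"] by auto
  have H_k: "H \<in> sets (obs_sigma {1..k})"
    by (rule subsetD[OF obs_sigma_mono H_sets]) (auto simp: k_def)
  have G_sets: "G \<in> sets (obs_sigma {1..k})"
    unfolding HG using H_k H'_sets by (rule sets.Diff)
  have B_sets: "B \<in> sets (obs_sigma {v..k})"
  proof -
    have "ratio d v k \<in> borel_measurable (obs_sigma {v..k})"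
    proof (intro borel_measurable_prod_ennreal)
      fix j assume j: "j \<in> {v..k}"
      have [measurable]: "X j \<in> measurable (obs_sigma {v..k}) M" "f (ph d v j) \<in> borel_measurable M"
        using ph_range[of v j d] j v by (auto intro!: X_measurable_obs_sigma)
      show "(\<lambda>\<omega>. ennreal (f (ph d v j) (X j \<omega>) / f 0 (X j \<omega>))) \<in> borel_measurable (obs_sigma {v..k})"
        by measurable
    qed
    then have "{\<omega>\<in>space (obs_sigma {v..k}). ennreal (exp a) < ratio d v k \<omega>} \<in> sets (obs_sigma {v..k})"
      by measurable
    then show ?thesis by (simp add: B_def)
  qed
  have B_k: "B \<in> sets (obs_sigma {1..k})"
    by (rule subsetD[OF obs_sigma_mono B_sets]) (use v in auto)
  have to_P: "A \<in> sets (P d v)" if "A \<in> sets (obs_sigma {1..l})" for A l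
    using that sets_obs_sigma_subset[of "{1..l}"] sets_P[OF v, of d] by auto
  have to_Pinf: "A \<in> sets Pinf" if "A \<in> sets (obs_sigma {1..l})" for A l
    using that sets_obs_sigma_subset[of "{1..l}"] by auto
  have [measurable]: "H \<in> sets (P d v)" "H' \<in> sets (P d v)" "G \<in> sets (P d v)" "B \<in> sets (P d v)"
    using H_k H'_sets G_sets B_k by (auto intro: to_P)
  \<comment> \<open>\<open>H\<close> is decided before \<open>v\<close>, where the likelihood ratio
    is an empty product.\<close>
  have PH: "V.prob H = Q.prob H"
  proof -
    have "emeasure (P d v) H = (\<integral>\<^sup>+\<omega>. ratio d v (v - 1) \<omega> * indicator H \<omega> \<partial>Pinf)"
      by (rule change_of_measure[OF v H_sets])
    also have "\<dots> = emeasure Pinf H"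
      using v to_Pinf[OF H_sets] by simp
    finally show ?thesis by (simp add: measure_def)
  qed
  have "emeasure (P d v) (G - B) = (\<integral>\<^sup>+\<omega>. ratio d v k \<omega> * indicator (G - B) \<omega> \<partial>Pinf)"
    by (intro change_of_measure[OF v] sets.Diff G_sets B_k)
  also have "\<dots> \<le> (\<integral>\<^sup>+\<omega>. ennreal (exp a) * indicator G \<omega> \<partial>Pinf)"
    by (intro nn_integral_mono) (auto simp: indicator_def B_def G_def not_less)
  also have "\<dots> = ennreal (exp a) * emeasure Pinf G"
    using to_Pinf[OF G_sets] by (simp add: nn_integral_cmult)
  finally have "emeasure (P d v) (G - B) \<le> ennreal (exp a * Q.prob G)"
    by (simp add: Q.emeasure_eq_measure ennreal_mult)
  then have GB: "V.prob (G - B) \<le> exp a * Q.prob G"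
    by (simp add: V.emeasure_eq_measure)
  have HB: "V.prob (H \<inter> B) = V.prob H * V.prob B"
  proof -
    have "V.prob (\<Inter>i\<le>1::nat. (if i = 0 then H else B)) = (\<Prod>i\<le>1::nat. V.prob (if i = 0 then H else B))"
    proof (rule indep_blocks[OF v, where T = "\<lambda>i. if i = 0 then {1..v - 1} else {v..k}"])
      show "disjoint_family_on (\<lambda>i::nat. if i = 0 then {1..v - 1} else {v..k}) {..1}"
        by (auto simp: disjoint_family_on_def)
    qed (use v H_sets B_sets in auto)
    then show ?thesis by (simp add: atMost_Suc Int_commute mult.commute)
  qed
  have "V.prob B = V.prob {\<omega>\<in>space (P d v). a < (\<Sum>j\<in>{v..<v + m}. llr (ph d v j) (X j \<omega>))}"
  proof (rule V.finite_measure_eq_AE)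
    show "AE \<omega> in P d v. (\<omega> \<in> B) = (\<omega> \<in> {\<omega> \<in> space (P d v). a < (\<Sum>j\<in>{v..<v + m}. llr (ph d v j) (X j \<omega>))})"
      using AE_pos_all[OF v, of d] AE_space
    proof eventually_elim
      case (elim \<omega>)
      have "ratio d v k \<omega> = ennreal (exp (\<Sum>j\<in>{v..<v + m}. llr (ph d v j) (X j \<omega>)))"
        using ratio_exp[OF elim(1), of k] unfolding vk .
      then show ?case using elim space_P[OF v, of d] by (simp add: B_def ennreal_less_iff)
    qed
    have "(\<lambda>\<omega>. \<Sum>j\<in>{v..<v + m}. llr (ph d v j) (X j \<omega>)) \<in> borel_measurable (P d v)"
      using v by (intro borel_measurable_sum borel_measurable_integrable integrable_llr_X) auto
    then show "{\<omega> \<in> space (P d v). a < (\<Sum>j\<in>{v..<v + m}. llr (ph d v j) (X j \<omega>))} \<in> V.events"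
      by measurable
  qed simp
  then have Bq: "V.prob B \<le> q" using q by simp
  have "V.prob G \<le> V.prob ((G - B) \<union> (H \<inter> B))"
    by (intro V.finite_measure_mono) (auto simp: HG)
  also have "\<dots> \<le> V.prob (G - B) + V.prob (H \<inter> B)"
    by (intro measure_Un_le) measurable
  also have "\<dots> \<le> exp a * (\<delta> * Q.prob H) + V.prob H * q"
  proof (intro add_mono)
    show "V.prob (G - B) \<le> exp a * (\<delta> * Q.prob H)"
      by (rule order_trans[OF GB mult_left_mono[OF \<delta>[folded G_def H_def]]]) simp
    show "V.prob (H \<inter> B) \<le> V.prob H * q"
      unfolding HB using Bq by (intro mult_left_mono) auto
  qed
  also have "\<dots> = V.prob H * (exp a * \<delta> + q)" by (simp add: PH algebra_simps)
  finally have PG: "V.prob G \<le> V.prob H * (exp a * \<delta> + q)" .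
  have "V.prob G = V.prob H - V.prob H'"
    unfolding HG using HH' by (intro V.finite_measure_Diff) measurable
  with PG have PH': "V.prob H * (1 - exp a * \<delta> - q) \<le> V.prob H'"
    by (simp add: algebra_simps)
  have pos: "0 < V.prob H" using H PH by (simp add: H_def)
  have "ennreal (m * (1 - exp a * \<delta> - q)) * emeasure (P d v) H
      = ennreal (m * (V.prob H * (1 - exp a * \<delta> - q)))"
    unfolding V.emeasure_eq_measure
    by (subst ennreal_mult''[symmetric]) (auto simp: mult_ac)
  also have "\<dots> \<le> ennreal (m * V.prob H')"
    using PH' by (intro ennreal_leI mult_left_mono) auto
  also have "\<dots> = of_nat m * emeasure (P d v) H'"
    by (simp add: V.emeasure_eq_measure ennreal_mult ennreal_of_nat_eq_real_of_nat)
  also have "\<dots> = (\<integral>\<^sup>+\<omega>. of_nat m * indicator H' \<omega> \<partial>P d v)"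
    by (simp add: nn_integral_cmult)
  also have "\<dots> \<le> (\<integral>\<^sup>+\<omega>. ennreal_of_enat (\<tau> \<omega> - enat v) * indicator {\<omega>. enat v \<le> \<tau> \<omega>} \<omega> \<partial>P d v)"
  proof (intro nn_integral_mono)
    fix \<omega>
    show "of_nat m * indicator H' \<omega> \<le> ennreal_of_enat (\<tau> \<omega> - enat v) * indicator {\<omega>. enat v \<le> \<tau> \<omega>} \<omega>"
      by (cases "\<tau> \<omega>") (auto simp: H'_def indicator_def)
  qed
  finally have "ennreal (m * (1 - exp a * \<delta> - q)) * emeasure (P d v) H / emeasure (P d v) H
      \<le> (\<integral>\<^sup>+\<omega>. ennreal_of_enat (\<tau> \<omega> - enat v) * indicator {\<omega>. enat v \<le> \<tau> \<omega>} \<omega> \<partial>P d v) / emeasure (P d v) H"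
    by (rule divide_right_mono_ennreal)
  also have "\<dots> \<le> pollak_delay (P d) \<tau>"
    unfolding pollak_delay_def H_def using v by (intro SUP_upper2[of v]) (auto simp: space_P)
  finally show ?thesis
    using pos by (subst (asm) mult_divide_eq_ennreal) (auto simp: V.emeasure_eq_measure)
qed

end

subsection \<open>Upper bound on the delay\<close>

context transient_change
begin

lemma delay_measurable:
  assumes st: "stopping_time (obs_filtration Pinf M X) \<tau>" and v: "1 \<le> v"
  shows "(\<lambda>\<omega>. ennreal_of_enat (\<tau> \<omega> - enat u)) \<in> borel_measurable (P d v)"
  by (rule measurable_compose[OF stopping_time_measurable_P[OF st v, of d], of "\<lambda>t. ennreal_of_enat (t - enat u)"]) simp

text \<open>Reaching \<open>v\<close> is an event of the first \<open>v - 1\<close> observations, so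
  conditioning on it averages the conditional means whose essential supremum Lorden's delay
  takes.\<close>

lemma pollak_le_lorden:
  assumes st: "stopping_time (obs_filtration Pinf M X) \<tau>"
  shows "pollak_delay (P d) \<tau> \<le> lorden_delay M X (P d) \<tau>"
  unfolding pollak_delay_def
proof (rule SUP_least)
  fix v :: nat assume "v \<in> {1..}"
  then have v: "1 \<le> v" by simp
  interpret V: prob_space "P d v" by (rule prob_space_P[OF v])
  let ?F = "obs_filtration (P d v) M X (enat (v - 1))"
  have F: "?F = obs_sigma {1..v - 1}" using v by (simp add: obs_filtration_P obs_filtration_eq)
  interpret S: finite_measure_subalgebra "P d v" ?F
    unfolding F by unfold_locales (rule subalgebra_obs_sigma[OF _ v], auto)
  let ?g = "\<lambda>\<omega>. ennreal_of_enat (\<tau> \<omega> - enat v)"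
  let ?e = "esssup (P d v) (nn_cond_exp (P d v) ?F ?g)"
  define H where "H = {\<omega> \<in> space (P d v). enat v \<le> \<tau> \<omega>}"
  have HF [measurable]: "H \<in> sets ?F"
    unfolding H_def F space_P[OF v] by (rule stopping_time_ge[OF st v])
  have H [measurable]: "H \<in> sets (P d v)" using HF S.subalg by (auto simp: subalgebra_def)
  have "(\<integral>\<^sup>+ \<omega>. ?g \<omega> * indicator {\<omega>. enat v \<le> \<tau> \<omega>} \<omega> \<partial>P d v) = (\<integral>\<^sup>+ \<omega>. indicator H \<omega> * ?g \<omega> \<partial>P d v)"
    by (intro nn_integral_cong) (simp add: H_def indicator_def)
  also have "\<dots> = (\<integral>\<^sup>+ \<omega>. indicator H \<omega> * nn_cond_exp (P d v) ?F ?g \<omega> \<partial>P d v)"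
    by (rule S.nn_cond_exp_intg[symmetric, OF borel_measurable_indicator[OF HF] delay_measurable[OF st v]])
  also have "\<dots> \<le> (\<integral>\<^sup>+ \<omega>. ?e * indicator H \<omega> \<partial>P d v)"
    using esssup_AE[where f = "nn_cond_exp (P d v) ?F ?g" and M = "P d v"]
    by (intro nn_integral_mono_AE) (auto elim!: eventually_mono simp: indicator_def)
  also have "\<dots> = ?e * emeasure (P d v) H" by (simp add: nn_integral_cmult)
  finally have "(\<integral>\<^sup>+ \<omega>. ?g \<omega> * indicator {\<omega>. enat v \<le> \<tau> \<omega>} \<omega> \<partial>P d v) / emeasure (P d v) H
      \<le> ?e * emeasure (P d v) H / emeasure (P d v) H"
    by (rule divide_right_mono_ennreal)
  \<comment> \<open>If \<open>v\<close> is reached with probability zero, the quotient is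
    \<open>0 / 0 = 0\<close> and the bound is trivial.\<close>
  also have "\<dots> \<le> ?e"
    by (cases "emeasure (P d v) H = 0") (simp_all add: mult_divide_eq_ennreal)
  also have "\<dots> \<le> lorden_delay M X (P d) \<tau>"
    unfolding lorden_delay_def using v by (intro SUP_upper2[of v]) auto
  finally show "(\<integral>\<^sup>+ \<omega>. ?g \<omega> * indicator {\<omega>. enat v \<le> \<tau> \<omega>} \<omega> \<partial>P d v)
      / emeasure (P d v) {\<omega> \<in> space (P d v). enat v \<le> \<tau> \<omega>} \<le> lorden_delay M X (P d) \<tau>"
    by (simp add: H_def)
qed

lemma llr_sum_measurable_obs_sigma:
  assumes "1 \<le> v" "T \<subseteq> {v..}"
  shows "(\<lambda>\<omega>. \<Sum>j\<in>T. llr (ph d v j) (X j \<omega>)) \<in> borel_measurable (obs_sigma T)"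
proof (intro borel_measurable_sum)
  fix j assume j: "j \<in> T"
  then have [measurable]: "X j \<in> measurable (obs_sigma T) M" "llr (ph d v j) \<in> borel_measurable M"
    using ph_range[of v j d] assms by (auto intro!: X_measurable_obs_sigma)
  show "(\<lambda>\<omega>. llr (ph d v j) (X j \<omega>)) \<in> borel_measurable (obs_sigma T)" by measurable
qed

text \<open>After the change, a first block of length \<open>n\<close> and further blocks of length \<open>N\<close> are
  independent of each other and of the past; not having stopped means that all of them failed.\<close>

lemma delay_integral_le:
  fixes \<beta> :: "nat \<Rightarrow> real" and \<epsilon> :: real
  assumes st: "stopping_time (obs_filtration Pinf M X) \<tau>" and v: "1 \<le> v"
    and n: "1 \<le> n" and N: "1 \<le> N" and \<epsilon>: "0 \<le> \<epsilon>" "\<epsilon> < 1"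
    and stop: "AE \<omega> in P d v. \<forall>s k. v \<le> s \<longrightarrow> s \<le> k \<longrightarrow> enat k < \<tau> \<omega> \<longrightarrow>
        (\<Sum>j = s..k. llr (ph d v j) (X j \<omega>)) \<le> \<beta> (k + 1 - s)"
    and p0: "measure (P d v) {\<omega>\<in>space (P d v). (\<Sum>j\<in>{v..<v + n}. llr (ph d v j) (X j \<omega>)) \<le> \<beta> n} \<le> \<epsilon>"
    and p1: "\<And>s. v \<le> s \<Longrightarrow>
        measure (P d v) {\<omega>\<in>space (P d v). (\<Sum>j\<in>{s..<s + N}. llr (ph d v j) (X j \<omega>)) \<le> \<beta> N} \<le> \<epsilon>"
    and A: "A \<in> sets (obs_sigma {1..v - 1})"
  shows "(\<integral>\<^sup>+\<omega>. indicator A \<omega> * ennreal_of_enat (\<tau> \<omega> - enat v) \<partial>P d v)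
      \<le> ennreal (n + N * (\<epsilon> / (1 - \<epsilon>))) * emeasure (P d v) A"
proof -
  interpret V: prob_space "P d v" by (rule prob_space_P[OF v])
  \<comment> \<open>Starting times of the blocks: block 0 is the past, block 1 the first block of
    length \<open>n\<close>, all later ones have length \<open>N\<close>. Treating the past event
    \<open>A\<close> as a block of its own puts it into the same product formula.\<close>
  define S where "S i = (if i = 0 then 1 else if i = 1 then v else v + n + (i - 2) * N)" for i :: nat
  define T where "T i = {S i..<S (Suc i)}" for i
  define E where "E i = (if i = 0 then A else
      {\<omega>\<in>space Pinf. (\<Sum>j\<in>T i. llr (ph d v j) (X j \<omega>)) \<le> \<beta> (card (T i))})" for i
  have S_mono: "S i \<le> S (Suc i)" for i
    using v by (cases "i = 0"; cases "i = 1") (auto simp: S_def)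
  have S_le: "S i \<le> S j" if "i \<le> j" for i j using S_mono that by (rule lift_Suc_mono_le)
  have T0: "T 0 = {1..v - 1}" using v by (auto simp: T_def S_def)
  have T1: "T 1 = {v..<v + n}" by (simp add: T_def S_def)
  have T2: "T (Suc (Suc i)) = {v + n + i * N..<v + n + i * N + N}" for i by (simp add: T_def S_def add_ac)
  have Tv: "T i \<subseteq> {v..}" if "1 \<le> i" for i
    using S_le[of 1 i] that by (auto simp: T_def S_def)
  have T_pos: "T i \<subseteq> {1..}" for i
    using S_le[of 0 i] by (auto simp: T_def S_def[of 0])
  have disj: "disjoint_family_on T I" for I
  proof -
    have "T i \<inter> T j = {}" if "i < j" for i j
      using S_le[of "Suc i" j] that by (auto simp: T_def)
    then show ?thesis
      unfolding disjoint_family_on_def by (metis Int_commute linorder_neqE_nat)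
  qed
  have E_sets: "E i \<in> sets (obs_sigma (T i))" for i
  proof (cases "i = 0")
    case True
    then show ?thesis using A by (simp add: E_def T0)
  next
    case False
    then have "(\<lambda>\<omega>. \<Sum>j\<in>T i. llr (ph d v j) (X j \<omega>)) \<in> borel_measurable (obs_sigma (T i))"
      by (intro llr_sum_measurable_obs_sigma[OF v] Tv) simp
    then have "{\<omega>\<in>space (obs_sigma (T i)). (\<Sum>j\<in>T i. llr (ph d v j) (X j \<omega>)) \<le> \<beta> (card (T i))} \<in> sets (obs_sigma (T i))"
      by measurable
    then show ?thesis using False by (simp add: E_def)
  qed
  have E_P: "E i \<in> sets (P d v)" for i
    using E_sets[of i] sets_obs_sigma_subset[OF T_pos] sets_P[OF v, of d] by auto
  have A_P [measurable]: "A \<in> sets (P d v)" using E_P[of 0] by (simp add: E_def)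
  have pE: "V.prob (E (Suc i)) \<le> \<epsilon>" for i
  proof (cases i)
    case 0
    then show ?thesis using p0 T1 by (simp add: E_def space_P[OF v])
  next
    case (Suc l)
    then show ?thesis using p1[of "v + n + l * N"] T2[of l] by (simp add: E_def space_P[OF v])
  qed
  note \<tau>m [measurable] = stopping_time_measurable_P[OF st v, of d]
  \<comment> \<open>Block \<open>j + 1\<close> ends at time \<open>v + n + j * N - 1\<close>, so
    survival beyond \<open>v + n + j * N\<close> makes the \<open>j + 1\<close> blocks after the
    past all fail.\<close>
  have tail: "V.prob {\<omega>\<in>A. enat (v + n + j * N) < \<tau> \<omega>} \<le> V.prob A * \<epsilon> ^ Suc j" for j
  proof -
    have "V.prob {\<omega>\<in>A. enat (v + n + j * N) < \<tau> \<omega>} \<le> V.prob (\<Inter>i\<le>Suc j. E i)"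
    proof (rule V.finite_measure_mono_AE)
      show "AE \<omega> in P d v. \<omega> \<in> {\<omega>\<in>A. enat (v + n + j * N) < \<tau> \<omega>} \<longrightarrow> \<omega> \<in> (\<Inter>i\<le>Suc j. E i)"
        using stop
      proof (eventually_elim, safe)
        fix \<omega> i
        assume stop: "\<forall>s k. v \<le> s \<longrightarrow> s \<le> k \<longrightarrow> enat k < \<tau> \<omega> \<longrightarrow>
            (\<Sum>j = s..k. llr (ph d v j) (X j \<omega>)) \<le> \<beta> (k + 1 - s)"
          and \<omega>: "\<omega> \<in> A" "enat (v + n + j * N) < \<tau> \<omega>" and i: "i \<le> Suc j"
        show "\<omega> \<in> E i"
        proof (cases "i = 0")
          case True
          then show ?thesis using \<omega> by (simp add: E_def)
        next
          case False
          define k where "k = S (Suc i) - 1"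
          have lt: "S i < S (Suc i)" using False n N by (cases "i = 1") (auto simp: S_def)
          have Sk: "{S i..k} = T i" "k + 1 - S i = card (T i)" "S i \<le> k"
            using lt by (auto simp: T_def k_def)
          have "S (Suc i) \<le> S (Suc (Suc j))" using i by (intro S_le) simp
          then have "k < v + n + j * N" using lt by (simp add: k_def S_def[of "Suc (Suc j)"])
          then have "enat k < \<tau> \<omega>" using \<omega>(2) by (metis enat_ord_simps(2) less_trans)
          moreover have "v \<le> S i" using S_le[of 1 i] False by (simp add: S_def[of "Suc 0"])
          ultimately have "(\<Sum>j = S i..k. llr (ph d v j) (X j \<omega>)) \<le> \<beta> (k + 1 - S i)"
            using stop Sk(3) by blast
          moreover have "\<omega> \<in> space Pinf"
            using \<omega>(1) sets.sets_into_space[OF A_P] space_P[OF v, of d] by auto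
          ultimately show ?thesis using False unfolding Sk by (simp add: E_def)
        qed
      qed
      show "(\<Inter>i\<le>Suc j. E i) \<in> V.events" using E_P by (intro sets.finite_INT) auto
    qed
    also have "\<dots> = (\<Prod>i\<le>Suc j. V.prob (E i))"
      by (rule indep_blocks[OF v T_pos disj E_sets])
    also have "\<dots> = V.prob A * (\<Prod>i\<le>j. V.prob (E (Suc i)))"
      by (subst prod.atMost_Suc_shift) (simp add: E_def[of 0])
    also have "\<dots> \<le> V.prob A * (\<Prod>i\<le>j. \<epsilon>)"
      using pE by (intro mult_left_mono prod_mono) auto
    finally show ?thesis by simp
  qed
  \<comment> \<open>The first block is charged in full; only the excess over it is counted in steps
    of \<open>N\<close>.\<close>
  have split: "ennreal_of_enat (t - enat v) \<le> of_nat n + of_nat N * (\<Sum>j. of_bool (enat (v + n + j * N) < t))" for t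
  proof -
    have "ennreal_of_enat (t - enat v) \<le> of_nat n + ennreal_of_enat (t - enat (v + n))"
      by (cases t) (auto simp flip: of_nat_add simp del: of_nat_add)
    also have "\<dots> \<le> of_nat n + of_nat N * (\<Sum>j. of_bool (enat (j * N) < t - enat (v + n)))"
      using N by (intro add_left_mono ennreal_of_enat_le_count) auto
    also have "(\<lambda>j. of_bool (enat (j * N) < t - enat (v + n)) :: ennreal) = (\<lambda>j. of_bool (enat (v + n + j * N) < t))"
      by (cases t) (auto simp: fun_eq_iff)
    finally show ?thesis .
  qed
  have geo: "(\<Sum>j. ennreal (\<epsilon> ^ Suc j)) = ennreal (\<epsilon> / (1 - \<epsilon>))"
  proof (rule suminf_ennreal_eq)
    show "(\<lambda>j. \<epsilon> ^ Suc j) sums (\<epsilon> / (1 - \<epsilon>))"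
      using sums_mult[OF geometric_sums[of \<epsilon>], of \<epsilon>] \<epsilon> by simp
  qed (use \<epsilon> in auto)
  have "(\<integral>\<^sup>+\<omega>. indicator A \<omega> * ennreal_of_enat (\<tau> \<omega> - enat v) \<partial>P d v)
      \<le> (\<integral>\<^sup>+\<omega>. of_nat n * indicator A \<omega> + of_nat N * (\<Sum>j. indicator {\<omega>\<in>A. enat (v + n + j * N) < \<tau> \<omega>} \<omega>) \<partial>P d v)"
  proof (intro nn_integral_mono)
    fix \<omega>
    show "indicator A \<omega> * ennreal_of_enat (\<tau> \<omega> - enat v)
        \<le> of_nat n * indicator A \<omega> + of_nat N * (\<Sum>j. indicator {\<omega>\<in>A. enat (v + n + j * N) < \<tau> \<omega>} \<omega>)"
    proof (cases "\<omega> \<in> A")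
      case True
      then have "(\<lambda>j. indicator {\<omega>\<in>A. enat (v + n + j * N) < \<tau> \<omega>} \<omega>) = (\<lambda>j. of_bool (enat (v + n + j * N) < \<tau> \<omega>) :: ennreal)"
        by (auto simp: indicator_def)
      then show ?thesis using split[of "\<tau> \<omega>"] True by simp
    qed simp
  qed
  also have "\<dots> = of_nat n * emeasure (P d v) A
      + of_nat N * (\<Sum>j. emeasure (P d v) {\<omega>\<in>A. enat (v + n + j * N) < \<tau> \<omega>})"
  proof -
    have [measurable]: "{\<omega>\<in>A. enat (v + n + j * N) < \<tau> \<omega>} \<in> sets (P d v)" for j
    proof -
      have "{\<omega>\<in>A. enat (v + n + j * N) < \<tau> \<omega>} = A \<inter> {\<omega>\<in>space (P d v). enat (v + n + j * N) < \<tau> \<omega>}"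
        using sets.sets_into_space[OF A_P] by auto
      also have "\<dots> \<in> sets (P d v)" by measurable
      finally show ?thesis .
    qed
    show ?thesis by (simp add: nn_integral_add nn_integral_cmult nn_integral_suminf)
  qed
  also have "\<dots> \<le> of_nat n * emeasure (P d v) A + of_nat N * (\<Sum>j. emeasure (P d v) A * ennreal (\<epsilon> ^ Suc j))"
  proof (intro add_left_mono mult_left_mono suminf_le summableI)
    fix j
    show "emeasure (P d v) {\<omega>\<in>A. enat (v + n + j * N) < \<tau> \<omega>} \<le> emeasure (P d v) A * ennreal (\<epsilon> ^ Suc j)"
      unfolding V.emeasure_eq_measure using tail[of j] \<epsilon>
      by (subst ennreal_mult[symmetric]) (auto intro: ennreal_leI)
  qed simp
  also have "\<dots> = (of_nat n + of_nat N * ennreal (\<epsilon> / (1 - \<epsilon>))) * emeasure (P d v) A"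
    unfolding ennreal_suminf_cmult geo by (simp add: algebra_simps)
  also have "of_nat n + of_nat N * ennreal (\<epsilon> / (1 - \<epsilon>)) = ennreal (n + N * (\<epsilon> / (1 - \<epsilon>)))"
    using \<epsilon> by (simp add: ennreal_of_nat_eq_real_of_nat ennreal_mult[symmetric] ennreal_plus[symmetric] del: ennreal_plus)
  finally show ?thesis .
qed

text \<open>The bound of \<open>delay_integral_le\<close> holds on every past event with one
  constant for all \<open>v\<close>, hence for the conditional means. The level
  \<open>\<beta>\<close> depends on the window length because the weighted rule loses a little with
  each observation.\<close>

lemma lorden_delay_le:
  fixes \<beta> :: "nat \<Rightarrow> real" and \<epsilon> :: real
  assumes st: "stopping_time (obs_filtration Pinf M X) \<tau>"
    and n: "1 \<le> n" and N: "1 \<le> N" and \<epsilon>: "0 \<le> \<epsilon>" "\<epsilon> < 1"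
    and stop: "\<And>v. 1 \<le> v \<Longrightarrow> AE \<omega> in P d v. \<forall>s k. v \<le> s \<longrightarrow> s \<le> k \<longrightarrow> enat k < \<tau> \<omega> \<longrightarrow>
        (\<Sum>j = s..k. llr (ph d v j) (X j \<omega>)) \<le> \<beta> (k + 1 - s)"
    and p0: "\<And>v. 1 \<le> v \<Longrightarrow>
        measure (P d v) {\<omega>\<in>space (P d v). (\<Sum>j\<in>{v..<v + n}. llr (ph d v j) (X j \<omega>)) \<le> \<beta> n} \<le> \<epsilon>"
    and p1: "\<And>v s. 1 \<le> v \<Longrightarrow> v \<le> s \<Longrightarrow>
        measure (P d v) {\<omega>\<in>space (P d v). (\<Sum>j\<in>{s..<s + N}. llr (ph d v j) (X j \<omega>)) \<le> \<beta> N} \<le> \<epsilon>"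
  shows "lorden_delay M X (P d) \<tau> \<le> ennreal (n + N * (\<epsilon> / (1 - \<epsilon>)))"
  unfolding lorden_delay_def
proof (rule SUP_least)
  fix v :: nat assume "v \<in> {1..}"
  then have v: "1 \<le> v" by simp
  interpret V: prob_space "P d v" by (rule prob_space_P[OF v])
  let ?F = "obs_filtration (P d v) M X (enat (v - 1))"
  have F: "?F = obs_sigma {1..v - 1}" using v by (simp add: obs_filtration_P obs_filtration_eq)
  have "AE \<omega> in P d v. nn_cond_exp (P d v) ?F (\<lambda>\<omega>. ennreal_of_enat (\<tau> \<omega> - enat v)) \<omega>
      \<le> ennreal (n + N * (\<epsilon> / (1 - \<epsilon>)))"
    unfolding F
  proof (rule V.nn_cond_exp_le_const)
    show "subalgebra (P d v) (obs_sigma {1..v - 1})" using v by (intro subalgebra_obs_sigma) auto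
    fix A assume A: "A \<in> sets (obs_sigma {1..v - 1})"
    show "(\<integral>\<^sup>+\<omega>. indicator A \<omega> * ennreal_of_enat (\<tau> \<omega> - enat v) \<partial>P d v)
        \<le> ennreal (n + N * (\<epsilon> / (1 - \<epsilon>))) * emeasure (P d v) A"
      by (intro delay_integral_le[OF st v n N \<epsilon> stop[OF v] p0[OF v]] p1 v A)
  qed (use delay_measurable[OF st v] in auto)
  then show "esssup (P d v) (nn_cond_exp (P d v) ?F (\<lambda>\<omega>. ennreal_of_enat (\<tau> \<omega> - enat v)))
      \<le> ennreal (n + N * (\<epsilon> / (1 - \<epsilon>)))"
    by (intro esssup_I) auto
qed

end

subsection \<open>The two stopping rules\<close>

lemma INF_enat_le_iff: "(INF k\<in>{k. 1 \<le> k \<and> p k}. enat k) \<le> enat n \<longleftrightarrow> (\<exists>k\<in>{1..n}. p k)"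
proof
  assume le: "(INF k\<in>{k. 1 \<le> k \<and> p k}. enat k) \<le> enat n"
  show "\<exists>k\<in>{1..n}. p k"
  proof (rule ccontr)
    assume none: "\<not> (\<exists>k\<in>{1..n}. p k)"
    have "enat (Suc n) \<le> (INF k\<in>{k. 1 \<le> k \<and> p k}. enat k)"
    proof (rule INF_greatest)
      fix k assume "k \<in> {k. 1 \<le> k \<and> p k}"
      then show "enat (Suc n) \<le> enat k" using none by (auto simp: not_le Suc_le_eq)
    qed
    then have "enat (Suc n) \<le> enat n" using le by (rule order_trans)
    then show False by simp
  qed
next
  assume "\<exists>k\<in>{1..n}. p k"
  then obtain k where "k \<in> {1..n}" "p k" by auto
  then show "(INF k\<in>{k. 1 \<le> k \<and> p k}. enat k) \<le> enat n"
    by (intro INF_lower2[of k]) auto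
qed

definition vec_of :: "nat list \<Rightarrow> nat \<Rightarrow> nat" where
  "vec_of l i = (if i < length l then l ! i else 0)"

text \<open>A supremum over vectors that only looks at finitely many entries is a countable one,
  hence measurable.\<close>

lemma SUP_vec_of:
  fixes g :: "(nat \<Rightarrow> nat) \<Rightarrow> 'b::complete_lattice"
  assumes g: "\<And>v w. (\<And>i. i \<le> n \<Longrightarrow> v i = w i) \<Longrightarrow> g v = g w"
    and C: "\<And>v w. (\<And>i. i \<le> n \<Longrightarrow> v i = w i) \<Longrightarrow> v \<in> C \<Longrightarrow> w \<in> C"
  shows "(SUP v\<in>C. g v) = (SUP l\<in>{l. vec_of l \<in> C}. g (vec_of l))"
proof (rule antisym)
  show "(SUP v\<in>C. g v) \<le> (SUP l\<in>{l. vec_of l \<in> C}. g (vec_of l))"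
  proof (rule SUP_least)
    fix v assume v: "v \<in> C"
    define l where "l = map v [0..<Suc n]"
    have eq: "v i = vec_of l i" if "i \<le> n" for i
      using that by (simp add: l_def vec_of_def nth_append le_Suc_eq)
    then have "g v = g (vec_of l)" "vec_of l \<in> C" using g[of v "vec_of l"] C[of v "vec_of l"] v by auto
    then show "g v \<le> (SUP l\<in>{l. vec_of l \<in> C}. g (vec_of l))" by (intro SUP_upper2[of l]) auto
  qed
  show "(SUP l\<in>{l. vec_of l \<in> C}. g (vec_of l)) \<le> (SUP v\<in>C. g v)"
    by (intro SUP_least SUP_upper) auto
qed

lemma elog_measurable [measurable]: "elog \<in> borel_measurable borel"
  unfolding elog_def[abs_def] by measurable

lemma elog_pos: "0 < x \<Longrightarrow> elog x = ereal (ln x)"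
  by (simp add: elog_def)

section \<open>Measurability of the statistics and a pathwise criterion for stopping\<close>

context transient_change
begin

lemma stopping_time_first_hit:
  assumes "\<And>k. 1 \<le> k \<Longrightarrow> {\<omega>\<in>space Pinf. p k \<omega>} \<in> sets (obs_sigma {1..k})"
  shows "stopping_time (obs_filtration Pinf M X) (\<lambda>\<omega>. INF k\<in>{k. 1 \<le> k \<and> p k \<omega>}. enat k)"
  unfolding stopping_time_def
proof
  fix t :: enat
  show "Measurable.pred (obs_filtration Pinf M X t) (\<lambda>\<omega>. (INF k\<in>{k. 1 \<le> k \<and> p k \<omega>}. enat k) \<le> t)"
  proof (cases t)
    case (enat n)
    have "{\<omega>\<in>space Pinf. \<exists>k\<in>{1..n}. p k \<omega>} = (\<Union>k\<in>{1..n}. {\<omega>\<in>space Pinf. p k \<omega>})" by auto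
    also have "\<dots> \<in> sets (obs_sigma {1..n})"
    proof (intro sets.finite_UN)
      fix k assume k: "k \<in> {1..n}"
      show "{\<omega>\<in>space Pinf. p k \<omega>} \<in> sets (obs_sigma {1..n})"
        by (rule subsetD[OF obs_sigma_mono assms]) (use k in auto)
    qed simp
    finally show ?thesis
      unfolding enat INF_enat_le_iff obs_filtration_eq by (simp add: pred_def)
  qed simp
qed

lemma change_point_ge: "1 \<le> i \<Longrightarrow> v \<le> change_point v d i"
  by (simp add: change_point_def)

lemma likelihood_ratio_measurable:
  assumes v1: "1 \<le> v1"
  shows "likelihood_ratio L f X k v1 d \<in> borel_measurable (obs_sigma {1..k})"
  unfolding likelihood_ratio_def
proof (intro borel_measurable_prod)
  fix i j assume ij: "i \<in> {1..L}" "j \<in> segment L (change_point v1 d) i \<inter> {..k}"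
  have "1 \<le> j"
    using v1 change_point_ge[of i v1 d] ij by (auto simp: segment_def)
  then have [measurable]: "X j \<in> measurable (obs_sigma {1..k}) M" "f i \<in> borel_measurable M"
    using ij by (auto intro!: X_measurable_obs_sigma)
  show "(\<lambda>\<omega>. f i (X j \<omega>) / f 0 (X j \<omega>)) \<in> borel_measurable (obs_sigma {1..k})" by measurable
qed

lemma likelihood_ratio_cong:
  assumes "\<And>i. i \<le> L \<Longrightarrow> d i = d' i"
  shows "likelihood_ratio L f X k v1 d \<omega> = likelihood_ratio L f X k v1 d' \<omega>"
proof -
  have "change_point v1 d i = change_point v1 d' i" if "i \<le> L" for i
    using that assms by (simp add: change_point_def)
  then have "segment L (change_point v1 d) i = segment L (change_point v1 d') i" if "i \<le> L" for i
    using that by (auto simp: segment_def)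
  then show ?thesis unfolding likelihood_ratio_def by (intro prod.cong) auto
qed

lemma dcusum_stat_measurable: "dcusum_stat L f X k \<in> borel_measurable (obs_sigma {1..k})"
proof -
  have "dcusum_stat L f X k \<omega> =
      (SUP v1\<in>{1..k}. SUP l\<in>{l. vec_of l \<in> UNIV}. elog (likelihood_ratio L f X k v1 (vec_of l) \<omega>))" for \<omega>
    unfolding dcusum_stat_def
    by (intro SUP_cong refl SUP_vec_of[where n = L]) (auto intro!: arg_cong[where f = elog] likelihood_ratio_cong)
  moreover have "(\<lambda>\<omega>. SUP v1\<in>{1..k}. SUP l\<in>{l. vec_of l \<in> UNIV}. elog (likelihood_ratio L f X k v1 (vec_of l) \<omega>))
      \<in> borel_measurable (obs_sigma {1..k})"
    by (intro borel_measurable_SUP measurable_compose[OF likelihood_ratio_measurable elog_measurable]) auto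
  ultimately show ?thesis by (simp cong: measurable_cong)
qed

lemma stopping_time_dcusum: "stopping_time (obs_filtration Pinf M X) (dcusum L f X b)"
  unfolding dcusum_def[abs_def]
proof (rule stopping_time_first_hit)
  fix k :: nat
  have "{\<omega>\<in>space (obs_sigma {1..k}). ereal b < dcusum_stat L f X k \<omega>} \<in> sets (obs_sigma {1..k})"
    using dcusum_stat_measurable[of k] by measurable
  then show "{\<omega>\<in>space Pinf. ereal b < dcusum_stat L f X k \<omega>} \<in> sets (obs_sigma {1..k})" by simp
qed

lemma weighted_block_cong:
  assumes "i \<in> {1..L}" "\<And>i. i \<le> L \<Longrightarrow> v i = w i"
  shows "weighted_block L f X \<rho> k v \<omega> i = weighted_block L f X \<rho> k w \<omega> i"
proof -
  have "segment L v i = segment L w i" using assms by (auto simp: segment_def)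
  moreover have "(i < L \<and> v (Suc i) \<le> k) = (i < L \<and> w (Suc i) \<le> k)" using assms(2)[of "Suc i"] by auto
  ultimately show ?thesis unfolding weighted_block_def by simp
qed

lemma wdcusum_stat_measurable: "wdcusum_stat L f X \<rho> k \<in> borel_measurable (obs_sigma {1..k})"
proof -
  let ?C = "{v. 1 \<le> v 1 \<and> (\<forall>i\<in>{1..<L}. v i \<le> v (Suc i)) \<and> v L \<le> k + 1}"
  let ?g = "\<lambda>\<omega> v. elog ((\<Prod>i = 1..L. weighted_block L f X \<rho> k v \<omega> i) / (\<Prod>j = v 1..k. f 0 (X j \<omega>)))"
  have "wdcusum_stat L f X \<rho> k \<omega> = (SUP l\<in>{l. vec_of l \<in> ?C}. ?g \<omega> (vec_of l))" for \<omega>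
    unfolding wdcusum_stat_def
  proof (rule SUP_vec_of[where n = L])
    fix v w :: "nat \<Rightarrow> nat" assume eq: "\<And>i. i \<le> L \<Longrightarrow> v i = w i"
    have "(\<Prod>i = 1..L. weighted_block L f X \<rho> k v \<omega> i) = (\<Prod>i = 1..L. weighted_block L f X \<rho> k w \<omega> i)"
      by (intro prod.cong refl weighted_block_cong eq)
    moreover have "v 1 = w 1" using eq[of 1] L_ge by simp
    ultimately show "?g \<omega> v = ?g \<omega> w" by simp
    assume "v \<in> ?C"
    then show "w \<in> ?C" using eq[of 1] eq[of L] L_ge eq by auto
  qed
  moreover have "(\<lambda>\<omega>. SUP l\<in>{l. vec_of l \<in> ?C}. ?g \<omega> (vec_of l)) \<in> borel_measurable (obs_sigma {1..k})"
  proof (intro borel_measurable_SUP)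
    fix l assume "l \<in> {l. vec_of l \<in> ?C}"
    then have v1: "1 \<le> vec_of l 1" and ord: "phases_ordered L (vec_of l)" by (auto simp: phases_ordered_def)
    have "(\<lambda>\<omega>. \<Prod>j = vec_of l 1..k. f 0 (X j \<omega>)) \<in> borel_measurable (obs_sigma {1..k})"
    proof (intro borel_measurable_prod)
      fix j assume "j \<in> {vec_of l 1..k}"
      then have [measurable]: "X j \<in> measurable (obs_sigma {1..k}) M"
        using v1 by (intro X_measurable_obs_sigma) auto
      show "(\<lambda>\<omega>. f 0 (X j \<omega>)) \<in> borel_measurable (obs_sigma {1..k})" by measurable
    qed
    moreover have "(\<lambda>\<omega>. \<Prod>i = 1..L. weighted_block L f X \<rho> k (vec_of l) \<omega> i) \<in> borel_measurable (obs_sigma {1..k})"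
      unfolding weighted_block_def Let_def
    proof (intro borel_measurable_prod borel_measurable_times borel_measurable_const)
      fix i j assume ij: "i \<in> {1..L}" "j \<in> segment L (vec_of l) i \<inter> {..k}"
      have "1 \<le> j"
        using v1 phases_ordered_le[OF ord, of 1 i] ij by (auto simp: segment_def)
      then have [measurable]: "X j \<in> measurable (obs_sigma {1..k}) M" "f i \<in> borel_measurable M"
        using ij by (auto intro!: X_measurable_obs_sigma)
      show "(\<lambda>\<omega>. f i (X j \<omega>)) \<in> borel_measurable (obs_sigma {1..k})" by measurable
    qed
    ultimately show "(\<lambda>\<omega>. ?g \<omega> (vec_of l)) \<in> borel_measurable (obs_sigma {1..k})"
      by measurable
  qed simp
  ultimately show ?thesis by (simp cong: measurable_cong)
qed

lemma stopping_time_wdcusum: "stopping_time (obs_filtration Pinf M X) (wdcusum L f X \<rho> b)"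
  unfolding wdcusum_def[abs_def]
proof (rule stopping_time_first_hit)
  fix k :: nat
  have "{\<omega>\<in>space (obs_sigma {1..k}). ereal b \<le> wdcusum_stat L f X \<rho> k \<omega>} \<in> sets (obs_sigma {1..k})"
    using wdcusum_stat_measurable[of \<rho> k] by measurable
  then show "{\<omega>\<in>space Pinf. ereal b \<le> wdcusum_stat L f X \<rho> k \<omega>} \<in> sets (obs_sigma {1..k})" by simp
qed

lemma sum_llr_eq_ln_prod:
  assumes "\<forall>j\<ge>v. 0 < f 0 (X j \<omega>) \<and> 0 < f (ph d v j) (X j \<omega>)" "v \<le> s"
  shows "(\<Sum>j = s..k. llr (ph d v j) (X j \<omega>)) = ln (\<Prod>j = s..k. f (ph d v j) (X j \<omega>) / f 0 (X j \<omega>))"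
proof -
  have "f (ph d v j) (X j \<omega>) / f 0 (X j \<omega>) \<noteq> 0" if "j \<in> {s..k}" for j
  proof -
    have "0 < f 0 (X j \<omega>) \<and> 0 < f (ph d v j) (X j \<omega>)" using assms that by auto
    then show ?thesis by auto
  qed
  then show ?thesis
    unfolding llr_def by (intro ln_prod[symmetric] finite_atLeastAtMost)
qed

text \<open>A window \<open>{s..k}\<close> after the true change-point contains a truncated copy of the true phases,
  which is one of the hypotheses scanned by both statistics.\<close>

lemma dcusum_stat_ge:
  assumes v: "1 \<le> v" and s: "v \<le> s" "s \<le> k"
    and pos: "\<forall>j\<ge>v. 0 < f 0 (X j \<omega>) \<and> 0 < f (ph d v j) (X j \<omega>)"
  shows "ereal (\<Sum>j = s..k. llr (ph d v j) (X j \<omega>)) \<le> dcusum_stat L f X k \<omega>"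
proof -
  let ?c = "change_point v d"
  \<comment> \<open>These durations realise the change-points \<open>max s (?c i)\<close>: the
    hypothetical change occurs at \<open>s\<close>, and phases already over by then get length
    zero.\<close>
  define d' where "d' i = max s (?c (Suc i)) - max s (?c i)" for i
  have c': "change_point s d' i = max s (?c i)" if "1 \<le> i" for i
    using that
  proof (induction i rule: dec_induct)
    case base
    then show ?case using s by simp
  next
    case (step i)
    have "change_point s d' (Suc i) = change_point s d' i + d' i"
      using step by (simp add: change_point_def)
    also have "\<dots> = max s (?c (Suc i))"
    proof -
      have "?c i \<le> ?c (Suc i)" using step by (simp add: change_point_def)
      then show ?thesis unfolding step.IH d'_def by simp
    qed
    finally show ?case .
  qed
  \<comment> \<open>For \<open>j\<close> at or after \<open>s\<close>, the bounds
    \<open>max s (?c i) \<le> j\<close> and \<open>?c i \<le> j\<close> are equivalent, so the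
    counts agree.\<close>
  have ph': "phase L (change_point s d') j = ph d v j" if "s \<le> j" for j
    unfolding phase_def using that c' by (intro arg_cong[where f = card]) auto
  have "likelihood_ratio L f X k s d' \<omega>
      = (\<Prod>j = change_point s d' 1..k. f (phase L (change_point s d') j) (X j \<omega>) / f 0 (X j \<omega>))"
    unfolding likelihood_ratio_def
    by (rule prod_segments[OF phases_ordered_change_point, where F = "\<lambda>i j. f i (X j \<omega>) / f 0 (X j \<omega>)"]) (use L_ge in simp)
  also have "\<dots> = (\<Prod>j = s..k. f (ph d v j) (X j \<omega>) / f 0 (X j \<omega>))"
    using ph' by simp
  finally have lr: "likelihood_ratio L f X k s d' \<omega> = (\<Prod>j = s..k. f (ph d v j) (X j \<omega>) / f 0 (X j \<omega>))" .
  have "0 < likelihood_ratio L f X k s d' \<omega>"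
    unfolding lr using pos s by (intro prod_pos) auto
  then have "ereal (\<Sum>j = s..k. llr (ph d v j) (X j \<omega>)) = elog (likelihood_ratio L f X k s d' \<omega>)"
    unfolding sum_llr_eq_ln_prod[OF pos s(1)] by (simp add: elog_pos lr)
  also have "\<dots> \<le> dcusum_stat L f X k \<omega>"
    unfolding dcusum_stat_def using v s by (intro SUP_upper2[of s] SUP_upper) auto
  finally show ?thesis .
qed

lemma dcusum_not_stopped:
  assumes v: "1 \<le> v" and s: "v \<le> s" "s \<le> k"
    and pos: "\<forall>j\<ge>v. 0 < f 0 (X j \<omega>) \<and> 0 < f (ph d v j) (X j \<omega>)"
    and k: "enat k < dcusum L f X b \<omega>"
  shows "(\<Sum>j = s..k. llr (ph d v j) (X j \<omega>)) \<le> b"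
proof -
  have "\<not> dcusum L f X b \<omega> \<le> enat k" using k by simp
  then have "\<not> ereal b < dcusum_stat L f X k \<omega>"
    unfolding dcusum_def INF_enat_le_iff using v s by auto
  then have "ereal (\<Sum>j = s..k. llr (ph d v j) (X j \<omega>)) \<le> ereal b"
    using dcusum_stat_ge[OF v s pos] by (meson not_le order_trans)
  then show ?thesis by simp
qed

text \<open>The cost of all transitions together, an upper bound for the cost of those made within a
  window.\<close>

definition switch_loss :: "(nat \<Rightarrow> real) \<Rightarrow> real" where
  "switch_loss \<rho> = (\<Sum>i = 1..<L. - ln (\<rho> i))"

text \<open>Bounds the cost of one observation in any phase. The sum replaces a maximum over the
  phases; it still vanishes when all weights do.\<close>

definition stay_loss :: "(nat \<Rightarrow> real) \<Rightarrow> real" where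
  "stay_loss \<rho> = (\<Sum>i = 1..<L. - ln (1 - \<rho> i))"

text \<open>The weights reduce the log-likelihood ratio of the scanned hypothesis by at most
  \<open>stay_loss \<rho>\<close> per observation and \<open>switch_loss \<rho>\<close> in total for
  transitions.\<close>

lemma wdcusum_stat_ge:
  assumes v: "1 \<le> v" and s: "v \<le> s" "s \<le> k"
    and pos: "\<forall>j\<ge>v. 0 < f 0 (X j \<omega>) \<and> 0 < f (ph d v j) (X j \<omega>)"
    and \<rho>: "\<And>i. i \<in> {1..<L} \<Longrightarrow> 0 < \<rho> i \<and> \<rho> i < 1"
  shows "ereal ((\<Sum>j = s..k. llr (ph d v j) (X j \<omega>)) - stay_loss \<rho> * real (k + 1 - s) - switch_loss \<rho>)
      \<le> wdcusum_stat L f X \<rho> k \<omega>"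
proof -
  let ?c = "change_point v d"
  \<comment> \<open>Besides starting at \<open>s\<close>, the change-points are capped at
    \<open>k + 1\<close>, the largest position the weighted statistic admits; a phase not begun by
    time \<open>k\<close> becomes empty.\<close>
  define u where "u i = min (k + 1) (max s (?c i))" for i
  define r where "r i = (if i = L then 0 else \<rho> i)" for i
  have r: "0 \<le> r i" "r i < 1" if "i \<in> {1..L}" for i
    using \<rho>[of i] that by (auto simp: r_def)
  have ord: "phases_ordered L u"
    using phases_ordered_change_point[of L v d] unfolding phases_ordered_def u_def
    by (intro ballI min.mono max.mono) auto
  have u1: "u 1 = s" using s by (simp add: u_def)
  have ph': "phase L u j = ph d v j" if "s \<le> j" "j \<le> k" for j
    unfolding phase_def u_def using that by (intro arg_cong[where f = card]) auto
  have uC: "u \<in> {v. 1 \<le> v 1 \<and> (\<forall>i\<in>{1..<L}. v i \<le> v (Suc i)) \<and> v L \<le> k + 1}"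
    using ord v s u1 by (auto simp: phases_ordered_def u_def)
  define R where "R = (\<Prod>j = s..k. f (ph d v j) (X j \<omega>) / f 0 (X j \<omega>))"
  define S where "S = (\<Prod>j = s..k. 1 - r (ph d v j))"
  define W where "W = (\<Prod>i = 1..L. r i ^ of_bool (i < L \<and> u (Suc i) \<le> k))"
  have f0: "0 < f 0 (X j \<omega>)" if "j \<in> {s..k}" for j using pos s that by auto
  have "(\<Prod>i = 1..L. weighted_block L f X \<rho> k u \<omega> i)
      = (\<Prod>i = 1..L. \<Prod>j\<in>segment L u i \<inter> {..k}. f i (X j \<omega>) * (1 - r i)) * W"
    unfolding weighted_block_def Let_def W_def r_def by (rule prod.distrib)
  also have "(\<Prod>i = 1..L. \<Prod>j\<in>segment L u i \<inter> {..k}. f i (X j \<omega>) * (1 - r i))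
      = (\<Prod>j = u 1..k. f (phase L u j) (X j \<omega>) * (1 - r (phase L u j)))"
    by (rule prod_segments[OF ord, where F = "\<lambda>i j. f i (X j \<omega>) * (1 - r i)"]) (use L_ge in simp)
  also have "\<dots> = (\<Prod>j = s..k. f (ph d v j) (X j \<omega>) * (1 - r (ph d v j)))"
    unfolding u1 using ph' by (intro prod.cong) auto
  finally have eq: "(\<Prod>i = 1..L. weighted_block L f X \<rho> k u \<omega> i) / (\<Prod>j = u 1..k. f 0 (X j \<omega>)) = R * S * W"
    unfolding u1 R_def S_def by (simp add: prod.distrib prod_dividef)
  have R: "0 < R" unfolding R_def using pos s by (intro prod_pos) auto
  have phr: "ph d v j \<in> {1..L}" if "j \<in> {s..k}" for j using ph_range[of v j d] that s by auto
  have S: "exp (- stay_loss \<rho> * real (k + 1 - s)) \<le> S"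
  proof -
    have "exp (- stay_loss \<rho>) \<le> 1 - r i" if i: "i \<in> {1..L}" for i
    proof -
      have nonneg: "0 \<le> - ln (1 - \<rho> l)" if "l \<in> {1..<L}" for l
        using \<rho>[OF that] by simp
      have "- ln (1 - r i) \<le> stay_loss \<rho>"
      proof (cases "i = L")
        case True
        then show ?thesis unfolding stay_loss_def r_def using nonneg by (auto intro!: sum_nonneg)
      next
        case False
        then show ?thesis unfolding stay_loss_def r_def using nonneg i
          by (auto intro!: member_le_sum[where f = "\<lambda>i. - ln (1 - \<rho> i)"])
      qed
      then have "exp (- stay_loss \<rho>) \<le> exp (ln (1 - r i))" by simp
      then show ?thesis using r[OF i] by simp
    qed
    then have "(\<Prod>j = s..k. exp (- stay_loss \<rho>)) \<le> S"
      unfolding S_def using phr by (intro prod_mono) auto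
    then show ?thesis by (simp add: exp_of_nat2_mult[symmetric] mult.commute)
  qed
  have W: "exp (- switch_loss \<rho>) \<le> W"
  proof -
    have LL: "{1..L} = insert L {1..<L}" using L_ge by auto
    have "exp (- switch_loss \<rho>) = (\<Prod>i = 1..<L. \<rho> i)"
      using \<rho> by (simp add: switch_loss_def sum_negf exp_sum)
    \<comment> \<open>A transition not made by time \<open>k\<close> has exponent 0, so its factor
      is 1 instead of \<open>\<rho> i\<close>. The factor of phase \<open>L\<close>, added back
      below, is \<open>0 ^ 0 = 1\<close>.\<close>
    also have "\<dots> \<le> (\<Prod>i = 1..<L. r i ^ of_bool (i < L \<and> u (Suc i) \<le> k))"
      using \<rho> by (intro prod_mono) (auto simp: r_def less_imp_le)
    also have "\<dots> = W" unfolding W_def LL by simp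
    finally show ?thesis .
  qed
  have SW: "0 < S" "0 < W" using S W exp_gt_zero less_le_trans by blast+
  have "- stay_loss \<rho> * real (k + 1 - s) \<le> ln S" "- switch_loss \<rho> \<le> ln W"
    using S W SW by (auto simp: ln_ge_iff)
  then have "(\<Sum>j = s..k. llr (ph d v j) (X j \<omega>)) - stay_loss \<rho> * real (k + 1 - s) - switch_loss \<rho> \<le> ln (R * S * W)"
    using R SW unfolding sum_llr_eq_ln_prod[OF pos s(1)] R_def[symmetric] by (simp add: ln_mult)
  then have "ereal ((\<Sum>j = s..k. llr (ph d v j) (X j \<omega>)) - stay_loss \<rho> * real (k + 1 - s) - switch_loss \<rho>)
      \<le> elog ((\<Prod>i = 1..L. weighted_block L f X \<rho> k u \<omega> i) / (\<Prod>j = u 1..k. f 0 (X j \<omega>)))"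
    unfolding eq using R SW by (simp add: elog_pos)
  also have "\<dots> \<le> wdcusum_stat L f X \<rho> k \<omega>"
    unfolding wdcusum_stat_def using uC by (rule SUP_upper)
  finally show ?thesis .
qed

lemma wdcusum_not_stopped:
  assumes v: "1 \<le> v" and s: "v \<le> s" "s \<le> k"
    and pos: "\<forall>j\<ge>v. 0 < f 0 (X j \<omega>) \<and> 0 < f (ph d v j) (X j \<omega>)"
    and \<rho>: "\<And>i. i \<in> {1..<L} \<Longrightarrow> 0 < \<rho> i \<and> \<rho> i < 1"
    and k: "enat k < wdcusum L f X \<rho> b \<omega>"
  shows "(\<Sum>j = s..k. llr (ph d v j) (X j \<omega>)) \<le> b + switch_loss \<rho> + stay_loss \<rho> * real (k + 1 - s)"
proof -
  have "\<not> wdcusum L f X \<rho> b \<omega> \<le> enat k" using k by simp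
  then have "\<not> ereal b \<le> wdcusum_stat L f X \<rho> k \<omega>"
    unfolding wdcusum_def INF_enat_le_iff using v s by auto
  then have "ereal ((\<Sum>j = s..k. llr (ph d v j) (X j \<omega>)) - stay_loss \<rho> * real (k + 1 - s) - switch_loss \<rho>) \<le> ereal b"
    using wdcusum_stat_ge[OF v s pos \<rho>] by (meson not_le order_trans less_imp_le)
  then show ?thesis by simp
qed

end

subsection \<open>Accumulated information\<close>

lemma nat_ceiling_bounds:
  fixes y :: real
  assumes "0 \<le> y"
  shows "y \<le> real (nat \<lceil>y\<rceil>)" "real (nat \<lceil>y\<rceil>) \<le> y + 1"
  using assms by linarith+

context transient_change
begin

text \<open>Measured from the change-point and cut off at the window length \<open>n\<close>. For
  \<open>i = 0\<close> the empty sum gives 0; the last phase never ends, so only the window bounds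
  it.\<close>

definition phase_end :: "(nat \<Rightarrow> nat) \<Rightarrow> nat \<Rightarrow> nat \<Rightarrow> nat" where
  "phase_end d n i = (if i < L then min n (\<Sum>j = 1..i. d j) else n)"

text \<open>The mean log-likelihood ratio gathered over the first \<open>n\<close> observations
  after the change. It does not depend on the position of the change, hence estimates for it are
  uniform in \<open>v\<close>.\<close>

definition info_upto :: "(nat \<Rightarrow> nat) \<Rightarrow> nat \<Rightarrow> real" where
  "info_upto d n = (\<Sum>i = 1..L. info i * (real (phase_end d n i) - real (phase_end d n (i - 1))))"

lemma phase_end_mono: "phase_end d n (i - 1) \<le> phase_end d n i"
proof -
  have "(\<Sum>j = 1..i - 1. d j) \<le> (\<Sum>j = 1..i. d j)" by (intro sum_mono2) auto
  then show ?thesis by (auto simp: phase_end_def)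
qed

lemma sum_info_eq_info_upto: "(\<Sum>j\<in>{v..<v + n}. info (ph d v j)) = info_upto d n"
proof -
  let ?c = "change_point v d"
  have "(\<Sum>j\<in>{v..<v + n}. info (ph d v j))
      = (\<Sum>i = 1..L. \<Sum>j\<in>{j\<in>{v..<v + n}. ph d v j = i}. info (ph d v j))"
    using ph_range[of v _ d] by (intro sum.group[symmetric]) auto
  also have "\<dots> = info_upto d n"
    unfolding info_upto_def
  proof (intro sum.cong refl)
    fix i assume i: "i \<in> {1..L}"
    have ci: "?c i = v + (\<Sum>j = 1..i - 1. d j)"
      using i by (auto simp: change_point_def intro!: sum.cong)
    have cS: "?c (Suc i) = v + (\<Sum>j = 1..i. d j)"
      by (simp add: change_point_def atLeastLessThanSuc_atLeastAtMost del: sum.op_ivl_Suc)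
    have "{j\<in>{v..<v + n}. ph d v j = i} = {v + phase_end d n (i - 1)..<v + phase_end d n i}"
    proof (intro set_eqI)
      fix j
      have "ph d v j = i \<longleftrightarrow> j \<in> segment L ?c i" if "v \<le> j"
        using segment_phase_iff[OF phases_ordered_change_point[of L v d] _ _ i, of j] L_ge that by simp
      then show "j \<in> {j\<in>{v..<v + n}. ph d v j = i} \<longleftrightarrow> j \<in> {v + phase_end d n (i - 1)..<v + phase_end d n i}"
        using i ci cS by (cases "v \<le> j") (auto simp: segment_def phase_end_def)
    qed
    then have "card {j\<in>{v..<v + n}. ph d v j = i} = phase_end d n i - phase_end d n (i - 1)" by simp
    then have "real (card {j\<in>{v..<v + n}. ph d v j = i}) = real (phase_end d n i) - real (phase_end d n (i - 1))"
      using phase_end_mono[of d n i] by (simp add: of_nat_diff)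
    moreover have "(\<Sum>j\<in>{j\<in>{v..<v + n}. ph d v j = i}. info (ph d v j))
        = (\<Sum>j\<in>{j\<in>{v..<v + n}. ph d v j = i}. info i)"
      by (intro sum.cong) auto
    ultimately show "(\<Sum>j\<in>{j\<in>{v..<v + n}. ph d v j = i}. info (ph d v j))
        = info i * (real (phase_end d n i) - real (phase_end d n (i - 1)))"
      by simp
  qed
  finally show ?thesis .
qed

definition info_min :: real where
  "info_min = Min (info ` {1..L})"

lemma info_min_pos: "0 < info_min"
  unfolding info_min_def using L_ge KL_pos by (subst Min_gr_iff) auto

lemma info_min_le: "i \<in> {1..L} \<Longrightarrow> info_min \<le> info i"
  unfolding info_min_def by (intro Min_le) auto

lemma sum_info_ge:
  assumes "v \<le> s"
  shows "info_min * n \<le> (\<Sum>j\<in>{s..<s + n}. info (ph d v j))"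
proof -
  have "(\<Sum>j\<in>{s..<s + n}. info_min) \<le> (\<Sum>j\<in>{s..<s + n}. info (ph d v j))"
    using assms by (intro sum_mono info_min_le ph_range) auto
  then show ?thesis by (simp add: mult.commute)
qed

text \<open>Every observation brings at least \<open>info_min\<close>. This converts a margin in
  window length into a margin in information, whatever phase the margin falls in.\<close>

lemma info_upto_add_ge: "info_upto d n + info_min * m \<le> info_upto d (n + m)"
proof -
  \<comment> \<open>The position of the window is immaterial, so it is placed at 0.\<close>
  have "info_upto d (n + m) = (\<Sum>j\<in>{0..<n}. info (ph d 0 j)) + (\<Sum>j\<in>{n..<n + m}. info (ph d 0 j))"
    using sum_info_eq_info_upto[where v = 0 and n = "n + m" and d = d] sum.atLeastLessThan_concat[of 0 n "n + m" "\<lambda>j. info (ph d 0 j)"]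
    by simp
  then show ?thesis
    using sum_info_eq_info_upto[where v = 0 and n = n and d = d] sum_info_ge[of 0 n m d] by simp
qed

end

section \<open>The critical phase and the limit of the accumulated information\<close>

locale growing_durations = transient_change L M f X Pinf P
  for L and M :: "'a measure" and f and X and Pinf :: "'w measure" and P +
  fixes d :: "real \<Rightarrow> nat \<Rightarrow> nat" and c :: "nat \<Rightarrow> ennreal"
  assumes d_lim: "\<And>i. i \<in> {1..L - 1} \<Longrightarrow>
      ((\<lambda>\<gamma>. ennreal (real (d \<gamma> i) * KL_info M f i / ln \<gamma>)) \<longlongrightarrow> c i) at_top"
    and c_L: "c L = \<infinity>"
begin

definition h :: nat where
  "h = critical_phase L c"

text \<open>The optimal delay per unit of \<open>ln \<gamma>\<close>, as a real number. Converting
  the \<open>c i\<close> is faithful since those below the critical phase are finite, by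
  \<open>c_finite\<close>.\<close>

definition \<kappa> :: real where
  "\<kappa> = (\<Sum>i = 1..<h. enn2real (c i) / info i) + (1 - (\<Sum>i = 1..<h. enn2real (c i))) / info h"

lemma h: "1 \<le> h" "h \<le> L" "1 \<le> (\<Sum>i = 1..h. c i)" "(\<Sum>i = 1..<h. c i) < 1"
proof -
  let ?p = "\<lambda>j. 1 \<le> j \<and> j \<le> L \<and> 1 \<le> (\<Sum>i = 1..j. c i)"
  have "1 \<le> c L" by (simp add: c_L)
  also have "c L \<le> (\<Sum>i = 1..L. c i)" using L_ge by (intro member_le_sum) auto
  finally have "?p L" using L_ge by simp
  then have p: "?p h" unfolding h_def critical_phase_def by (rule LeastI)
  then show "1 \<le> h" "h \<le> L" "1 \<le> (\<Sum>i = 1..h. c i)" by auto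
  show "(\<Sum>i = 1..<h. c i) < 1"
  proof (rule ccontr)
    assume "\<not> (\<Sum>i = 1..<h. c i) < 1"
    moreover have eq: "{1..<h} = {1..h - 1}" using p by auto
    ultimately have "1 \<le> (\<Sum>i = 1..h - 1. c i)" by (simp add: not_less)
    then have "1 \<le> h - 1" by (cases "h - 1 = 0") auto
    with \<open>1 \<le> (\<Sum>i = 1..h - 1. c i)\<close> have "?p (h - 1)" using p by auto
    then have "h \<le> h - 1" unfolding h_def critical_phase_def by (rule Least_le)
    then show False using p by simp
  qed
qed

lemma info_pos: "i \<in> {1..L} \<Longrightarrow> 0 < info i"
  by (rule KL_pos)

lemma c_finite:
  assumes "i \<in> {1..<h}"
  shows "c i = ennreal (enn2real (c i))"
proof -
  have "c i \<le> (\<Sum>i = 1..<h. c i)" using assms by (intro member_le_sum) auto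
  also have "\<dots> < top" using h(4) by (rule less_trans) simp
  finally show ?thesis by simp
qed

lemma sum_c_eq: "(\<Sum>i = 1..<h. c i) = ennreal (\<Sum>i = 1..<h. enn2real (c i))"
proof -
  have "(\<Sum>i = 1..<h. c i) = (\<Sum>i = 1..<h. ennreal (enn2real (c i)))" by (intro sum.cong refl c_finite)
  also have "\<dots> = ennreal (\<Sum>i = 1..<h. enn2real (c i))" by (rule sum_ennreal) simp
  finally show ?thesis .
qed

lemma sum_c_less: "(\<Sum>i = 1..<h. enn2real (c i)) < 1"
  using h(4) unfolding sum_c_eq ennreal_1[symmetric]
  by (subst (asm) ennreal_less_iff) (auto intro!: sum_nonneg)

lemma \<kappa>_pos: "0 < \<kappa>"
  unfolding \<kappa>_def using sum_c_less info_pos h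
  by (intro add_nonneg_pos sum_nonneg divide_nonneg_pos divide_pos_pos) auto

lemma c_div: "i \<in> {1..<h} \<Longrightarrow> c i / ennreal (info i) = ennreal (enn2real (c i) / info i)"
  using info_pos[of i] h by (subst c_finite) (auto simp: divide_ennreal)

lemma ennreal_\<kappa>:
  "ennreal \<kappa> = (\<Sum>i = 1..<h. c i / ennreal (info i)) + (1 - (\<Sum>i = 1..<h. c i)) / ennreal (info h)"
proof -
  have "(\<Sum>i = 1..<h. c i / ennreal (info i)) = ennreal (\<Sum>i = 1..<h. enn2real (c i) / info i)"
  proof -
    have "(\<Sum>i = 1..<h. c i / ennreal (info i)) = (\<Sum>i = 1..<h. ennreal (enn2real (c i) / info i))"
      by (intro sum.cong refl c_div)
    also have "\<dots> = ennreal (\<Sum>i = 1..<h. enn2real (c i) / info i)"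
      using info_pos h by (intro sum_ennreal divide_nonneg_pos) auto
    finally show ?thesis .
  qed
  moreover have "(1 - (\<Sum>i = 1..<h. c i)) / ennreal (info h)
      = ennreal ((1 - (\<Sum>i = 1..<h. enn2real (c i))) / info h)"
    unfolding sum_c_eq using sum_c_less info_pos[of h] h
    by (auto simp: divide_ennreal ennreal_minus sum_nonneg simp flip: ennreal_1)
  ultimately show ?thesis
    unfolding \<kappa>_def using sum_c_less info_pos h
    by (subst ennreal_plus) (auto intro!: sum_nonneg divide_nonneg_pos)
qed

lemma optimal_delay_eq: "1 < \<gamma> \<Longrightarrow> optimal_delay L c info \<gamma> = ennreal (\<kappa> * ln \<gamma>)"
  unfolding optimal_delay_def Let_def h_def[symmetric] ennreal_\<kappa>[symmetric]
  using \<kappa>_pos by (simp add: ennreal_mult mult.commute)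

text \<open>On the scale \<open>ln \<gamma>\<close>, phases before \<open>h\<close> fit into the
  optimal window completely, whereas from phase \<open>h\<close> on the window is exhausted.\<close>

definition end_limit :: "nat \<Rightarrow> real" where
  "end_limit i = (if i < h then (\<Sum>j = 1..i. enn2real (c j) / info j) else \<kappa>)"

text \<open>Scaled durations may tend to infinity, so sums and minima are taken to the limit in
  \<open>ennreal\<close>. The minimum with the scaled window length has a finite limit, which brings
  the statement back to the reals.\<close>

lemma phase_end_tendsto:
  "((\<lambda>\<gamma>. real (phase_end (d \<gamma>) (nat \<lceil>\<kappa> * ln \<gamma>\<rceil>) i) / ln \<gamma>) \<longlongrightarrow> end_limit i) at_top"
proof -
  have n_lim: "((\<lambda>\<gamma>. real (nat \<lceil>\<kappa> * ln \<gamma>\<rceil>) / ln \<gamma>) \<longlongrightarrow> \<kappa>) at_top"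
  proof (rule tendsto_sandwich)
    show "((\<lambda>\<gamma>::real. \<kappa>) \<longlongrightarrow> \<kappa>) at_top" by simp
    show "((\<lambda>\<gamma>. \<kappa> + 1 / ln \<gamma>) \<longlongrightarrow> \<kappa>) at_top"
    proof -
      have "((\<lambda>\<gamma>::real. 1 / ln \<gamma>) \<longlongrightarrow> 0) at_top" by real_asymp
      then show ?thesis using tendsto_add[OF tendsto_const[of \<kappa>]] by fastforce
    qed
    have bounds: "\<kappa> * ln \<gamma> \<le> real (nat \<lceil>\<kappa> * ln \<gamma>\<rceil>) \<and> real (nat \<lceil>\<kappa> * ln \<gamma>\<rceil>) \<le> \<kappa> * ln \<gamma> + 1 \<and> 0 < ln \<gamma>"
      if "1 < \<gamma>" for \<gamma>
    proof -
      have "0 \<le> \<kappa> * ln \<gamma>" using \<kappa>_pos that by simp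
      then show ?thesis using nat_ceiling_bounds that by simp
    qed
    show "\<forall>\<^sub>F \<gamma> in at_top. \<kappa> \<le> real (nat \<lceil>\<kappa> * ln \<gamma>\<rceil>) / ln \<gamma>"
      using eventually_gt_at_top[of "1::real"]
      by eventually_elim (use bounds in \<open>auto simp: pos_le_divide_eq\<close>)
    show "\<forall>\<^sub>F \<gamma> in at_top. real (nat \<lceil>\<kappa> * ln \<gamma>\<rceil>) / ln \<gamma> \<le> \<kappa> + 1 / ln \<gamma>"
      using eventually_gt_at_top[of "1::real"]
    proof eventually_elim
      case (elim \<gamma>)
      have "0 < ln \<gamma>" using bounds[OF elim] by simp
      have "real (nat \<lceil>\<kappa> * ln \<gamma>\<rceil>) / ln \<gamma> \<le> (\<kappa> * ln \<gamma> + 1) / ln \<gamma>"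
        using bounds[OF elim] by (intro divide_right_mono) auto
      also have "\<dots> = \<kappa> + 1 / ln \<gamma>" using \<open>0 < ln \<gamma>\<close> by (simp add: add_divide_distrib)
      finally show ?case .
    qed
  qed
  show ?thesis
  proof (cases "i < L")
    case False
    then have "\<not> i < h" using h by simp
    then show ?thesis using n_lim False by (simp add: phase_end_def end_limit_def)
  next
    case True
    let ?C = "\<Sum>j = 1..i. c j / ennreal (info j)"
    have d_div: "((\<lambda>\<gamma>. ennreal (real (d \<gamma> j) / ln \<gamma>)) \<longlongrightarrow> c j / ennreal (info j)) at_top" if j: "j \<in> {1..i}" for j
    proof -
      have Ij: "0 < info j" using info_pos j True by auto
      have "((\<lambda>\<gamma>. ennreal (1 / info j) * ennreal (real (d \<gamma> j) * info j / ln \<gamma>)) \<longlongrightarrow> ennreal (1 / info j) * c j) at_top"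
        using j True by (intro ennreal_tendsto_cmult d_lim) auto
      also have "(\<lambda>\<gamma>. ennreal (1 / info j) * ennreal (real (d \<gamma> j) * info j / ln \<gamma>)) = (\<lambda>\<gamma>. ennreal (real (d \<gamma> j) / ln \<gamma>))"
        using Ij by (intro ext, subst ennreal_mult'[symmetric]) auto
      also have "ennreal (1 / info j) * c j = c j / ennreal (info j)"
        using Ij by (simp add: divide_ennreal_def inverse_ennreal mult.commute inverse_eq_divide)
      finally show ?thesis .
    qed
    have "((\<lambda>\<gamma>. \<Sum>j = 1..i. ennreal (real (d \<gamma> j) / ln \<gamma>)) \<longlongrightarrow> ?C) at_top"
      by (intro tendsto_sum d_div)
    moreover have "\<forall>\<^sub>F \<gamma> in at_top. (\<Sum>j = 1..i. ennreal (real (d \<gamma> j) / ln \<gamma>)) = ennreal (real (\<Sum>j = 1..i. d \<gamma> j) / ln \<gamma>)"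
      using eventually_gt_at_top[of "1::real"]
      by eventually_elim (subst sum_ennreal, auto simp: sum_divide_distrib)
    ultimately have S: "((\<lambda>\<gamma>. ennreal (real (\<Sum>j = 1..i. d \<gamma> j) / ln \<gamma>)) \<longlongrightarrow> ?C) at_top"
      by (rule Lim_transform_eventually)
    have "((\<lambda>\<gamma>. ennreal (real (nat \<lceil>\<kappa> * ln \<gamma>\<rceil>) / ln \<gamma>)) \<longlongrightarrow> ennreal \<kappa>) at_top"
      using n_lim by (rule tendsto_ennrealI)
    then have "((\<lambda>\<gamma>. min (ennreal (real (nat \<lceil>\<kappa> * ln \<gamma>\<rceil>) / ln \<gamma>)) (ennreal (real (\<Sum>j = 1..i. d \<gamma> j) / ln \<gamma>)))
        \<longlongrightarrow> min (ennreal \<kappa>) ?C) at_top"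
      using S by (rule tendsto_min)
    moreover have "\<forall>\<^sub>F \<gamma> in at_top. min (ennreal (real (nat \<lceil>\<kappa> * ln \<gamma>\<rceil>) / ln \<gamma>)) (ennreal (real (\<Sum>j = 1..i. d \<gamma> j) / ln \<gamma>))
        = ennreal (real (phase_end (d \<gamma>) (nat \<lceil>\<kappa> * ln \<gamma>\<rceil>) i) / ln \<gamma>)"
      using eventually_gt_at_top[of "1::real"]
    proof eventually_elim
      case (elim \<gamma>)
      then have "0 < ln \<gamma>" by simp
      then show ?case using True
        by (simp add: phase_end_def min_def ennreal_le_iff divide_right_mono divide_le_cancel del: of_nat_sum)
    qed
    ultimately have lim: "((\<lambda>\<gamma>. ennreal (real (phase_end (d \<gamma>) (nat \<lceil>\<kappa> * ln \<gamma>\<rceil>) i) / ln \<gamma>)) \<longlongrightarrow> min (ennreal \<kappa>) ?C) at_top"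
      by (rule Lim_transform_eventually)
    have "min (ennreal \<kappa>) ?C = ennreal (end_limit i)"
    proof (cases "i < h")
      case i: True
      have "?C \<le> (\<Sum>j = 1..<h. c j / ennreal (info j))" using i by (intro sum_mono2) auto
      also have "\<dots> \<le> ennreal \<kappa>" unfolding ennreal_\<kappa> by simp
      finally have "min (ennreal \<kappa>) ?C = ?C" by (simp add: min_def)
      also have "\<dots> = ennreal (end_limit i)"
      proof -
        have "?C = (\<Sum>j = 1..i. ennreal (enn2real (c j) / info j))"
          using i by (intro sum.cong refl c_div) auto
        also have "\<dots> = ennreal (\<Sum>j = 1..i. enn2real (c j) / info j)"
          using info_pos True by (intro sum_ennreal divide_nonneg_pos) auto
        finally show ?thesis using i by (simp add: end_limit_def)
      qed
      finally show ?thesis .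
    next
      case i: False
      have split: "{1..h} = insert h {1..<h}" using h by auto
      \<comment> \<open>The choice of \<open>h\<close> enters here: phase \<open>h\<close> is long
        enough to supply the missing information, so it reaches the end of the window in the
        limit.\<close>
      have "1 - (\<Sum>i = 1..<h. c i) \<le> c h"
        using h(3) h(4) unfolding split by (simp add: ennreal_minus_le_iff add.commute)
      then have "ennreal \<kappa> \<le> (\<Sum>j = 1..<h. c j / ennreal (info j)) + c h / ennreal (info h)"
        unfolding ennreal_\<kappa> by (intro add_left_mono divide_right_mono_ennreal)
      also have "\<dots> = (\<Sum>j = 1..h. c j / ennreal (info j))" unfolding split by (simp add: add.commute)
      also have "\<dots> \<le> ?C" using i by (intro sum_mono2) auto
      finally show ?thesis using i by (simp add: end_limit_def min_def)
    qed
    moreover have "0 \<le> end_limit i"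
      unfolding end_limit_def using \<kappa>_pos info_pos True by (auto intro!: sum_nonneg divide_nonneg_pos)
    moreover have "\<forall>\<^sub>F \<gamma> in at_top. 0 \<le> real (phase_end (d \<gamma>) (nat \<lceil>\<kappa> * ln \<gamma>\<rceil>) i) / ln \<gamma>"
      using eventually_gt_at_top[of "1::real"] by eventually_elim auto
    ultimately show ?thesis using lim by (simp add: tendsto_ennreal_iff)
  qed
qed

text \<open>This is what determines \<open>\<kappa>\<close>: each phase \<open>i\<close> before
  \<open>h\<close> contributes \<open>c i\<close>, and phase \<open>h\<close> contributes the rest
  up to 1.\<close>

lemma info_upto_tendsto: "((\<lambda>\<gamma>. info_upto (d \<gamma>) (nat \<lceil>\<kappa> * ln \<gamma>\<rceil>) / ln \<gamma>) \<longlongrightarrow> 1) at_top"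
proof -
  let ?e = "\<lambda>\<gamma> i. real (phase_end (d \<gamma>) (nat \<lceil>\<kappa> * ln \<gamma>\<rceil>) i) / ln \<gamma>"
  have "((\<lambda>\<gamma>. \<Sum>i = 1..L. info i * (?e \<gamma> i - ?e \<gamma> (i - 1))) \<longlongrightarrow> (\<Sum>i = 1..L. info i * (end_limit i - end_limit (i - 1)))) at_top"
    by (intro tendsto_sum tendsto_mult tendsto_const tendsto_diff phase_end_tendsto)
  also have "(\<lambda>\<gamma>. \<Sum>i = 1..L. info i * (?e \<gamma> i - ?e \<gamma> (i - 1))) = (\<lambda>\<gamma>. info_upto (d \<gamma>) (nat \<lceil>\<kappa> * ln \<gamma>\<rceil>) / ln \<gamma>)"
    unfolding info_upto_def by (simp add: sum_divide_distrib diff_divide_distrib[symmetric])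
  \<comment> \<open>Beyond phase \<open>h\<close> both ends of a phase tend to
    \<open>\<kappa>\<close>, so its share vanishes.\<close>
  also have "(\<Sum>i = 1..L. info i * (end_limit i - end_limit (i - 1))) = (\<Sum>i = 1..h. info i * (end_limit i - end_limit (i - 1)))"
    using h by (intro sum.mono_neutral_right) (auto simp: end_limit_def)
  also have "\<dots> = (\<Sum>i = 1..<h. info i * (end_limit i - end_limit (i - 1))) + info h * (end_limit h - end_limit (h - 1))"
  proof -
    have "{1..h} = insert h {1..<h}" using h by auto
    then show ?thesis by simp
  qed
  also have "(\<Sum>i = 1..<h. info i * (end_limit i - end_limit (i - 1))) = (\<Sum>i = 1..<h. enn2real (c i))"
  proof (intro sum.cong refl)
    fix i assume i: "i \<in> {1..<h}"
    then have "(\<Sum>j = 1..i. enn2real (c j) / info j) = enn2real (c i) / info i + (\<Sum>j = 1..i - 1. enn2real (c j) / info j)"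
      by (cases i) (auto simp: add.commute)
    then have "end_limit i - end_limit (i - 1) = enn2real (c i) / info i"
      using i by (auto simp: end_limit_def)
    then show "info i * (end_limit i - end_limit (i - 1)) = enn2real (c i)"
      using info_pos[of i] i h by simp
  qed
  also have "info h * (end_limit h - end_limit (h - 1)) = 1 - (\<Sum>i = 1..<h. enn2real (c i))"
  proof -
    have "{1..h - 1} = {1..<h}" using h by auto
    then have "end_limit h - end_limit (h - 1) = (1 - (\<Sum>i = 1..<h. enn2real (c i))) / info h"
      using h by (simp add: end_limit_def \<kappa>_def)
    then show ?thesis using info_pos[of h] h by simp
  qed
  finally show ?thesis by simp
qed

end

subsection \<open>First-order asymptotics\<close>

context growing_durations
begin

lemma eventually_ln: "\<forall>\<^sub>F x in at_top. Q x \<Longrightarrow> \<forall>\<^sub>F \<gamma> :: real in at_top. Q (ln \<gamma>)"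
  by (rule eventually_compose_filterlim[OF _ ln_at_top])

lemma eventually_info_upto_le:
  assumes "0 < \<theta>"
  shows "\<forall>\<^sub>F \<gamma> in at_top. info_upto (d \<gamma>) (nat \<lceil>\<kappa> * ln \<gamma>\<rceil>) \<le> (1 + \<theta>) * ln \<gamma>
      \<and> (1 - \<theta>) * ln \<gamma> \<le> info_upto (d \<gamma>) (nat \<lceil>\<kappa> * ln \<gamma>\<rceil>)"
proof -
  have "\<forall>\<^sub>F \<gamma> in at_top. info_upto (d \<gamma>) (nat \<lceil>\<kappa> * ln \<gamma>\<rceil>) / ln \<gamma> < 1 + \<theta>"
       "\<forall>\<^sub>F \<gamma> in at_top. 1 - \<theta> < info_upto (d \<gamma>) (nat \<lceil>\<kappa> * ln \<gamma>\<rceil>) / ln \<gamma>"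
    using order_tendstoD[OF info_upto_tendsto] assms by auto
  with eventually_gt_at_top[of "1::real"] show ?thesis
  proof eventually_elim
    case (elim \<gamma>)
    then have "0 < ln \<gamma>" by simp
    then show ?case using elim by (simp add: pos_divide_less_eq pos_less_divide_eq less_imp_le)
  qed
qed

lemma pollak_delay_asymp_ge:
  assumes \<epsilon>: "0 < \<epsilon>" "\<epsilon> < 1"
  shows "\<forall>\<^sub>F \<gamma> in at_top. \<forall>\<tau>\<in>admissible Pinf M X \<gamma>. ennreal ((1 - \<epsilon>) * \<kappa> * ln \<gamma>) \<le> pollak_delay (P (d \<gamma>)) \<tau>"
proof -
  \<comment> \<open>One factor \<open>1 - \<eta>\<close> is spent on the window length and one on
    the probability of not stopping in it; their product is at least
    \<open>1 - \<epsilon>\<close>.\<close>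
  define \<eta> where "\<eta> = \<epsilon> / 2"
  \<comment> \<open>Shortening the window by \<open>\<eta> * \<kappa> * x\<close> saves information
    \<open>4 * \<theta> * x\<close>. One \<open>\<theta>\<close> covers the error in the limit of
    \<open>info_upto\<close>, one the rounding, and one the deviation; the last remains in the
    exponent \<open>(1 - \<theta>) * x\<close>.\<close>
  define \<theta> where "\<theta> = info_min * \<eta> * \<kappa> / 4"
  have \<eta>: "0 < \<eta>" "\<eta> < 1" using \<epsilon> by (auto simp: \<eta>_def)
  have \<theta>: "0 < \<theta>" using \<eta> info_min_pos \<kappa>_pos by (simp add: \<theta>_def)
  let ?R = "\<kappa> + 1"
  have R: "0 < ?R" using \<kappa>_pos by simp
  have dev: "\<forall>\<^sub>F x in at_top. \<forall>d v T. 1 \<le> v \<longrightarrow> finite T \<longrightarrow> T \<subseteq> {v..} \<longrightarrow> card T \<le> ?R * x \<longrightarrow>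
      measure (P d v) {\<omega>\<in>space (P d v). \<theta> * x \<le> \<bar>\<Sum>j\<in>T. llr (ph d v j) (X j \<omega>) - info (ph d v j)\<bar>} \<le> \<eta> / 2"
    using \<eta> by (intro llr_deviation \<theta> R) auto
  have "\<forall>\<^sub>F x in at_top. 2 * (?R * x) * exp (- \<theta> * x) < \<eta> / 2"
  proof -
    have "((\<lambda>x::real. x * exp (- \<theta> * x)) \<longlongrightarrow> 0) at_top" using \<theta> by real_asymp
    then have "((\<lambda>x. 2 * ?R * (x * exp (- \<theta> * x))) \<longlongrightarrow> 2 * ?R * 0) at_top" by (intro tendsto_intros)
    then show ?thesis using \<eta> by (auto dest!: order_tendstoD(2)[where a = "\<eta> / 2"] simp: mult_ac)
  qed
  note ev = eventually_ln[OF this] eventually_ln[OF dev] eventually_info_upto_le[OF \<theta>]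
    eventually_ln[OF eventually_ge_at_top[of 1]] eventually_ln[OF eventually_ge_at_top[of "info_min / \<theta>"]]
    eventually_gt_at_top[of 1] eventually_ln[OF eventually_ge_at_top[of "1 / (\<kappa> * \<eta>)"]]
  have "\<forall>\<^sub>F \<gamma> :: real in at_top. 2 * (r * ln \<gamma>) \<le> \<gamma>" if "0 < r" for r :: real
    using that by real_asymp
  from ev this[OF R] show ?thesis
  proof eventually_elim
    case (elim \<gamma>)
    show ?case
    proof
      fix \<tau> assume \<tau>: "\<tau> \<in> admissible Pinf M X \<gamma>"
      define x where "x = ln \<gamma>"
      have ex: "exp x = \<gamma>" using elim by (simp add: x_def)
      have x: "1 \<le> x" "info_min \<le> \<theta> * x" "1 \<le> \<kappa> * \<eta> * x"
        using elim \<theta> \<eta> \<kappa>_pos by (auto simp: x_def field_simps)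
      have st: "stopping_time (obs_filtration Pinf M X) \<tau>" and fa: "ennreal \<gamma> \<le> false_alarm_time Pinf \<tau>"
        using \<tau> by (auto simp: admissible_def)
      define m where "m = nat \<lceil>(1 - \<eta>) * \<kappa> * x\<rceil>"
      have pos: "0 < (1 - \<eta>) * \<kappa> * x" using \<eta> \<kappa>_pos x by simp
      then have m_pos: "0 < m" by (simp add: m_def)
      have m: "(1 - \<eta>) * \<kappa> * x \<le> m" "m \<le> (1 - \<eta>) * \<kappa> * x + 1"
        using nat_ceiling_bounds[of "(1 - \<eta>) * \<kappa> * x"] pos by (auto simp: m_def)
      have m_R: "m \<le> ?R * x"
      proof -
        have "(1 - \<eta>) * (\<kappa> * x) \<le> 1 * (\<kappa> * x)" using \<eta> \<kappa>_pos x by (intro mult_right_mono) auto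
        then show ?thesis using m x by (simp add: algebra_simps)
      qed
      define n where "n = nat \<lceil>\<kappa> * x\<rceil>"
      have n: "\<kappa> * x \<le> n" using nat_ceiling_bounds[of "\<kappa> * x"] \<kappa>_pos x by (simp add: n_def)
      have nm: "\<eta> * \<kappa> * x - 1 \<le> real n - real m" using n m by (simp add: algebra_simps)
      have mn: "m \<le> n" using nm x by (simp add: mult_ac)
      have info_m: "info_upto (d \<gamma>) m \<le> (1 - 2 * \<theta>) * x"
      proof -
        have "info_upto (d \<gamma>) m + info_min * (n - m) \<le> info_upto (d \<gamma>) n"
          using info_upto_add_ge[of "d \<gamma>" m "n - m"] mn by simp
        also have "\<dots> \<le> (1 + \<theta>) * x" using elim by (simp add: n_def x_def)
        finally have "info_upto (d \<gamma>) m \<le> (1 + \<theta>) * x - info_min * (real n - real m)"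
          using mn by (simp add: of_nat_diff)
        moreover have "info_min * (\<eta> * \<kappa> * x - 1) \<le> info_min * (real n - real m)"
          using nm info_min_pos by (intro mult_left_mono) auto
        moreover have "info_min * (\<eta> * \<kappa> * x - 1) = 4 * \<theta> * x - info_min"
          by (simp add: \<theta>_def algebra_simps)
        ultimately have "info_upto (d \<gamma>) m \<le> (1 + \<theta>) * x - (4 * \<theta> * x - info_min)"
          by linarith
        then show ?thesis using x by (simp add: algebra_simps)
      qed
      \<comment> \<open>The factor 2 gives \<open>m / \<delta> = \<gamma> / 2\<close>, strictly
        below the false alarm time as \<open>exists_quiet_window\<close> demands.\<close>
      define \<delta> where "\<delta> = 2 * m / \<gamma>"
      have \<gamma>: "0 < \<gamma>" using elim by simp
      have \<delta>: "0 < \<delta>" "\<delta> \<le> 1"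
        using m_pos m_R \<gamma> elim by (auto simp: \<delta>_def x_def divide_simps)
      have "ennreal (m / \<delta>) < ennreal \<gamma>"
        using m_pos \<gamma> by (intro ennreal_lessI) (auto simp: \<delta>_def)
      then have "ennreal (m / \<delta>) < false_alarm_time Pinf \<tau>" using fa by (rule less_le_trans)
      then obtain v where v: "1 \<le> v" "0 < measure Pinf {\<omega>\<in>space Pinf. enat v \<le> \<tau> \<omega>}"
        "measure Pinf {\<omega>\<in>space Pinf. enat v \<le> \<tau> \<omega> \<and> \<tau> \<omega> < enat (v + m)}
          \<le> \<delta> * measure Pinf {\<omega>\<in>space Pinf. enat v \<le> \<tau> \<omega>}"
        using exists_quiet_window[OF st m_pos \<delta>] by blast
      interpret V: prob_space "P (d \<gamma>) v" by (rule prob_space_P[OF v(1)])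
      let ?Z = "\<lambda>\<omega>. \<Sum>j\<in>{v..<v + m}. llr (ph (d \<gamma>) v j) (X j \<omega>)"
      let ?D = "\<lambda>\<omega>. \<Sum>j\<in>{v..<v + m}. llr (ph (d \<gamma>) v j) (X j \<omega>) - info (ph (d \<gamma>) v j)"
      have Zm: "?Z \<in> borel_measurable (P (d \<gamma>) v)" "?D \<in> borel_measurable (P (d \<gamma>) v)"
        using v(1) by (intro borel_measurable_sum borel_measurable_diff borel_measurable_const borel_measurable_integrable[OF integrable_llr_X]; simp)+
      have "V.prob {\<omega>\<in>space (P (d \<gamma>) v). (1 - \<theta>) * x < ?Z \<omega>}
          \<le> V.prob {\<omega>\<in>space (P (d \<gamma>) v). \<theta> * x \<le> \<bar>?D \<omega>\<bar>}"
      proof (rule V.finite_measure_mono)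
        show "{\<omega>\<in>space (P (d \<gamma>) v). (1 - \<theta>) * x < ?Z \<omega>} \<subseteq> {\<omega>\<in>space (P (d \<gamma>) v). \<theta> * x \<le> \<bar>?D \<omega>\<bar>}"
        proof -
          have "?D \<omega> = ?Z \<omega> - info_upto (d \<gamma>) m" for \<omega>
            by (simp only: sum_subtractf sum_info_eq_info_upto)
          then show ?thesis using info_m by (auto simp: left_diff_distrib)
        qed
        show "{\<omega>\<in>space (P (d \<gamma>) v). \<theta> * x \<le> \<bar>?D \<omega>\<bar>} \<in> V.events" using Zm(2) by measurable
      qed
      also have "\<dots> \<le> \<eta> / 2"
      proof -
        have "1 \<le> v \<longrightarrow> finite {v..<v + m} \<longrightarrow> {v..<v + m} \<subseteq> {v..} \<longrightarrow> card {v..<v + m} \<le> ?R * x \<longrightarrow>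
          V.prob {\<omega>\<in>space (P (d \<gamma>) v). \<theta> * x \<le> \<bar>?D \<omega>\<bar>} \<le> \<eta> / 2"
          using elim(2)[rule_format, of v "{v..<v + m}" "d \<gamma>"] unfolding x_def by blast
        then show ?thesis using v m_R by auto
      qed
      finally have q: "V.prob {\<omega>\<in>space (P (d \<gamma>) v). (1 - \<theta>) * x < ?Z \<omega>} \<le> \<eta> / 2" .
      have "exp ((1 - \<theta>) * x) * \<delta> = 2 * m * exp (- \<theta> * x)"
      proof -
        have "exp ((1 - \<theta>) * x) = \<gamma> * exp (- \<theta> * x)"
          unfolding ex[symmetric] exp_add[symmetric] by (simp add: algebra_simps)
        then show ?thesis using \<gamma> by (simp add: \<delta>_def)
      qed
      also have "\<dots> \<le> 2 * (?R * x) * exp (- \<theta> * x)" using m_R by (intro mult_right_mono mult_left_mono) auto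
      also have "\<dots> \<le> \<eta> / 2" using elim(1) by (simp add: x_def)
      finally have e: "exp ((1 - \<theta>) * x) * \<delta> \<le> \<eta> / 2" .
      have "(1 - \<epsilon>) * \<kappa> * x \<le> (1 - \<eta>) * ((1 - \<eta>) * \<kappa> * x)"
      proof -
        have "(1 - \<epsilon>) * (\<kappa> * x) \<le> ((1 - \<eta>) * (1 - \<eta>)) * (\<kappa> * x)"
          using \<kappa>_pos x by (intro mult_right_mono) (auto simp: \<eta>_def algebra_simps)
        then show ?thesis by (simp add: mult_ac)
      qed
      also have "\<dots> \<le> (1 - \<eta>) * m" using m \<eta> by (intro mult_left_mono) auto
      also have "\<dots> \<le> m * (1 - exp ((1 - \<theta>) * x) * \<delta> - \<eta> / 2)"
      proof -
        have "m * (1 - \<eta>) \<le> m * (1 - exp ((1 - \<theta>) * x) * \<delta> - \<eta> / 2)"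
          using e by (intro mult_left_mono) auto
        then show ?thesis by (simp add: mult.commute)
      qed
      finally have "ennreal ((1 - \<epsilon>) * \<kappa> * x) \<le> ennreal (m * (1 - exp ((1 - \<theta>) * x) * \<delta> - \<eta> / 2))"
        by (rule ennreal_leI)
      also have "\<dots> \<le> pollak_delay (P (d \<gamma>)) \<tau>"
        by (rule pollak_delay_ge[OF st v q])
      finally show "ennreal ((1 - \<epsilon>) * \<kappa> * ln \<gamma>) \<le> pollak_delay (P (d \<gamma>)) \<tau>"
        by (simp add: x_def)
    qed
  qed
qed

text \<open>Common to both rules: \<open>B\<close> is the threshold with the transition losses,
  \<open>\<eta>\<close> the loss per observation. Over windows of length
  \<open>O(ln \<gamma>)\<close> the latter amounts to \<open>o(ln \<gamma>)\<close>.\<close>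

lemma lorden_delay_asymp_le:
  fixes B \<eta> :: "real \<Rightarrow> real"
  assumes \<epsilon>: "0 < \<epsilon>"
    and B: "((\<lambda>\<gamma>. B \<gamma> / ln \<gamma>) \<longlongrightarrow> 1) at_top" and \<eta>: "(\<eta> \<longlongrightarrow> 0) at_top"
    and st: "\<And>\<gamma>. stopping_time (obs_filtration Pinf M X) (\<tau> \<gamma>)"
    and stop: "\<forall>\<^sub>F \<gamma> in at_top. \<forall>v\<ge>1. AE \<omega> in P (d \<gamma>) v. \<forall>s k. v \<le> s \<longrightarrow> s \<le> k \<longrightarrow> enat k < \<tau> \<gamma> \<omega> \<longrightarrow>
        (\<Sum>j = s..k. llr (ph (d \<gamma>) v j) (X j \<omega>)) \<le> B \<gamma> + \<eta> \<gamma> * real (k + 1 - s)"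
  shows "\<forall>\<^sub>F \<gamma> in at_top. lorden_delay M X (P (d \<gamma>)) (\<tau> \<gamma>) \<le> ennreal ((1 + \<epsilon>) * \<kappa> * ln \<gamma>)"
proof -
  \<comment> \<open>Three equal shares: the extra length of the first block, its rounding, and the
    expected time in later blocks.\<close>
  define \<epsilon>' where "\<epsilon>' = \<epsilon> / 3"
  \<comment> \<open>The extra length brings information at least \<open>4 * \<theta> * x\<close>.
    Rounding and the limit error use one \<open>\<theta>\<close> each, so the mean is at least
    \<open>(1 + 2 * \<theta>) * x\<close>, against a level of at most
    \<open>(1 + \<theta>) * x\<close>; the gap is left for the deviation.\<close>
  define \<theta> where "\<theta> = min (1 / 4) (info_min * \<epsilon>' * \<kappa> / 4)"
  define R where "R = (1 + \<epsilon>') * \<kappa> + 2 / info_min + 1"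
  \<comment> \<open>With \<open>q \<le> 1 / 2\<close> the geometric factor
    \<open>q / (1 - q)\<close> is at most \<open>2 * q\<close>, which the second bound turns into a
    contribution of at most \<open>\<epsilon>' * \<kappa> * x\<close>.\<close>
  define q where "q = min (1 / 2) (\<epsilon>' * \<kappa> / (2 * R))"
  have \<epsilon>': "0 < \<epsilon>'" using \<epsilon> by (simp add: \<epsilon>'_def)
  have \<theta>: "0 < \<theta>" "\<theta> \<le> 1 / 4" "4 * \<theta> \<le> info_min * \<epsilon>' * \<kappa>"
    using \<epsilon>' info_min_pos \<kappa>_pos by (auto simp: \<theta>_def)
  have R: "0 < R" unfolding R_def using \<epsilon>' info_min_pos \<kappa>_pos by (intro add_pos_pos) auto
  have q: "0 < q" "q \<le> 1 / 2" "q \<le> \<epsilon>' * \<kappa> / (2 * R)"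
    using \<epsilon>' \<kappa>_pos R by (auto simp: q_def)
  have ev_B: "\<forall>\<^sub>F \<gamma> in at_top. B \<gamma> / ln \<gamma> < 1 + \<theta> / 2"
    using \<theta> by (intro order_tendstoD(2)[OF B]) auto
  have ev_\<eta>: "\<forall>\<^sub>F \<gamma> in at_top. \<eta> \<gamma> < \<theta> / (2 * R)"
    using \<theta> R by (intro order_tendstoD(2)[OF \<eta>]) auto
  note ev = ev_B ev_\<eta> eventually_ln[OF llr_deviation[OF q(1) \<theta>(1) R]] eventually_info_upto_le[OF \<theta>(1)]
    eventually_ln[OF eventually_ge_at_top[of 1]] eventually_ln[OF eventually_ge_at_top[of "info_min / \<theta>"]]
    eventually_gt_at_top[of 1] eventually_ln[OF eventually_ge_at_top[of "1 / (\<epsilon>' * \<kappa>)"]]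
  from ev stop show ?thesis
  proof eventually_elim
    case (elim \<gamma>)
    define x where "x = ln \<gamma>"
    have x: "1 \<le> x" "info_min \<le> \<theta> * x" "1 \<le> \<epsilon>' * \<kappa> * x"
      using elim \<theta> \<epsilon>' \<kappa>_pos by (auto simp: x_def field_simps)
    define n where "n = nat \<lceil>(1 + \<epsilon>') * \<kappa> * x\<rceil>"
    \<comment> \<open>A later block can start in any phase; even at the rate \<open>info_min\<close>
      this length gathers mean information \<open>2 * x\<close>, above the required
      \<open>(1 + 2 * \<theta>) * x\<close>.\<close>
    define N where "N = nat \<lceil>2 * x / info_min\<rceil>"
    have "0 < (1 + \<epsilon>') * \<kappa> * x" using \<epsilon>' \<kappa>_pos x by simp
    then have n: "1 \<le> n" "(1 + \<epsilon>') * \<kappa> * x \<le> n" "n \<le> (1 + \<epsilon>') * \<kappa> * x + 1"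
      using nat_ceiling_bounds[of "(1 + \<epsilon>') * \<kappa> * x"] by (auto simp: n_def Suc_le_eq)
    have "0 < 2 * x / info_min" using info_min_pos x by simp
    then have N: "1 \<le> N" "2 * x / info_min \<le> N" "N \<le> 2 * x / info_min + 1"
      using nat_ceiling_bounds[of "2 * x / info_min"] by (auto simp: N_def Suc_le_eq)
    have nR: "n \<le> R * x" and NR: "N \<le> R * x"
    proof -
      have "0 \<le> (1 + \<epsilon>') * \<kappa> * x" "0 \<le> 2 / info_min * x" using \<epsilon>' \<kappa>_pos x info_min_pos by auto
      then show "n \<le> R * x" "N \<le> R * x" using n(3) N(3) x by (auto simp: R_def algebra_simps)
    qed
    define n0 where "n0 = nat \<lceil>\<kappa> * x\<rceil>"
    have n0: "n0 \<le> \<kappa> * x + 1" using nat_ceiling_bounds[of "\<kappa> * x"] \<kappa>_pos x by (simp add: n0_def)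
    have nn0: "\<epsilon>' * \<kappa> * x - 1 \<le> real n - real n0" using n0 n by (simp add: algebra_simps)
    have n0n: "n0 \<le> n" using nn0 x by simp
    have info_n: "(1 + 2 * \<theta>) * x \<le> info_upto (d \<gamma>) n"
    proof -
      have "4 * \<theta> * x - \<theta> * x \<le> info_min * \<epsilon>' * \<kappa> * x - info_min"
        using \<theta>(3) x by (intro diff_mono mult_right_mono) auto
      also have "\<dots> = info_min * (\<epsilon>' * \<kappa> * x - 1)" by (simp add: algebra_simps)
      also have "\<dots> \<le> info_min * (real n - real n0)" using nn0 info_min_pos by (intro mult_left_mono) auto
      finally have 1: "3 * \<theta> * x \<le> info_min * (real n - real n0)" by (simp add: algebra_simps)
      have "(1 - \<theta>) * x \<le> info_upto (d \<gamma>) n0" using elim by (simp add: n0_def x_def)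
      moreover have "info_upto (d \<gamma>) n0 + info_min * (real n - real n0) \<le> info_upto (d \<gamma>) n"
        using info_upto_add_ge[of "d \<gamma>" n0 "n - n0"] n0n by (simp add: of_nat_diff)
      ultimately show ?thesis using 1 by (simp add: algebra_simps)
    qed
    define \<beta> where "\<beta> l = B \<gamma> + \<eta> \<gamma> * real l" for l :: nat
    have \<beta>: "\<beta> l \<le> (1 + \<theta>) * x" if "l \<le> R * x" for l
    proof -
      have "B \<gamma> \<le> (1 + \<theta> / 2) * x" using elim(1) x by (simp add: x_def pos_divide_less_eq less_imp_le)
      moreover have "\<eta> \<gamma> * real l \<le> \<theta> / (2 * R) * real l" using elim(2) by (intro mult_right_mono) auto
      moreover have "\<theta> / (2 * R) * real l \<le> \<theta> / (2 * R) * (R * x)" using that \<theta> R by (intro mult_left_mono) auto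
      moreover have "\<theta> / (2 * R) * (R * x) = \<theta> / 2 * x" using R by simp
      ultimately show ?thesis by (simp add: \<beta>_def algebra_simps)
    qed
    have fail: "measure (P (d \<gamma>) v) {\<omega>\<in>space (P (d \<gamma>) v). (\<Sum>j\<in>{s..<s + l}. llr (ph (d \<gamma>) v j) (X j \<omega>)) \<le> \<beta> l} \<le> q"
      if v: "1 \<le> v" "v \<le> s" and l: "real l \<le> R * x"
        and info: "(1 + 2 * \<theta>) * x \<le> (\<Sum>j\<in>{s..<s + l}. info (ph (d \<gamma>) v j))" for v s l
    proof -
      interpret V: prob_space "P (d \<gamma>) v" by (rule prob_space_P[OF v(1)])
      let ?D = "\<lambda>\<omega>. \<Sum>j\<in>{s..<s + l}. llr (ph (d \<gamma>) v j) (X j \<omega>) - info (ph (d \<gamma>) v j)"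
      have Dm: "?D \<in> borel_measurable (P (d \<gamma>) v)"
        using v by (intro borel_measurable_sum borel_measurable_diff borel_measurable_const borel_measurable_integrable[OF integrable_llr_X]) auto
      have "V.prob {\<omega>\<in>space (P (d \<gamma>) v). (\<Sum>j\<in>{s..<s + l}. llr (ph (d \<gamma>) v j) (X j \<omega>)) \<le> \<beta> l}
        \<le> V.prob {\<omega>\<in>space (P (d \<gamma>) v). \<theta> * x \<le> \<bar>?D \<omega>\<bar>}"
      proof (rule V.finite_measure_mono)
        show "{\<omega>\<in>space (P (d \<gamma>) v). (\<Sum>j\<in>{s..<s + l}. llr (ph (d \<gamma>) v j) (X j \<omega>)) \<le> \<beta> l}
            \<subseteq> {\<omega>\<in>space (P (d \<gamma>) v). \<theta> * x \<le> \<bar>?D \<omega>\<bar>}"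
          using info \<beta>[OF l] by (auto simp: sum_subtractf algebra_simps)
        show "{\<omega>\<in>space (P (d \<gamma>) v). \<theta> * x \<le> \<bar>?D \<omega>\<bar>} \<in> V.events" using Dm by measurable
      qed
      also have "\<dots> \<le> q"
      proof -
        have "{s..<s + l} \<subseteq> {v..}" using v by auto
        then show ?thesis using elim(3)[rule_format, of v "{s..<s + l}" "d \<gamma>"] v l by (simp add: x_def)
      qed
      finally show ?thesis .
    qed
    have "lorden_delay M X (P (d \<gamma>)) (\<tau> \<gamma>) \<le> ennreal (n + N * (q / (1 - q)))"
    proof (rule lorden_delay_le[OF st n(1) N(1)])
      fix v :: nat assume v: "1 \<le> v"
      show "AE \<omega> in P (d \<gamma>) v. \<forall>s k. v \<le> s \<longrightarrow> s \<le> k \<longrightarrow> enat k < \<tau> \<gamma> \<omega> \<longrightarrow>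
          (\<Sum>j = s..k. llr (ph (d \<gamma>) v j) (X j \<omega>)) \<le> \<beta> (k + 1 - s)"
        unfolding \<beta>_def using elim v by auto
      show "measure (P (d \<gamma>) v) {\<omega>\<in>space (P (d \<gamma>) v). (\<Sum>j\<in>{v..<v + n}. llr (ph (d \<gamma>) v j) (X j \<omega>)) \<le> \<beta> n} \<le> q"
        using v nR info_n by (intro fail) (auto simp: sum_info_eq_info_upto)
      fix s assume s: "v \<le> s"
      have "(1 + 2 * \<theta>) * x \<le> 2 * x" using \<theta> x by (intro mult_right_mono) auto
      also have "\<dots> \<le> info_min * N" using N(2) info_min_pos by (simp add: pos_divide_le_eq mult.commute)
      also have "\<dots> \<le> (\<Sum>j\<in>{s..<s + N}. info (ph (d \<gamma>) v j))" by (rule sum_info_ge[OF s])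
      finally show "measure (P (d \<gamma>) v) {\<omega>\<in>space (P (d \<gamma>) v). (\<Sum>j\<in>{s..<s + N}. llr (ph (d \<gamma>) v j) (X j \<omega>)) \<le> \<beta> N} \<le> q"
        using v s NR by (intro fail) auto
    qed (use q in auto)
    also have "\<dots> \<le> ennreal ((1 + \<epsilon>) * \<kappa> * x)"
    proof (rule ennreal_leI)
      have "q / (1 - q) \<le> q / (1 / 2)" using q by (intro divide_left_mono) auto
      also have "\<dots> \<le> 2 * (\<epsilon>' * \<kappa> / (2 * R))" using q by simp
      finally have "N * (q / (1 - q)) \<le> R * x * (\<epsilon>' * \<kappa> / R)"
        using NR q R x by (intro mult_mono) auto
      also have "\<dots> = \<epsilon>' * \<kappa> * x" using R by simp
      finally have "n + N * (q / (1 - q)) \<le> (1 + \<epsilon>') * \<kappa> * x + \<epsilon>' * \<kappa> * x + \<epsilon>' * \<kappa> * x"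
        using n(3) x(3) by linarith
      also have "\<dots> = (1 + \<epsilon>) * \<kappa> * x" by (simp add: \<epsilon>'_def algebra_simps)
      finally show "n + N * (q / (1 - q)) \<le> (1 + \<epsilon>) * \<kappa> * x" .
    qed
    finally show ?case by (simp add: x_def)
  qed
qed

text \<open>Equivalence to \<open>\<kappa> * ln \<gamma>\<close> in the form of two-sided bounds,
  which pass to infima and intermediate quantities in \<open>ennreal\<close> and include eventual
  finiteness.\<close>

definition first_order :: "(real \<Rightarrow> ennreal) \<Rightarrow> bool" where
  "first_order g \<longleftrightarrow> (\<forall>\<epsilon>\<in>{0<..<1}. \<forall>\<^sub>F \<gamma> in at_top.
     ennreal ((1 - \<epsilon>) * \<kappa> * ln \<gamma>) \<le> g \<gamma> \<and> g \<gamma> \<le> ennreal ((1 + \<epsilon>) * \<kappa> * ln \<gamma>))"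

lemma first_order_tendsto:
  assumes g: "first_order g"
  shows "((\<lambda>\<gamma>. enn2real (g \<gamma>) / ln \<gamma>) \<longlongrightarrow> \<kappa>) at_top"
    and "\<forall>\<^sub>F \<gamma> in at_top. g \<gamma> = ennreal (enn2real (g \<gamma>)) \<and> 0 < enn2real (g \<gamma>)"
proof -
  have ev: "\<forall>\<^sub>F \<gamma> in at_top. 1 < \<gamma> \<and> ennreal ((1 - \<epsilon>) * \<kappa> * ln \<gamma>) \<le> g \<gamma> \<and> g \<gamma> \<le> ennreal ((1 + \<epsilon>) * \<kappa> * ln \<gamma>)"
    if "0 < \<epsilon>" "\<epsilon> < 1" for \<epsilon>
  proof -
    have "\<forall>\<^sub>F \<gamma> in at_top. ennreal ((1 - \<epsilon>) * \<kappa> * ln \<gamma>) \<le> g \<gamma> \<and> g \<gamma> \<le> ennreal ((1 + \<epsilon>) * \<kappa> * ln \<gamma>)"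
      using g that unfolding first_order_def by simp
    with eventually_gt_at_top[of "1::real"] show ?thesis by eventually_elim simp
  qed
  have real: "g \<gamma> = ennreal (enn2real (g \<gamma>)) \<and> (1 - \<epsilon>) * \<kappa> * ln \<gamma> \<le> enn2real (g \<gamma>) \<and> enn2real (g \<gamma>) \<le> (1 + \<epsilon>) * \<kappa> * ln \<gamma>"
    if "1 < \<gamma> \<and> ennreal ((1 - \<epsilon>) * \<kappa> * ln \<gamma>) \<le> g \<gamma> \<and> g \<gamma> \<le> ennreal ((1 + \<epsilon>) * \<kappa> * ln \<gamma>)" "0 < \<epsilon>" "\<epsilon> < 1" for \<gamma> \<epsilon>
  proof -
    have "g \<gamma> < top" using that by (meson ennreal_less_top le_less_trans)
    then have eq: "g \<gamma> = ennreal (enn2real (g \<gamma>))" by simp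
    have "0 \<le> (1 + \<epsilon>) * \<kappa> * ln \<gamma>" using that \<kappa>_pos by simp
    then show ?thesis using that eq by (metis ennreal_le_iff ennreal_le_iff2 enn2real_nonneg)
  qed
  show "((\<lambda>\<gamma>. enn2real (g \<gamma>) / ln \<gamma>) \<longlongrightarrow> \<kappa>) at_top"
  proof (rule tendstoI)
    fix e :: real assume e: "0 < e"
    define \<epsilon> where "\<epsilon> = min (1 / 2) (e / (2 * \<kappa>))"
    have \<epsilon>: "0 < \<epsilon>" "\<epsilon> < 1" "\<epsilon> * \<kappa> < e"
    proof -
      show "0 < \<epsilon>" "\<epsilon> < 1" using e \<kappa>_pos by (auto simp: \<epsilon>_def)
      have "\<epsilon> * \<kappa> \<le> e / (2 * \<kappa>) * \<kappa>" using \<kappa>_pos by (intro mult_right_mono) (auto simp: \<epsilon>_def)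
      then show "\<epsilon> * \<kappa> < e" using \<kappa>_pos e by simp
    qed
    show "\<forall>\<^sub>F \<gamma> in at_top. dist (enn2real (g \<gamma>) / ln \<gamma>) \<kappa> < e"
      using ev[OF \<epsilon>(1,2)]
    proof eventually_elim
      case (elim \<gamma>)
      then have l: "0 < ln \<gamma>" by simp
      have "(1 - \<epsilon>) * \<kappa> \<le> enn2real (g \<gamma>) / ln \<gamma>" "enn2real (g \<gamma>) / ln \<gamma> \<le> (1 + \<epsilon>) * \<kappa>"
        using real[OF elim \<epsilon>(1,2)] l by (auto simp: pos_le_divide_eq pos_divide_le_eq)
      then have "\<bar>enn2real (g \<gamma>) / ln \<gamma> - \<kappa>\<bar> \<le> \<epsilon> * \<kappa>" by (auto simp: algebra_simps abs_le_iff)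
      then show ?case using \<epsilon>(3) by (simp add: dist_real_def)
    qed
  qed
  have half: "0 < (1 / 2 :: real)" "1 / 2 < (1 :: real)" by simp_all
  show "\<forall>\<^sub>F \<gamma> in at_top. g \<gamma> = ennreal (enn2real (g \<gamma>)) \<and> 0 < enn2real (g \<gamma>)"
    using ev[OF half]
  proof eventually_elim
    case (elim \<gamma>)
    have "0 < (1 - 1 / 2) * \<kappa> * ln \<gamma>" using elim \<kappa>_pos by simp
    then show ?case using real[OF elim half] by linarith
  qed
qed

text \<open>Both functions are eventually finite and positive, so the quotient can be computed in
  the reals, where the common scale cancels.\<close>

lemma delay_equiv_first_order:
  assumes "first_order g" "first_order g'"
  shows "delay_equiv g g'"
proof -
  note g = first_order_tendsto[OF assms(1)] and g' = first_order_tendsto[OF assms(2)]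
  have "((\<lambda>\<gamma>. (enn2real (g \<gamma>) / ln \<gamma>) / (enn2real (g' \<gamma>) / ln \<gamma>)) \<longlongrightarrow> \<kappa> / \<kappa>) at_top"
    using g(1) g'(1) \<kappa>_pos by (intro tendsto_divide) auto
  then have "((\<lambda>\<gamma>. ennreal ((enn2real (g \<gamma>) / ln \<gamma>) / (enn2real (g' \<gamma>) / ln \<gamma>))) \<longlongrightarrow> ennreal 1) at_top"
    using \<kappa>_pos by (intro tendsto_ennrealI) auto
  moreover have "\<forall>\<^sub>F \<gamma> in at_top. ennreal ((enn2real (g \<gamma>) / ln \<gamma>) / (enn2real (g' \<gamma>) / ln \<gamma>)) = g \<gamma> / g' \<gamma>"
    using g(2) g'(2) eventually_gt_at_top[of "1::real"]
  proof eventually_elim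
    case (elim \<gamma>)
    have "g \<gamma> / g' \<gamma> = ennreal (enn2real (g \<gamma>)) / ennreal (enn2real (g' \<gamma>))" using elim by simp
    also have "\<dots> = ennreal (enn2real (g \<gamma>) / enn2real (g' \<gamma>))" using elim by (intro divide_ennreal) auto
    also have "enn2real (g \<gamma>) / enn2real (g' \<gamma>) = (enn2real (g \<gamma>) / ln \<gamma>) / (enn2real (g' \<gamma>) / ln \<gamma>)"
      using elim by simp
    finally show ?case ..
  qed
  ultimately show ?thesis
    unfolding delay_equiv_def by (subst ennreal_1[symmetric]) (rule Lim_transform_eventually)
qed

lemma first_order_optimal_delay: "first_order (optimal_delay L c info)"
  unfolding first_order_def
proof
  fix \<epsilon> :: real assume \<epsilon>: "\<epsilon> \<in> {0<..<1}"
  show "\<forall>\<^sub>F \<gamma> in at_top. ennreal ((1 - \<epsilon>) * \<kappa> * ln \<gamma>) \<le> optimal_delay L c info \<gamma>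
      \<and> optimal_delay L c info \<gamma> \<le> ennreal ((1 + \<epsilon>) * \<kappa> * ln \<gamma>)"
    using eventually_gt_at_top[of "1::real"]
  proof eventually_elim
    case (elim \<gamma>)
    then have "0 \<le> \<epsilon> * (\<kappa> * ln \<gamma>)" using \<epsilon> \<kappa>_pos by simp
    then show ?case unfolding optimal_delay_eq[OF elim] by (auto intro!: ennreal_leI simp: algebra_simps)
  qed
qed

text \<open>The sandwich: the lower bound holds for every admissible rule, the upper bound for
  \<open>\<tau> \<gamma>\<close>, which is itself eventually admissible. The order between the
  delays and the infima does the rest.\<close>

lemma first_order_delays:
  fixes B \<eta> :: "real \<Rightarrow> real"
  assumes B: "((\<lambda>\<gamma>. B \<gamma> / ln \<gamma>) \<longlongrightarrow> 1) at_top" and \<eta>: "(\<eta> \<longlongrightarrow> 0) at_top"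
    and st: "\<And>\<gamma>. stopping_time (obs_filtration Pinf M X) (\<tau> \<gamma>)"
    and stop: "\<forall>\<^sub>F \<gamma> in at_top. \<forall>v\<ge>1. AE \<omega> in P (d \<gamma>) v. \<forall>s k. v \<le> s \<longrightarrow> s \<le> k \<longrightarrow> enat k < \<tau> \<gamma> \<omega> \<longrightarrow>
        (\<Sum>j = s..k. llr (ph (d \<gamma>) v j) (X j \<omega>)) \<le> B \<gamma> + \<eta> \<gamma> * real (k + 1 - s)"
    and fa: "\<forall>\<^sub>F \<gamma> in at_top. ennreal \<gamma> \<le> false_alarm_time Pinf (\<tau> \<gamma>)"
  shows "first_order (\<lambda>\<gamma>. lorden_delay M X (P (d \<gamma>)) (\<tau> \<gamma>))"
    and "first_order (\<lambda>\<gamma>. INF \<sigma>\<in>admissible Pinf M X \<gamma>. lorden_delay M X (P (d \<gamma>)) \<sigma>)"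
    and "first_order (\<lambda>\<gamma>. pollak_delay (P (d \<gamma>)) (\<tau> \<gamma>))"
    and "first_order (\<lambda>\<gamma>. INF \<sigma>\<in>admissible Pinf M X \<gamma>. pollak_delay (P (d \<gamma>)) \<sigma>)"
proof -
  have ev: "\<forall>\<^sub>F \<gamma> in at_top. \<tau> \<gamma> \<in> admissible Pinf M X \<gamma>
      \<and> (\<forall>\<sigma>\<in>admissible Pinf M X \<gamma>. ennreal ((1 - \<epsilon>) * \<kappa> * ln \<gamma>) \<le> pollak_delay (P (d \<gamma>)) \<sigma>)
      \<and> lorden_delay M X (P (d \<gamma>)) (\<tau> \<gamma>) \<le> ennreal ((1 + \<epsilon>) * \<kappa> * ln \<gamma>)"
    if "\<epsilon> \<in> {0<..<1}" for \<epsilon>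
    using that st fa
    by (intro eventually_conj pollak_delay_asymp_ge lorden_delay_asymp_le[OF _ B \<eta> st stop])
       (auto simp: admissible_def elim!: eventually_mono)
  have pl: "pollak_delay (P d) \<sigma> \<le> lorden_delay M X (P d) \<sigma>" if "\<sigma> \<in> admissible Pinf M X \<gamma>" for d \<sigma> \<gamma>
    using that by (intro pollak_le_lorden) (simp add: admissible_def)
  show "first_order (\<lambda>\<gamma>. lorden_delay M X (P (d \<gamma>)) (\<tau> \<gamma>))"
    unfolding first_order_def by (intro ballI eventually_mono[OF ev]) (auto intro: order_trans[OF _ pl])
  show "first_order (\<lambda>\<gamma>. INF \<sigma>\<in>admissible Pinf M X \<gamma>. lorden_delay M X (P (d \<gamma>)) \<sigma>)"
    unfolding first_order_def
    by (intro ballI eventually_mono[OF ev]) (auto intro!: INF_greatest intro: order_trans[OF _ pl] INF_lower2)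
  show "first_order (\<lambda>\<gamma>. pollak_delay (P (d \<gamma>)) (\<tau> \<gamma>))"
    unfolding first_order_def by (intro ballI eventually_mono[OF ev]) (auto intro: order_trans[OF pl])
  show "first_order (\<lambda>\<gamma>. INF \<sigma>\<in>admissible Pinf M X \<gamma>. pollak_delay (P (d \<gamma>)) \<sigma>)"
    unfolding first_order_def
    by (intro ballI eventually_mono[OF ev]) (auto intro!: INF_greatest intro: INF_lower2 order_trans[OF pl])
qed

lemma ln_equiv_tendsto:
  fixes b :: "real \<Rightarrow> real"
  assumes "b \<sim>[at_top] ln"
  shows "((\<lambda>\<gamma>. b \<gamma> / ln \<gamma>) \<longlongrightarrow> 1) at_top" and "filterlim b at_top at_top"
proof -
  have "\<forall>\<^sub>F \<gamma> :: real in at_top. ln \<gamma> \<noteq> 0"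
    using eventually_gt_at_top[of "1::real"] by eventually_elim simp
  then have "\<forall>\<^sub>F \<gamma> in at_top. b \<gamma> \<noteq> 0 \<or> ln \<gamma> \<noteq> 0" by (rule eventually_mono) simp
  then show "((\<lambda>\<gamma>. b \<gamma> / ln \<gamma>) \<longlongrightarrow> 1) at_top" by (rule asymp_equivD_strong[OF assms])
  show "filterlim b at_top at_top"
    by (rule asymp_equiv_at_top_transfer[OF asymp_equiv_symI[OF assms] ln_at_top])
qed

text \<open>The zero term per observation gives the bound the shape shared with the weighted
  rule.\<close>

lemma dcusum_stop:
  "\<forall>v\<ge>1. AE \<omega> in P d' v. \<forall>s k. v \<le> s \<longrightarrow> s \<le> k \<longrightarrow> enat k < dcusum L f X b \<omega> \<longrightarrow>
     (\<Sum>j = s..k. llr (ph d' v j) (X j \<omega>)) \<le> b + 0 * real (k + 1 - s)"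
proof (intro allI impI)
  fix v :: nat assume v: "1 \<le> v"
  show "AE \<omega> in P d' v. \<forall>s k. v \<le> s \<longrightarrow> s \<le> k \<longrightarrow> enat k < dcusum L f X b \<omega> \<longrightarrow>
     (\<Sum>j = s..k. llr (ph d' v j) (X j \<omega>)) \<le> b + 0 * real (k + 1 - s)"
    using AE_pos_all[OF v, of d'] by eventually_elim (use dcusum_not_stopped[OF v] in auto)
qed

lemma wdcusum_stop:
  assumes "\<And>i. i \<in> {1..<L} \<Longrightarrow> 0 < \<rho> i \<and> \<rho> i < 1"
  shows "\<forall>v\<ge>1. AE \<omega> in P d' v. \<forall>s k. v \<le> s \<longrightarrow> s \<le> k \<longrightarrow> enat k < wdcusum L f X \<rho> b \<omega> \<longrightarrow>
     (\<Sum>j = s..k. llr (ph d' v j) (X j \<omega>)) \<le> (b + switch_loss \<rho>) + stay_loss \<rho> * real (k + 1 - s)"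
proof (intro allI impI)
  fix v :: nat assume v: "1 \<le> v"
  show "AE \<omega> in P d' v. \<forall>s k. v \<le> s \<longrightarrow> s \<le> k \<longrightarrow> enat k < wdcusum L f X \<rho> b \<omega> \<longrightarrow>
     (\<Sum>j = s..k. llr (ph d' v j) (X j \<omega>)) \<le> (b + switch_loss \<rho>) + stay_loss \<rho> * real (k + 1 - s)"
    using AE_pos_all[OF v, of d']
    by eventually_elim (intro allI impI, rule wdcusum_not_stopped[OF v _ _ _ assms], assumption+)
qed

lemma first_order_dcusum:
  assumes "b \<sim>[at_top] ln"
    and "\<forall>\<^sub>F \<gamma> in at_top. ennreal \<gamma> \<le> false_alarm_time Pinf (dcusum L f X (b \<gamma>))"
  shows "first_order (\<lambda>\<gamma>. lorden_delay M X (P (d \<gamma>)) (dcusum L f X (b \<gamma>)))"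
    and "first_order (\<lambda>\<gamma>. INF \<sigma>\<in>admissible Pinf M X \<gamma>. lorden_delay M X (P (d \<gamma>)) \<sigma>)"
    and "first_order (\<lambda>\<gamma>. pollak_delay (P (d \<gamma>)) (dcusum L f X (b \<gamma>)))"
    and "first_order (\<lambda>\<gamma>. INF \<sigma>\<in>admissible Pinf M X \<gamma>. pollak_delay (P (d \<gamma>)) \<sigma>)"
  by (rule first_order_delays[OF ln_equiv_tendsto(1)[OF assms(1)] tendsto_const stopping_time_dcusum
        always_eventually[OF allI[OF dcusum_stop]] assms(2)])+

text \<open>The conditions on the weights balance two losses:
  \<open>- ln (\<rho> \<beta> i) / \<beta>\<close> tending to 0 keeps the transition losses below
  the order of the threshold, and \<open>\<rho> \<beta> i\<close> tending to 0 makes the loss per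
  observation vanish. As \<open>b \<gamma>\<close> tends to infinity, both limits transfer to
  \<open>\<gamma>\<close>.\<close>

lemma first_order_wdcusum:
  assumes \<rho>: "\<forall>i\<in>{1..L - 1}. (\<forall>\<beta>>0. 0 < \<rho> \<beta> i \<and> \<rho> \<beta> i < 1) \<and> ((\<lambda>\<beta>. \<rho> \<beta> i) \<longlongrightarrow> 0) at_top
      \<and> ((\<lambda>\<beta>. - ln (\<rho> \<beta> i) / \<beta>) \<longlongrightarrow> 0) at_top"
    and b: "b \<sim>[at_top] ln"
    and fa: "\<forall>\<^sub>F \<gamma> in at_top. ennreal \<gamma> \<le> false_alarm_time Pinf (wdcusum L f X (\<rho> (b \<gamma>)) (b \<gamma>))"
  shows "first_order (\<lambda>\<gamma>. lorden_delay M X (P (d \<gamma>)) (wdcusum L f X (\<rho> (b \<gamma>)) (b \<gamma>)))"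
    and "first_order (\<lambda>\<gamma>. INF \<sigma>\<in>admissible Pinf M X \<gamma>. lorden_delay M X (P (d \<gamma>)) \<sigma>)"
    and "first_order (\<lambda>\<gamma>. pollak_delay (P (d \<gamma>)) (wdcusum L f X (\<rho> (b \<gamma>)) (b \<gamma>)))"
    and "first_order (\<lambda>\<gamma>. INF \<sigma>\<in>admissible Pinf M X \<gamma>. pollak_delay (P (d \<gamma>)) \<sigma>)"
proof -
  note b_lim = ln_equiv_tendsto[OF b]
  have iL: "i \<in> {1..L - 1}" if "i \<in> {1..<L}" for i using that by auto
  have b_pos: "\<forall>\<^sub>F \<gamma> in at_top. 0 < b \<gamma>"
    using b_lim(2) by (simp add: filterlim_at_top_dense)
  have "((\<lambda>\<beta>. \<Sum>i = 1..<L. - ln (\<rho> \<beta> i) / \<beta>) \<longlongrightarrow> (\<Sum>i = 1..<L. 0)) at_top"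
    using \<rho> iL by (intro tendsto_sum) blast
  then have "((\<lambda>\<beta>. switch_loss (\<rho> \<beta>) / \<beta>) \<longlongrightarrow> 0) at_top"
    by (simp add: switch_loss_def sum_divide_distrib)
  then have "((\<lambda>\<gamma>. switch_loss (\<rho> (b \<gamma>)) / b \<gamma>) \<longlongrightarrow> 0) at_top"
    using b_lim(2) by (rule filterlim_compose)
  \<comment> \<open>Factoring out \<open>b \<gamma>\<close> separates the relative transition loss
    from the equivalence of \<open>b\<close> with \<open>ln\<close>.\<close>
  then have "((\<lambda>\<gamma>. (1 + switch_loss (\<rho> (b \<gamma>)) / b \<gamma>) * (b \<gamma> / ln \<gamma>)) \<longlongrightarrow> (1 + 0) * 1) at_top"
    by (intro tendsto_mult tendsto_add tendsto_const b_lim(1))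
  moreover have "\<forall>\<^sub>F \<gamma> in at_top. (1 + switch_loss (\<rho> (b \<gamma>)) / b \<gamma>) * (b \<gamma> / ln \<gamma>) = (b \<gamma> + switch_loss (\<rho> (b \<gamma>))) / ln \<gamma>"
    using b_pos by eventually_elim (simp add: distrib_right)
  ultimately have B: "((\<lambda>\<gamma>. (b \<gamma> + switch_loss (\<rho> (b \<gamma>))) / ln \<gamma>) \<longlongrightarrow> 1) at_top"
    using Lim_transform_eventually by fastforce
  have "((\<lambda>\<beta>. \<Sum>i = 1..<L. - ln (1 - \<rho> \<beta> i)) \<longlongrightarrow> (\<Sum>i = 1..<L. - ln (1 - 0))) at_top"
    using \<rho> iL by (intro tendsto_sum tendsto_minus tendsto_ln tendsto_diff tendsto_const) auto
  then have "((\<lambda>\<beta>. stay_loss (\<rho> \<beta>)) \<longlongrightarrow> 0) at_top" by (simp add: stay_loss_def)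
  then have \<eta>: "((\<lambda>\<gamma>. stay_loss (\<rho> (b \<gamma>))) \<longlongrightarrow> 0) at_top"
    using b_lim(2) by (rule filterlim_compose)
  have stop: "\<forall>\<^sub>F \<gamma> in at_top. \<forall>v\<ge>1. AE \<omega> in P (d \<gamma>) v. \<forall>s k. v \<le> s \<longrightarrow> s \<le> k \<longrightarrow>
      enat k < wdcusum L f X (\<rho> (b \<gamma>)) (b \<gamma>) \<omega> \<longrightarrow>
      (\<Sum>j = s..k. llr (ph (d \<gamma>) v j) (X j \<omega>))
        \<le> (b \<gamma> + switch_loss (\<rho> (b \<gamma>))) + stay_loss (\<rho> (b \<gamma>)) * real (k + 1 - s)"
    using b_pos
  proof eventually_elim
    case (elim \<gamma>)
    then show ?case using \<rho> iL by (intro wdcusum_stop) auto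
  qed
  show "first_order (\<lambda>\<gamma>. lorden_delay M X (P (d \<gamma>)) (wdcusum L f X (\<rho> (b \<gamma>)) (b \<gamma>)))"
    and "first_order (\<lambda>\<gamma>. INF \<sigma>\<in>admissible Pinf M X \<gamma>. lorden_delay M X (P (d \<gamma>)) \<sigma>)"
    and "first_order (\<lambda>\<gamma>. pollak_delay (P (d \<gamma>)) (wdcusum L f X (\<rho> (b \<gamma>)) (b \<gamma>)))"
    and "first_order (\<lambda>\<gamma>. INF \<sigma>\<in>admissible Pinf M X \<gamma>. pollak_delay (P (d \<gamma>)) \<sigma>)"
    by (rule first_order_delays[OF B \<eta> stopping_time_wdcusum stop fa])+
qed

end

theorem theorem7:
  fixes L :: nat
    and M :: "'a measure"
    and f :: "nat \<Rightarrow> 'a \<Rightarrow> real"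
    and X :: "nat \<Rightarrow> 'w \<Rightarrow> 'a"
    and Pinf :: "'w measure"
    and P :: "(nat \<Rightarrow> nat) \<Rightarrow> nat \<Rightarrow> 'w measure"
    and d :: "real \<Rightarrow> nat \<Rightarrow> nat"
    and c :: "nat \<Rightarrow> ennreal"
  assumes "2 \<le> L"
    and "transient_change_model L M f X Pinf P"
    and "\<And>i. i \<in> {1..L - 1} \<Longrightarrow> filterlim (\<lambda>\<gamma>. d \<gamma> i) at_top at_top"
    and "\<And>i. i \<in> {1..L - 1} \<Longrightarrow>
           ((\<lambda>\<gamma>. ennreal (real (d \<gamma> i) * KL_info M f i / ln \<gamma>)) \<longlongrightarrow> c i) at_top"
    and "c L = \<infinity>"
  shows
    "(\<forall>b :: real \<Rightarrow> real.
        b \<sim>[at_top] ln \<longrightarrow>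
        (\<forall>\<^sub>F \<gamma> in at_top. ennreal \<gamma> \<le> false_alarm_time Pinf (dcusum L f X (b \<gamma>))) \<longrightarrow>
        delay_equiv (\<lambda>\<gamma>. lorden_delay M X (P (d \<gamma>)) (dcusum L f X (b \<gamma>)))
                    (\<lambda>\<gamma>. INF \<tau>\<in>admissible Pinf M X \<gamma>. lorden_delay M X (P (d \<gamma>)) \<tau>) \<and>
        delay_equiv (\<lambda>\<gamma>. INF \<tau>\<in>admissible Pinf M X \<gamma>. lorden_delay M X (P (d \<gamma>)) \<tau>)
                    (\<lambda>\<gamma>. pollak_delay (P (d \<gamma>)) (dcusum L f X (b \<gamma>))) \<and>
        delay_equiv (\<lambda>\<gamma>. pollak_delay (P (d \<gamma>)) (dcusum L f X (b \<gamma>)))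
                    (\<lambda>\<gamma>. INF \<tau>\<in>admissible Pinf M X \<gamma>. pollak_delay (P (d \<gamma>)) \<tau>) \<and>
        delay_equiv (\<lambda>\<gamma>. INF \<tau>\<in>admissible Pinf M X \<gamma>. pollak_delay (P (d \<gamma>)) \<tau>)
                    (optimal_delay L c (KL_info M f)))
     \<and>
     (\<forall>(\<rho> :: real \<Rightarrow> nat \<Rightarrow> real) (b :: real \<Rightarrow> real).
        (\<forall>i\<in>{1..L - 1}. (\<forall>\<beta>>0. 0 < \<rho> \<beta> i \<and> \<rho> \<beta> i < 1) \<and>
           ((\<lambda>\<beta>. \<rho> \<beta> i) \<longlongrightarrow> 0) at_top \<and>
           ((\<lambda>\<beta>. - ln (\<rho> \<beta> i) / \<beta>) \<longlongrightarrow> 0) at_top) \<longrightarrow>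
        b \<sim>[at_top] ln \<longrightarrow>
        (\<forall>\<^sub>F \<gamma> in at_top. ennreal \<gamma> \<le> false_alarm_time Pinf (wdcusum L f X (\<rho> (b \<gamma>)) (b \<gamma>))) \<longrightarrow>
        delay_equiv (\<lambda>\<gamma>. lorden_delay M X (P (d \<gamma>)) (wdcusum L f X (\<rho> (b \<gamma>)) (b \<gamma>)))
                    (\<lambda>\<gamma>. INF \<tau>\<in>admissible Pinf M X \<gamma>. lorden_delay M X (P (d \<gamma>)) \<tau>) \<and>
        delay_equiv (\<lambda>\<gamma>. INF \<tau>\<in>admissible Pinf M X \<gamma>. lorden_delay M X (P (d \<gamma>)) \<tau>)
                    (\<lambda>\<gamma>. pollak_delay (P (d \<gamma>)) (wdcusum L f X (\<rho> (b \<gamma>)) (b \<gamma>))) \<and>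
        delay_equiv (\<lambda>\<gamma>. pollak_delay (P (d \<gamma>)) (wdcusum L f X (\<rho> (b \<gamma>)) (b \<gamma>)))
                    (\<lambda>\<gamma>. INF \<tau>\<in>admissible Pinf M X \<gamma>. pollak_delay (P (d \<gamma>)) \<tau>) \<and>
        delay_equiv (\<lambda>\<gamma>. INF \<tau>\<in>admissible Pinf M X \<gamma>. pollak_delay (P (d \<gamma>)) \<tau>)
                    (optimal_delay L c (KL_info M f)))"
proof -
  interpret transient_change_model L M f X Pinf P by (rule assms(2))
  interpret growing_durations L M f X Pinf P d c
    by unfold_locales (use assms(1,4,5) in auto)
  show ?thesis
  proof (intro conjI allI impI)
    fix b assume b: "b \<sim>[at_top] ln"
      "\<forall>\<^sub>F \<gamma> in at_top. ennreal \<gamma> \<le> false_alarm_time Pinf (dcusum L f X (b \<gamma>))"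
    note fo = first_order_dcusum[OF b]
    show "delay_equiv (\<lambda>\<gamma>. lorden_delay M X (P (d \<gamma>)) (dcusum L f X (b \<gamma>)))
        (\<lambda>\<gamma>. INF \<tau>\<in>admissible Pinf M X \<gamma>. lorden_delay M X (P (d \<gamma>)) \<tau>)"
      by (rule delay_equiv_first_order[OF fo(1,2)])
    show "delay_equiv (\<lambda>\<gamma>. INF \<tau>\<in>admissible Pinf M X \<gamma>. lorden_delay M X (P (d \<gamma>)) \<tau>)
        (\<lambda>\<gamma>. pollak_delay (P (d \<gamma>)) (dcusum L f X (b \<gamma>)))"
      by (rule delay_equiv_first_order[OF fo(2,3)])
    show "delay_equiv (\<lambda>\<gamma>. pollak_delay (P (d \<gamma>)) (dcusum L f X (b \<gamma>)))
        (\<lambda>\<gamma>. INF \<tau>\<in>admissible Pinf M X \<gamma>. pollak_delay (P (d \<gamma>)) \<tau>)"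
      by (rule delay_equiv_first_order[OF fo(3,4)])
    show "delay_equiv (\<lambda>\<gamma>. INF \<tau>\<in>admissible Pinf M X \<gamma>. pollak_delay (P (d \<gamma>)) \<tau>)
        (optimal_delay L c (KL_info M f))"
      by (rule delay_equiv_first_order[OF fo(4) first_order_optimal_delay])
  next
    fix \<rho> :: "real \<Rightarrow> nat \<Rightarrow> real" and b
    assume b: "\<forall>i\<in>{1..L - 1}. (\<forall>\<beta>>0. 0 < \<rho> \<beta> i \<and> \<rho> \<beta> i < 1) \<and> ((\<lambda>\<beta>. \<rho> \<beta> i) \<longlongrightarrow> 0) at_top
        \<and> ((\<lambda>\<beta>. - ln (\<rho> \<beta> i) / \<beta>) \<longlongrightarrow> 0) at_top"
      "b \<sim>[at_top] ln"
      "\<forall>\<^sub>F \<gamma> in at_top. ennreal \<gamma> \<le> false_alarm_time Pinf (wdcusum L f X (\<rho> (b \<gamma>)) (b \<gamma>))"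
    note fo = first_order_wdcusum[OF b]
    show "delay_equiv (\<lambda>\<gamma>. lorden_delay M X (P (d \<gamma>)) (wdcusum L f X (\<rho> (b \<gamma>)) (b \<gamma>)))
        (\<lambda>\<gamma>. INF \<tau>\<in>admissible Pinf M X \<gamma>. lorden_delay M X (P (d \<gamma>)) \<tau>)"
      by (rule delay_equiv_first_order[OF fo(1,2)])
    show "delay_equiv (\<lambda>\<gamma>. INF \<tau>\<in>admissible Pinf M X \<gamma>. lorden_delay M X (P (d \<gamma>)) \<tau>)
        (\<lambda>\<gamma>. pollak_delay (P (d \<gamma>)) (wdcusum L f X (\<rho> (b \<gamma>)) (b \<gamma>)))"
      by (rule delay_equiv_first_order[OF fo(2,3)])
    show "delay_equiv (\<lambda>\<gamma>. pollak_delay (P (d \<gamma>)) (wdcusum L f X (\<rho> (b \<gamma>)) (b \<gamma>)))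
        (\<lambda>\<gamma>. INF \<tau>\<in>admissible Pinf M X \<gamma>. pollak_delay (P (d \<gamma>)) \<tau>)"
      by (rule delay_equiv_first_order[OF fo(3,4)])
    show "delay_equiv (\<lambda>\<gamma>. INF \<tau>\<in>admissible Pinf M X \<gamma>. pollak_delay (P (d \<gamma>)) \<tau>)
        (optimal_delay L c (KL_info M f))"
      by (rule delay_equiv_first_order[OF fo(4) first_order_optimal_delay])
  qed
qed

end
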